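(* Let $\hat M\xrightarrow{\hat\pi}\mathbb{C}/\Lambda'$ be a two torus with $a(\hat M)=1$, and $\tilde p:\tilde M=\mathbb{C}^2\to\hat M$ its universal covering with global coordinates $(z_1,z_2)$. Let $\mathcal{E}_0$ be the field of $\Lambda'$-elliptic meromorphic functions of $z_1$. Then the map from the set of meromorphic affine connections on $\hat M$ to $\mathcal{E}_0^8$ which sends $\hat\nabla$ to the coefficients $(f_{ij},g_{ij})_{i,j=1,2}$ of the matrix $$dz_1\otimes(f_{ij})_{i,j=1,2}+dz_2\otimes(g_{ij})_{i,j=1,2}$$ of $\tilde\nabla=\tilde p^\star\hat\nabla$ in $\left(\frac{\partial}{\partial z_1},\frac{\partial}{\partial z_2}\right)$ is a bijection.
   Context: A meromorphic affine connection on a complex manifold $M$ with poles at an effective divisor $D$ is a $\mathbb{C}$-linear morphism of sheaves $\nabla: TM\to \Omega^1_M\otimes TM( *D)$ satisfying the Leibniz rule (any $D$ is allowed). Its matrix $A$ in a frame $(e_1,e_2)$ is defined by $\nabla e_j=\sum_iA_{ij}\otimes e_i$. $a(\hat M)$ is the transcendence degree of the field of meromorphic functions. A two torus here is an elliptic surface $\hat M=G\backslash\mathbb{C}^2$, where $G$ is a (lattice) subgroup of translations of $\mathbb{C}^2$, with $\hat\pi([z_1,z_2])=[z_1]\in\mathbb{C}/\Lambda'$, $\Lambda'$ being a lattice in $\mathbb{C}$; $\hat\pi$ is its algebraic reduction. *)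

theory Defs
  imports
    "HOL-Complex_Analysis.Complex_Analysis"
    "HOL-Library.Extended_Nat"
    "HOL-Library.Multiset"
begin

section \<open>Holomorphic and meromorphic functions of several variables\<close>

definition holo_on :: "(complex ^ 'n \<Rightarrow> complex) \<Rightarrow> (complex ^ 'n) set \<Rightarrow> bool" where
  "holo_on f U \<longleftrightarrow> open U \<and>
     (\<forall>z\<in>U. \<exists>a :: complex ^ 'n. (f has_derivative (\<lambda>h. \<Sum>i\<in>UNIV. a $ i * h $ i)) (at z))"

definition pd :: "'n \<Rightarrow> (complex ^ 'n \<Rightarrow> complex) \<Rightarrow> complex ^ 'n \<Rightarrow> complex" where
  "pd k f z = deriv (\<lambda>t. f (z + axis k t)) 0"

definition jacobian :: "(complex ^ 'n \<Rightarrow> complex ^ 'n) \<Rightarrow> complex ^ 'n \<Rightarrow> complex ^ 'n ^ 'n" where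
  "jacobian F z = (\<chi> i k. pd k (\<lambda>w. F w $ i) z)"

text \<open>
  Identities between meromorphic functions are identities on a dense open subset: the
  value of a total function at a pole carries no information.
\<close>

definition generically_eq ::
    "'a::topological_space set \<Rightarrow> ('a \<Rightarrow> 'b) \<Rightarrow> ('a \<Rightarrow> 'b) \<Rightarrow> bool" where
  "generically_eq U f g \<longleftrightarrow> U \<subseteq> closure (interior {z\<in>U. f z = g z})"

text \<open>
  A meromorphic function is represented by a unique total function, as for
  \<^const>\<open>nicely_meromorphic_on\<close> in one variable: it takes its holomorphically extended value
  wherever there is one, and the value 0 at poles and at points of indeterminacy.
\<close>

definition regular_value :: "(complex ^ 'n \<Rightarrow> complex) \<Rightarrow> complex ^ 'n \<Rightarrow> complex \<Rightarrow> bool" where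
  "regular_value f z v \<longleftrightarrow>
     (\<exists>N F. open N \<and> z \<in> N \<and> holo_on F N \<and> generically_eq N f F \<and> F z = v)"

definition regularize :: "(complex ^ 'n \<Rightarrow> complex) \<Rightarrow> complex ^ 'n \<Rightarrow> complex" where
  "regularize f z = (if \<exists>v. regular_value f z v then THE v. regular_value f z v else 0)"

definition mero_on :: "(complex ^ 'n \<Rightarrow> complex) \<Rightarrow> (complex ^ 'n) set \<Rightarrow> bool" where
  "mero_on f U \<longleftrightarrow> open U \<and>
     (\<forall>z\<in>U. \<exists>N g h. open N \<and> z \<in> N \<and> holo_on g N \<and> holo_on h N \<and>
        N \<subseteq> closure {w\<in>N. h w \<noteq> 0} \<and> generically_eq N f (\<lambda>w. g w / h w)) \<and>
     (\<forall>z\<in>U. f z = regularize f z)"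


section \<open>Complex manifolds\<close>

text \<open>
  A manifold is given by an atlas. A chart \<open>(V, \<psi>)\<close> is a local parametrization
  \<open>\<psi> : V \<rightarrow> M\<close>, i.e. the inverse of a coordinate map, with \<open>V\<close> an open set of the
  model space.
\<close>

type_synonym ('a, 'n) chart = "(complex, 'n) vec set \<times> ((complex, 'n) vec \<Rightarrow> 'a)"
type_synonym ('a, 'n) atlas = "('a, 'n) chart set"

definition carrier_of :: "('a, 'n::finite) atlas \<Rightarrow> 'a set" where
  "carrier_of \<A> = (\<Union>c\<in>\<A>. snd c ` fst c)"

definition coords :: "('a, 'n::finite) chart \<Rightarrow> 'a set \<Rightarrow> (complex ^ 'n) set" where
  "coords c U = {z \<in> fst c. snd c z \<in> U}"

definition manifold_topology :: "('a, 'n::finite) atlas \<Rightarrow> 'a topology" where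
  "manifold_topology \<A> = topology (\<lambda>U. U \<subseteq> carrier_of \<A> \<and> (\<forall>c\<in>\<A>. open (coords c U)))"

lemma openin_manifold_topology:
  fixes \<A> :: "('a, 'n::finite) atlas"
  shows "openin (manifold_topology \<A>) U \<longleftrightarrow> U \<subseteq> carrier_of \<A> \<and> (\<forall>c\<in>\<A>. open (coords c U))"
proof -
  have 1: "coords c (S \<inter> T) = coords c S \<inter> coords c T" for c :: "('a, 'n) chart" and S T
    by (auto simp: coords_def)
  have 2: "coords c (\<Union>K) = (\<Union>S\<in>K. coords c S)" for c :: "('a, 'n) chart" and K
    by (auto simp: coords_def)
  have "istopology (\<lambda>U. U \<subseteq> carrier_of \<A> \<and> (\<forall>c\<in>\<A>. open (coords c U)))"
    unfolding istopology_def by (auto simp: 1 2)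
  then show ?thesis
    by (simp add: manifold_topology_def)
qed

text \<open>
  The expression \<open>\<psi>\<^sub>c\<^sup>-\<^sup>1 \<circ> p \<circ> \<psi>\<^sub>b\<close> of a map \<open>p\<close> in the charts \<open>b\<close> and \<open>c\<close>, and its domain within
  an open set \<open>U\<close>. For \<open>p = id\<close> this is a change of charts.
\<close>

definition local_expr ::
    "('a \<Rightarrow> 'b) \<Rightarrow> ('a, 'n::finite) chart \<Rightarrow> ('b, 'n) chart \<Rightarrow> complex ^ 'n \<Rightarrow> complex ^ 'n" where
  "local_expr p b c w = inv_into (fst c) (snd c) (p (snd b w))"

definition local_dom ::
    "('a \<Rightarrow> 'b) \<Rightarrow> ('a, 'n::finite) chart \<Rightarrow> ('b, 'n) chart \<Rightarrow> 'a set \<Rightarrow> (complex ^ 'n) set" where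
  "local_dom p b c U = {w \<in> coords b U. p (snd b w) \<in> snd c ` fst c}"

definition complex_atlas :: "('a, 'n::finite) atlas \<Rightarrow> bool" where
  "complex_atlas \<A> \<longleftrightarrow>
     (\<forall>c\<in>\<A>. open (fst c) \<and> inj_on (snd c) (fst c)) \<and>
     (\<forall>b\<in>\<A>. \<forall>c\<in>\<A>. \<forall>i. holo_on (\<lambda>w. local_expr id b c w $ i) (local_dom id b c (carrier_of \<A>)))"

definition holo_fun :: "('a, 'n::finite) atlas \<Rightarrow> 'a set \<Rightarrow> ('a \<Rightarrow> complex) \<Rightarrow> bool" where
  "holo_fun \<A> U f \<longleftrightarrow> (\<forall>c\<in>\<A>. holo_on (\<lambda>z. f (snd c z)) (coords c U))"

definition mero_functions :: "('a, 'n::finite) atlas \<Rightarrow> ('a \<Rightarrow> complex) set" where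
  "mero_functions \<A> = {f. (\<forall>x. x \<notin> carrier_of \<A> \<longrightarrow> f x = 0) \<and>
     (\<forall>c\<in>\<A>. mero_on (\<lambda>z. f (snd c z)) (fst c))}"

text \<open>
  Algebraic independence over \<open>\<complex>\<close>. A polynomial in the elements of \<open>B\<close> is given by a finite
  set \<open>S\<close> of monomials, each of them a multiset over \<open>B\<close>, and the coefficients \<open>a\<close>.
\<close>

definition alg_independent :: "('a, 'n::finite) atlas \<Rightarrow> ('a \<Rightarrow> complex) set \<Rightarrow> bool" where
  "alg_independent \<A> B \<longleftrightarrow> B \<subseteq> mero_functions \<A> \<and>
     (\<forall>(S :: ('a \<Rightarrow> complex) multiset set) (a :: ('a \<Rightarrow> complex) multiset \<Rightarrow> complex).
        finite S \<and> (\<forall>m\<in>S. set_mset m \<subseteq> B) \<and>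
        (\<forall>c\<in>\<A>. generically_eq (fst c)
           (\<lambda>z. \<Sum>m\<in>S. a m * (\<Prod>b\<in>#m. b (snd c z))) (\<lambda>_. 0))
        \<longrightarrow> (\<forall>m\<in>S. a m = 0))"

definition algebraic_dimension :: "('a, 'n::finite) atlas \<Rightarrow> enat" where
  "algebraic_dimension \<A> = (SUP B\<in>{B. finite B \<and> alg_independent \<A> B}. enat (card B))"


section \<open>Vector fields and vector-valued one-forms\<close>

text \<open>
  A local section of \<open>TM\<close> is the family of its component vectors in all charts, as functions of the
  coordinates. A local section \<open>\<omega>\<close> of \<open>\<Omega>\<^sup>1 \<otimes> TM\<close> is a family of matrices: \<open>\<omega> c z $ i $ k\<close> is
  the coefficient of \<open>dz\<^sub>k \<otimes> \<partial>/\<partial>z\<^sub>i\<close> in the chart \<open>c\<close>. Components are 0 outside the domain of the section.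
\<close>

type_synonym ('a, 'n) vfield = "('a, 'n) chart \<Rightarrow> (complex, 'n) vec \<Rightarrow> (complex, 'n) vec"
type_synonym ('a, 'n) vform =
  "('a, 'n) chart \<Rightarrow> (complex, 'n) vec \<Rightarrow> ((complex, 'n) vec, 'n) vec"

text \<open>
  Sections \<open>X\<close> over \<open>U\<close> and \<open>Y\<close> over \<open>p(U)\<close> are \<open>p\<close>-related if \<open>dp\<close> takes one to the other;
  for vector-valued forms, if \<open>\<eta> \<circ> dp = dp \<circ> \<omega>\<close>. When \<open>p\<close> is biholomorphic on \<open>U\<close> this says that
  the section over \<open>U\<close> is the pullback of the other one. For \<open>p = id\<close> it is the
  transformation law under changes of charts.
\<close>

definition vfield_related ::
    "('a, 'n::finite) atlas \<Rightarrow> ('b, 'n) atlas \<Rightarrow> ('a \<Rightarrow> 'b) \<Rightarrow> 'a set \<Rightarrow>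
     ('a, 'n) vfield \<Rightarrow> ('b, 'n) vfield \<Rightarrow> bool" where
  "vfield_related \<B> \<A> p U X Y \<longleftrightarrow>
     (\<forall>b\<in>\<B>. \<forall>c\<in>\<A>. \<forall>w\<in>local_dom p b c U.
        Y c (local_expr p b c w) = jacobian (local_expr p b c) w *v X b w)"

definition vform_related ::
    "('a, 'n::finite) atlas \<Rightarrow> ('b, 'n) atlas \<Rightarrow> ('a \<Rightarrow> 'b) \<Rightarrow> 'a set \<Rightarrow>
     ('a, 'n) vform \<Rightarrow> ('b, 'n) vform \<Rightarrow> bool" where
  "vform_related \<B> \<A> p U \<omega> \<eta> \<longleftrightarrow>
     (\<forall>b\<in>\<B>. \<forall>c\<in>\<A>. generically_eq (local_dom p b c U)
        (\<lambda>w. \<eta> c (local_expr p b c w) ** jacobian (local_expr p b c) w)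
        (\<lambda>w. jacobian (local_expr p b c) w ** \<omega> b w))"

definition vector_fields :: "('a, 'n::finite) atlas \<Rightarrow> 'a set \<Rightarrow> ('a, 'n) vfield set" where
  "vector_fields \<A> U = {X.
     (\<forall>c z. \<not> (c \<in> \<A> \<and> z \<in> coords c U) \<longrightarrow> X c z = 0) \<and>
     (\<forall>c\<in>\<A>. \<forall>i. holo_on (\<lambda>z. X c z $ i) (coords c U)) \<and>
     vfield_related \<A> \<A> id U X X}"

text \<open>An effective divisor is given by local equations \<open>(W, h)\<close>.\<close>

type_synonym 'a divisor = "('a set \<times> ('a \<Rightarrow> complex)) set"

definition effective_divisor :: "('a, 'n::finite) atlas \<Rightarrow> 'a divisor \<Rightarrow> bool" where
  "effective_divisor \<A> D \<longleftrightarrow>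
     (\<Union>(W, h)\<in>D. W) = carrier_of \<A> \<and>
     (\<forall>(W, h)\<in>D. openin (manifold_topology \<A>) W \<and> holo_fun \<A> W h \<and>
        (\<forall>c\<in>\<A>. coords c W \<subseteq> closure {z \<in> coords c W. h (snd c z) \<noteq> 0})) \<and>
     (\<forall>(W, h)\<in>D. \<forall>(W', h')\<in>D. \<exists>u. holo_fun \<A> (W \<inter> W') u \<and>
        (\<forall>x\<in>W \<inter> W'. u x \<noteq> 0 \<and> h x = u x * h' x))"

text \<open>The sections of \<open>\<Omega>\<^sup>1 \<otimes> TM(*D)\<close> over \<open>U\<close>: poles along \<open>D\<close> of arbitrary order are allowed.\<close>

definition mero_vforms :: "('a, 'n::finite) atlas \<Rightarrow> 'a divisor \<Rightarrow> 'a set \<Rightarrow> ('a, 'n) vform set" where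
  "mero_vforms \<A> D U = {\<omega>.
     (\<forall>c z. \<not> (c \<in> \<A> \<and> z \<in> coords c U) \<longrightarrow> \<omega> c z = 0) \<and>
     (\<forall>c\<in>\<A>. \<forall>i k. mero_on (\<lambda>z. \<omega> c z $ i $ k) (coords c U) \<and>
        (\<forall>(W, h)\<in>D. \<forall>z\<in>coords c (U \<inter> W). \<exists>m N F. open N \<and> z \<in> N \<and> holo_on F N \<and>
           generically_eq N (\<lambda>w. h (snd c w) ^ m * \<omega> c w $ i $ k) F)) \<and>
     vform_related \<A> \<A> id U \<omega> \<omega>}"


section \<open>Meromorphic affine connections\<close>

definition restrict_section ::
    "('a, 'n::finite) atlas \<Rightarrow> 'a set \<Rightarrow> (('a, 'n) chart \<Rightarrow> complex ^ 'n \<Rightarrow> 'v::zero) \<Rightarrow>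
     ('a, 'n) chart \<Rightarrow> complex ^ 'n \<Rightarrow> 'v" where
  "restrict_section \<A> W X = (\<lambda>c z. if c \<in> \<A> \<and> z \<in> coords c W then X c z else 0)"

definition vform_eq ::
    "('a, 'n::finite) atlas \<Rightarrow> 'a set \<Rightarrow> ('a, 'n) vform \<Rightarrow> ('a, 'n) vform \<Rightarrow> bool" where
  "vform_eq \<A> U \<omega> \<eta> \<longleftrightarrow> (\<forall>c\<in>\<A>. generically_eq (coords c U) (\<omega> c) (\<eta> c))"

text \<open>The tensor product \<open>df \<otimes> X\<close>.\<close>

definition d_tensor :: "('a \<Rightarrow> complex) \<Rightarrow> ('a, 'n::finite) vfield \<Rightarrow> ('a, 'n) vform" where
  "d_tensor f X = (\<lambda>c z. \<chi> i k. pd k (\<lambda>w. f (snd c w)) z * X c z $ i)"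

type_synonym ('a, 'n) connection = "'a set \<Rightarrow> ('a, 'n) vfield \<Rightarrow> ('a, 'n) vform"

text \<open>
  \<open>conn U\<close> is the map on sections over \<open>U\<close>. The first clause only serves to make a morphism of sheaves
  determined by its values on sections over open sets.
\<close>

definition mero_connection ::
    "('a, 'n::finite) atlas \<Rightarrow> 'a divisor \<Rightarrow> ('a, 'n) connection \<Rightarrow> bool" where
  "mero_connection \<A> D conn \<longleftrightarrow>
     (\<forall>U X. \<not> (openin (manifold_topology \<A>) U \<and> X \<in> vector_fields \<A> U) \<longrightarrow> conn U X = undefined) \<and>
     (\<forall>U. openin (manifold_topology \<A>) U \<longrightarrow>
        (\<forall>X\<in>vector_fields \<A> U. conn U X \<in> mero_vforms \<A> D U) \<and>
        (\<forall>W X. openin (manifold_topology \<A>) W \<and> W \<subseteq> U \<and> X \<in> vector_fields \<A> U \<longrightarrow>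
           conn W (restrict_section \<A> W X) = restrict_section \<A> W (conn U X)) \<and>
        (\<forall>X\<in>vector_fields \<A> U. \<forall>Y\<in>vector_fields \<A> U.
           vform_eq \<A> U (conn U (\<lambda>c z. X c z + Y c z)) (\<lambda>c z. conn U X c z + conn U Y c z)) \<and>
        (\<forall>X\<in>vector_fields \<A> U. \<forall>a :: complex.
           vform_eq \<A> U (conn U (\<lambda>c z. a *s X c z)) (\<lambda>c z. \<chi> i k. a * conn U X c z $ i $ k)) \<and>
        (\<forall>X\<in>vector_fields \<A> U. \<forall>f. holo_fun \<A> U f \<longrightarrow>
           vform_eq \<A> U (conn U (\<lambda>c z. f (snd c z) *s X c z))
             (\<lambda>c z. d_tensor f X c z + (\<chi> i k. f (snd c z) * conn U X c z $ i $ k))))"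

definition mero_affine_connections :: "('a, 'n::finite) atlas \<Rightarrow> ('a, 'n) connection set" where
  "mero_affine_connections \<A> = {conn. \<exists>D. effective_divisor \<A> D \<and> mero_connection \<A> D conn}"

text \<open>
  The pullback by a local biholomorphism \<open>p\<close> from the manifold \<open>\<B>\<close> to the manifold \<open>\<A>\<close>: the connection
  corresponding to the given one under every biholomorphism \<open>V \<rightarrow> p(V)\<close> that \<open>p\<close> induces.
\<close>

definition pullback_connection ::
    "('a, 'n::finite) atlas \<Rightarrow> ('b, 'n) atlas \<Rightarrow> ('a \<Rightarrow> 'b) \<Rightarrow>
     ('b, 'n) connection \<Rightarrow> ('a, 'n) connection" where
  "pullback_connection \<B> \<A> p conn =
     (THE conn'. conn' \<in> mero_affine_connections \<B> \<and>
        (\<forall>V X Y. openin (manifold_topology \<B>) V \<and> inj_on p V \<and>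
           X \<in> vector_fields \<B> V \<and> Y \<in> vector_fields \<A> (p ` V) \<and> vfield_related \<B> \<A> p V X Y \<longrightarrow>
           vform_related \<B> \<A> p V (conn' V X) (conn (p ` V) Y)))"

definition std_atlas :: "(complex ^ 'n, 'n::finite) atlas" where
  "std_atlas = {(UNIV, id)}"

definition coord_frame :: "'n \<Rightarrow> (complex ^ 'n, 'n::finite) vfield" where
  "coord_frame j = (\<lambda>c z. if c \<in> std_atlas then axis j 1 else 0)"

text \<open>
  The matrix of a connection on \<open>\<complex>\<^sup>n\<close> in the frame \<open>(\<partial>/\<partial>z\<^sub>1, \<dots>, \<partial>/\<partial>z\<^sub>n)\<close> is the sum of the
  \<open>dz\<^sub>k \<otimes> connection_coeff conn k\<close>. Column \<open>j\<close> comes from \<open>conn (\<partial>/\<partial>z\<^sub>j)\<close>.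
\<close>

definition connection_coeff ::
    "(complex ^ 'n, 'n::finite) connection \<Rightarrow> 'n \<Rightarrow> (complex ^ 'n \<Rightarrow> complex) ^ 'n ^ 'n" where
  "connection_coeff conn k = (\<chi> i j. (\<lambda>z. conn UNIV (coord_frame j) (UNIV, id) z $ i $ k))"


section \<open>Tori\<close>

definition full_lattice :: "'v::euclidean_space set \<Rightarrow> bool" where
  "full_lattice G \<longleftrightarrow> (\<exists>B. independent B \<and> span B = UNIV \<and>
     G = {\<Sum>b\<in>B. of_int (k b) *\<^sub>R b | k :: 'v \<Rightarrow> int. True})"

text \<open>The projection \<open>z \<mapsto> [z]\<close> to the quotient by a group of translations.\<close>

definition quot_proj :: "'v::ab_group_add set \<Rightarrow> 'v \<Rightarrow> 'v set" where
  "quot_proj G z = (\<lambda>g. g + z) ` G"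

text \<open>The charts of the quotient are the restrictions of the projection to open sets on which it is injective.\<close>

definition quotient_atlas :: "(complex ^ 'n) set \<Rightarrow> ((complex ^ 'n) set, 'n::finite) atlas" where
  "quotient_atlas G = {(V, quot_proj G) | V. open V \<and> inj_on (quot_proj G) V}"

definition elliptic_functions :: "complex set \<Rightarrow> (complex \<Rightarrow> complex) set" where
  "elliptic_functions \<Lambda> =
     {f. f nicely_meromorphic_on UNIV \<and> (\<forall>z. \<forall>\<omega>\<in>\<Lambda>. f (z + \<omega>) = f z)}"

text \<open>The field of elliptic functions of the first coordinate, as functions on \<open>\<complex>\<^sup>2\<close>.\<close>

definition elliptic_functions_z1 :: "complex set \<Rightarrow> (complex ^ 2 \<Rightarrow> complex) set" where
  "elliptic_functions_z1 \<Lambda> = {\<lambda>z. f (z $ 1) | f. f \<in> elliptic_functions \<Lambda>}"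

text \<open>
  The elliptic surface \<open>\<complex>\<^sup>2/G \<rightarrow> \<complex>/\<Lambda>\<close>, \<open>[(z\<^sub>1, z\<^sub>2)] \<mapsto> [z\<^sub>1]\<close>. The fibres are compact and smooth because
  \<open>G\<close> and \<open>\<Lambda>\<close> are lattices, so they are elliptic curves as soon as they are connected.
\<close>

definition two_torus ::
    "(complex ^ 2) set \<Rightarrow> complex set \<Rightarrow> ((complex ^ 2) set \<Rightarrow> complex set) \<Rightarrow> bool" where
  "two_torus G \<Lambda> \<pi> \<longleftrightarrow> full_lattice G \<and> full_lattice \<Lambda> \<and>
     (\<forall>z. \<pi> (quot_proj G z) = quot_proj \<Lambda> (z $ 1)) \<and>
     (\<forall>y\<in>range (quot_proj \<Lambda>). connectedin (manifold_topology (quotient_atlas G))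
        {x \<in> carrier_of (quotient_atlas G). \<pi> x = y})"

definition elliptic_curve_functions :: "complex set \<Rightarrow> (complex set \<Rightarrow> complex) set" where
  "elliptic_curve_functions \<Lambda> = {h. (\<forall>y. y \<notin> range (quot_proj \<Lambda>) \<longrightarrow> h y = 0) \<and>
     (\<lambda>z. h (quot_proj \<Lambda> z)) nicely_meromorphic_on UNIV}"

text \<open>
  A fibration over a curve is the algebraic reduction if pulling back by it is an isomorphism of the
  fields of meromorphic functions; for this it suffices that it is bijective.
\<close>

definition algebraic_reduction ::
    "('a, 'n::finite) atlas \<Rightarrow> complex set \<Rightarrow> ('a \<Rightarrow> complex set) \<Rightarrow> bool" where
  "algebraic_reduction \<A> \<Lambda> \<pi> \<longleftrightarrow>
     bij_betw (\<lambda>h x. if x \<in> carrier_of \<A> then h (\<pi> x) else 0)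
       (elliptic_curve_functions \<Lambda>) (mero_functions \<A>)"

lemma mem_quot_proj_iff:
  assumes "full_lattice G"
  shows "quot_proj G z = quot_proj G w \<longleftrightarrow> w - z \<in> G"
proof -
  obtain B where B: "G = {\<Sum>b\<in>B. of_int (k b) *\<^sub>R b | k :: 'a \<Rightarrow> int. True}"
    using assms unfolding full_lattice_def by blast
  have 0: "0 \<in> G"
    unfolding B by (auto intro!: exI[of _ "\<lambda>_. 0"])
  have diff: "x - y \<in> G" if xy: "x \<in> G" "y \<in> G" for x y
  proof -
    obtain k l :: "'a \<Rightarrow> int" where "x = (\<Sum>b\<in>B. of_int (k b) *\<^sub>R b)" "y = (\<Sum>b\<in>B. of_int (l b) *\<^sub>R b)"
      using xy unfolding B by blast
    then have "x - y = (\<Sum>b\<in>B. of_int (k b - l b) *\<^sub>R b)"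
      by (simp add: sum_subtractf scaleR_left_diff_distrib)
    then show ?thesis
      unfolding B by (intro CollectI exI[of _ "\<lambda>b. k b - l b"]) simp
  qed
  have add: "x + y \<in> G" if "x \<in> G" "y \<in> G" for x y
    using diff[OF that(1) diff[OF 0 that(2)]] by simp
  show ?thesis
  proof
    assume "quot_proj G z = quot_proj G w"
    then have "w \<in> quot_proj G z"
      using 0 by (force simp: quot_proj_def)
    then show "w - z \<in> G"
      by (auto simp: quot_proj_def)
  next
    assume g: "w - z \<in> G"
    show "quot_proj G z = quot_proj G w"
    proof (intro equalityI subsetI)
      fix x assume "x \<in> quot_proj G z"
      then obtain h where "h \<in> G" "x = h + z" by (auto simp: quot_proj_def)
      then have "h - (w - z) \<in> G" "x = (h - (w - z)) + w" using diff g by auto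
      then show "x \<in> quot_proj G w" unfolding quot_proj_def by blast
    next
      fix x assume "x \<in> quot_proj G w"
      then obtain h where "h \<in> G" "x = h + w" by (auto simp: quot_proj_def)
      then have "h + (w - z) \<in> G" "x = (h + (w - z)) + z" using add g by auto
      then show "x \<in> quot_proj G z" unfolding quot_proj_def by blast
    qed
  qed
qed

lemma complex_atlas_quotient_atlas:
  fixes G :: "(complex ^ 'n::finite) set"
  assumes G: "full_lattice G"
  shows "complex_atlas (quotient_atlas G)"
  unfolding complex_atlas_def
proof (intro conjI ballI allI)
  fix b c :: "((complex ^ 'n) set, 'n) chart" and i :: 'n
  assume b: "b \<in> quotient_atlas G" and c: "c \<in> quotient_atlas G"
  obtain V W where VW: "b = (V, quot_proj G)" "c = (W, quot_proj G)" "open V" "open W"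
      "inj_on (quot_proj G) V" "inj_on (quot_proj G) W"
    using b c by (auto simp: quotient_atlas_def)
  let ?D = "local_dom id b c (carrier_of (quotient_atlas G))"
  have D: "w \<in> ?D \<longleftrightarrow> w \<in> V \<and> (\<exists>v\<in>W. quot_proj G w = quot_proj G v)" for w
    using b VW by (force simp: local_dom_def coords_def carrier_of_def)
  have *: "\<exists>g N. open N \<and> w \<in> N \<and> N \<subseteq> ?D \<and> (\<forall>u\<in>N. local_expr id b c u = u + g)"
    if w: "w \<in> ?D" for w
  proof -
    obtain v where v: "v \<in> W" "quot_proj G w = quot_proj G v" using w D by auto
    define N where "N = V \<inter> (\<lambda>u. u + (v - w)) -` W"
    have "open N"
      unfolding N_def by (intro open_Int open_vimage VW continuous_intros)
    moreover have "w \<in> N"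
      using w v D by (simp add: N_def)
    moreover have p: "quot_proj G u = quot_proj G (u + (v - w))" for u
      using v(2) mem_quot_proj_iff[OF G] by simp
    moreover have "N \<subseteq> ?D"
    proof
      fix u assume "u \<in> N"
      then show "u \<in> ?D"
        unfolding D N_def using p[of u] by blast
    qed
    moreover have "local_expr id b c u = u + (v - w)" if "u \<in> N" for u
      using that p[of u] VW by (simp add: local_expr_def N_def inv_into_f_f)
    ultimately show ?thesis by blast
  qed
  show "holo_on (\<lambda>w. local_expr id b c w $ i) ?D"
    unfolding holo_on_def
  proof (intro conjI ballI)
    show "open ?D"
      using * by (subst open_subopen) blast
  next
    fix w assume "w \<in> ?D"
    then obtain g N where N: "open N" "w \<in> N" "\<forall>u\<in>N. local_expr id b c u = u + g"
      using * by blast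
    have s: "(\<lambda>h :: complex ^ 'n. \<Sum>j\<in>UNIV. axis i 1 $ j * h $ j) = (\<lambda>h. h $ i)"
      by (auto simp: axis_def if_distrib[of "\<lambda>x. x * _"] cong: if_cong)
    have "((\<lambda>u. (u + g) $ i) has_derivative (\<lambda>h. h $ i)) (at w)"
      by (auto intro!: derivative_eq_intros bounded_linear_imp_has_derivative
            bounded_linear_vec_nth)
    then have "((\<lambda>u. local_expr id b c u $ i) has_derivative (\<lambda>h. h $ i)) (at w)"
      by (rule has_derivative_transform_within_open[OF _ N(1,2)]) (use N(3) in auto)
    then show "\<exists>a :: complex ^ 'n.
        ((\<lambda>w. local_expr id b c w $ i) has_derivative (\<lambda>h. \<Sum>j\<in>UNIV. a $ j * h $ j)) (at w)"
      using s by metis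
  qed
qed (auto simp: quotient_atlas_def)

end

theory Submission
  imports Defs
begin

text \<open>
  In the charts of a torus the changes of coordinates are translations, so the coordinate fields are
  global, and by the Leibniz rule a meromorphic connection is the same thing as a family of
  \<open>G\<close>-invariant meromorphic Christoffel symbols, namely the coefficients of the pullback to \<open>\<complex>\<^sup>2\<close>.
  These symbols descend to meromorphic functions on the torus, hence factor through the algebraic
  reduction, which makes them elliptic functions of \<open>z\<^sub>1\<close>. Conversely, elliptic functions of \<open>z\<^sub>1\<close>
  have finite pole order along the fibres over a discrete set, and these fibres carry an effective
  divisor, locally given by the offset \<open>z\<^sub>1 - b\<close> from a pole.
\<close>

text \<open>Meromorphic functions are total functions in normal form, so additivity and the Leibniz
  rule hold only on dense open sets, whereas the bijection compares connections as functions. The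
  bridge is \<open>regularize\<close>, which is unchanged under generic equality: two functions in
  normal form that agree generically agree at every point. Conversely, the connection attached to
  given symbols must be regularized, and its axioms are checked on the raw formula. That formula
  contains derivatives of the components of a field, so partial derivatives must be known to be
  holomorphic. As holomorphy means complex differentiability, this needs Cauchy's integral. The
  pullback is a definite description, so exactly one connection on C^n has to be shown to satisfy
  it. For this the same theory is used twice, with the lattice and with the trivial group, and the
  relation along the covering is tested on coordinate fields restricted to chart domains, where the
  covering is injective.\<close>

no_notation fps_nth (infixl \<open>$\<close> 75)

section \<open>Holomorphic functions of several variables\<close>

lemma complex_linear_eq_sum:
  fixes L :: "complex ^ 'n::finite \<Rightarrow> complex"
  assumes "linear L" and "\<And>c h. L (c *s h) = c * L h"
  shows "L h = (\<Sum>i\<in>UNIV. L (axis i 1) * h $ i)"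
proof -
  have "L h = L (\<Sum>i\<in>UNIV. h $ i *s axis i 1)"
    by (simp add: basis_expansion)
  also have "\<dots> = (\<Sum>i\<in>UNIV. L (h $ i *s axis i 1))"
    using assms(1) by (rule linear_sum)
  finally show ?thesis
    by (simp add: assms(2) mult.commute)
qed

text \<open>Trading the coefficient vector for complex linearity of the derivative lets each closure
  property follow from the corresponding rule for \<open>has_derivative\<close>.\<close>

lemma holo_on_iff:
  fixes f :: "complex ^ 'n::finite \<Rightarrow> complex"
  shows "holo_on f U \<longleftrightarrow> open U \<and>
    (\<forall>z\<in>U. \<exists>L. (f has_derivative L) (at z) \<and> (\<forall>c h. L (c *s h) = c * L h))"
proof -
  have "(\<exists>a :: complex ^ 'n. (f has_derivative (\<lambda>h. \<Sum>i\<in>UNIV. a $ i * h $ i)) (at z)) \<longleftrightarrow>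
      (\<exists>L. (f has_derivative L) (at z) \<and> (\<forall>c h. L (c *s h) = c * L h))" (is "?l \<longleftrightarrow> ?r") for z
  proof
    assume ?l
    then obtain a :: "complex ^ 'n" where
      "(f has_derivative (\<lambda>h. \<Sum>i\<in>UNIV. a $ i * h $ i)) (at z)" by blast
    then show ?r
      by (intro exI[of _ "\<lambda>h. \<Sum>i\<in>UNIV. a $ i * h $ i"])
        (auto simp: sum_distrib_left mult_ac)
  next
    assume ?r
    then obtain L where L: "(f has_derivative L) (at z)" "\<And>c h. L (c *s h) = c * L h"
      by blast
    have "(\<lambda>h. \<Sum>i\<in>UNIV. (\<chi> i. L (axis i 1)) $ i * h $ i) = L"
    proof
      fix h
      show "(\<Sum>i\<in>UNIV. (\<chi> i. L (axis i 1)) $ i * h $ i) = L h"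
        using complex_linear_eq_sum[OF has_derivative_linear[OF L(1)] L(2), of h] by simp
    qed
    then show ?l
      using L(1) by (intro exI[of _ "\<chi> i. L (axis i 1)"]) simp
  qed
  then show ?thesis
    unfolding holo_on_def by simp
qed

lemma holo_onD:
  assumes "holo_on f U" "z \<in> U"
  obtains L where "(f has_derivative L) (at z)" "\<And>c h. L (c *s h) = c * L h"
  using assms unfolding holo_on_iff by blast

lemma holo_on_open: "holo_on f U \<Longrightarrow> open U"
  by (simp add: holo_on_def)

lemma holo_on_subset: "holo_on f U \<Longrightarrow> V \<subseteq> U \<Longrightarrow> open V \<Longrightarrow> holo_on f V"
  unfolding holo_on_def by blast

lemma holo_on_cong:
  assumes "\<And>z. z \<in> U \<Longrightarrow> f z = g z" "holo_on g U"
  shows "holo_on f U"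
  unfolding holo_on_def
proof (intro conjI ballI)
  show "open U" using assms(2) by (rule holo_on_open)
  fix z assume z: "z \<in> U"
  then obtain a :: "complex ^ 'a" where
    "(g has_derivative (\<lambda>h. \<Sum>i\<in>UNIV. a $ i * h $ i)) (at z)"
    using assms(2) unfolding holo_on_def by blast
  then have "(f has_derivative (\<lambda>h. \<Sum>i\<in>UNIV. a $ i * h $ i)) (at z)"
    by (rule has_derivative_transform_within_open[OF _ \<open>open U\<close> z]) (simp add: assms(1))
  then show "\<exists>a :: complex ^ 'a. (f has_derivative (\<lambda>h. \<Sum>i\<in>UNIV. a $ i * h $ i)) (at z)"
    by blast
qed

lemma holo_on_imp_continuous_on: "holo_on f U \<Longrightarrow> continuous_on U f"
  by (auto simp: holo_on_def intro!: continuous_at_imp_continuous_on dest!: bspec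
      intro: has_derivative_continuous)

lemma holo_on_const: "open U \<Longrightarrow> holo_on (\<lambda>z. c) U" for U :: "(complex ^ 'n::finite) set"
  unfolding holo_on_iff by (auto intro!: exI[of _ "\<lambda>h. 0"])

lemma holo_on_add:
  fixes f :: "complex ^ 'n::finite \<Rightarrow> complex"
  assumes "holo_on f U" "holo_on g U"
  shows "holo_on (\<lambda>z. f z + g z) U"
  unfolding holo_on_iff
proof (intro conjI ballI)
  show "open U" using assms(1) by (rule holo_on_open)
  fix z assume z: "z \<in> U"
  obtain L M where "(f has_derivative L) (at z)" "\<And>c h. L (c *s h) = c * L h"
      "(g has_derivative M) (at z)" "\<And>c h. M (c *s h) = c * M h"
    using assms[THEN holo_onD, OF z] by metis
  then show "\<exists>L. ((\<lambda>z. f z + g z) has_derivative L) (at z) \<and> (\<forall>c h. L (c *s h) = c * L h)"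
    by (intro exI[of _ "\<lambda>h. L h + M h"])
      (auto intro!: derivative_eq_intros simp: algebra_simps)
qed

lemma holo_on_mult:
  fixes f :: "complex ^ 'n::finite \<Rightarrow> complex"
  assumes "holo_on f U" "holo_on g U"
  shows "holo_on (\<lambda>z. f z * g z) U"
  unfolding holo_on_iff
proof (intro conjI ballI)
  show "open U" using assms(1) by (rule holo_on_open)
  fix z assume z: "z \<in> U"
  obtain L M where "(f has_derivative L) (at z)" "\<And>c h. L (c *s h) = c * L h"
      "(g has_derivative M) (at z)" "\<And>c h. M (c *s h) = c * M h"
    using assms[THEN holo_onD, OF z] by metis
  then show "\<exists>L. ((\<lambda>z. f z * g z) has_derivative L) (at z) \<and> (\<forall>c h. L (c *s h) = c * L h)"
    by (intro exI[of _ "\<lambda>h. f z * M h + L h * g z"])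
      (auto intro!: derivative_eq_intros simp: algebra_simps)
qed

lemma holo_on_sum:
  fixes f :: "'b \<Rightarrow> complex ^ 'n::finite \<Rightarrow> complex"
  assumes "open U" "\<And>j. j \<in> J \<Longrightarrow> holo_on (f j) U"
  shows "holo_on (\<lambda>z. \<Sum>j\<in>J. f j z) U"
  using assms(2)
  by (induction J rule: infinite_finite_induct) (auto intro: holo_on_add holo_on_const assms(1))

lemma holo_on_inverse:
  fixes f :: "complex ^ 'n::finite \<Rightarrow> complex"
  assumes "holo_on f U" "\<And>z. z \<in> U \<Longrightarrow> f z \<noteq> 0"
  shows "holo_on (\<lambda>z. inverse (f z)) U"
  unfolding holo_on_iff
proof (intro conjI ballI)
  show "open U" using assms(1) by (rule holo_on_open)
  fix z assume z: "z \<in> U"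
  obtain L where L: "(f has_derivative L) (at z)" "\<And>c h. L (c *s h) = c * L h"
    using holo_onD[OF assms(1) z] by blast
  show "\<exists>L. ((\<lambda>z. inverse (f z)) has_derivative L) (at z) \<and> (\<forall>c h. L (c *s h) = c * L h)"
    using Deriv.has_derivative_inverse[OF assms(2)[OF z] L(1)]
    by (intro exI[of _ "\<lambda>h. - (inverse (f z) * L h * inverse (f z))"]) (simp add: L(2))
qed

lemma holo_on_local:
  assumes "open U" "\<And>z. z \<in> U \<Longrightarrow> \<exists>N. open N \<and> z \<in> N \<and> holo_on f N"
  shows "holo_on f U"
  using assms unfolding holo_on_def by blast

lemma open_vec_nth_vimage: "open S \<Longrightarrow> open {z :: complex ^ 'n::finite. z $ l \<in> S}"
  using open_vimage_vec_nth[of S l] by (simp add: vimage_def)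

text \<open>The chain rule with a coordinate projection. This is how functions of one variable, such
  as the coefficients and the powers of an offset from a pole, enter.\<close>

lemma holo_on_vec_nth:
  fixes l :: "'n::finite"
  assumes "f holomorphic_on S" "open S"
  shows "holo_on (\<lambda>z. f (z $ l)) {z. z $ l \<in> S}"
  unfolding holo_on_iff
proof (intro conjI ballI)
  show "open {z :: complex ^ 'n. z $ l \<in> S}"
    using assms(2) by (rule open_vec_nth_vimage)
  fix z :: "complex ^ 'n" assume "z \<in> {z. z $ l \<in> S}"
  then have "(f has_field_derivative deriv f (z $ l)) (at (z $ l))"
    using assms by (auto intro: holomorphic_derivI)
  then have "(f has_derivative (*) (deriv f (z $ l))) (at (z $ l))"
    by (simp add: has_field_derivative_def)
  moreover have "((\<lambda>z. z $ l) has_derivative (\<lambda>h. h $ l)) (at z)"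
    by (intro bounded_linear_imp_has_derivative bounded_linear_vec_nth)
  ultimately have "((\<lambda>z. f (z $ l)) has_derivative (\<lambda>h. deriv f (z $ l) * h $ l)) (at z)"
    by (rule has_derivative_compose[rotated])
  then show "\<exists>L. ((\<lambda>z. f (z $ l)) has_derivative L) (at z) \<and> (\<forall>c h. L (c *s h) = c * L h)"
    by (intro exI[of _ "\<lambda>h. deriv f (z $ l) * h $ l"]) auto
qed

lemma holo_on_translate:
  fixes f :: "complex ^ 'n::finite \<Rightarrow> complex"
  assumes "holo_on f U"
  shows "holo_on (\<lambda>z. f (z + g)) {z. z + g \<in> U}"
  unfolding holo_on_iff
proof (intro conjI ballI)
  show "open {z. z + g \<in> U}"
    using open_vimage[OF holo_on_open[OF assms], of "\<lambda>z. z + g"]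
    by (simp add: vimage_def continuous_intros)
  fix z assume "z \<in> {z. z + g \<in> U}"
  then obtain L where L: "(f has_derivative L) (at (z + g))" "\<And>c h. L (c *s h) = c * L h"
    using assms by (auto elim: holo_onD)
  have "((\<lambda>z. z + g) has_derivative (\<lambda>h. h)) (at z)"
    by (auto intro!: derivative_eq_intros)
  from has_derivative_compose[OF this L(1)] L(2)
  show "\<exists>L. ((\<lambda>z. f (z + g)) has_derivative L) (at z) \<and> (\<forall>c h. L (c *s h) = c * L h)"
    by blast
qed

section \<open>Partial derivatives as values of the complex-linear derivative\<close>

lemma axis_zero: "axis k (0 :: complex) = 0"
  by (simp add: axis_def vec_eq_iff)

lemma bounded_linear_axis: "bounded_linear (axis k :: complex \<Rightarrow> complex ^ 'n::finite)"
  unfolding linear_conv_bounded_linear[symmetric]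
  by (rule linearI) (auto simp: axis_def vec_eq_iff)

text \<open>The slice along an axis is differentiated at every parameter \<open>u\<close>, not only
  at 0, because Cauchy's formula needs it to be holomorphic on a whole disc.\<close>

lemma has_field_derivative_axis:
  fixes f :: "complex ^ 'n::finite \<Rightarrow> complex"
  assumes "(f has_derivative L) (at (z + axis k u))" "\<And>c h. L (c *s h) = c * L h"
  shows "((\<lambda>t. f (z + axis k t)) has_field_derivative L (axis k 1)) (at u)"
proof -
  have "((\<lambda>t. z + axis k t) has_derivative (\<lambda>t. axis k t)) (at u)"
    using bounded_linear_imp_has_derivative[OF bounded_linear_axis, of k "at u"]
    by (auto intro!: derivative_eq_intros)
  from has_derivative_compose[OF this assms(1)]
  have "((\<lambda>t. f (z + axis k t)) has_derivative (\<lambda>t. L (axis k t))) (at u)" .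
  moreover have "(\<lambda>t. L (axis k t)) = (*) (L (axis k 1))"
  proof
    fix t :: complex
    have "axis k t = t *s axis k 1"
      by (auto simp: axis_def vec_eq_iff)
    then show "L (axis k t) = L (axis k 1) * t"
      using assms(2)[of t "axis k 1"] by (simp only: mult.commute)
  qed
  ultimately show ?thesis
    unfolding has_field_derivative_def by simp
qed

lemma pd_eq:
  fixes f :: "complex ^ 'n::finite \<Rightarrow> complex"
  assumes "(f has_derivative L) (at z)" "\<And>c h. L (c *s h) = c * L h"
  shows "pd k f z = L (axis k 1)"
  unfolding pd_def using has_field_derivative_axis[of f L z k 0] assms
  by (intro DERIV_imp_deriv) (simp add: axis_zero)

lemma holo_on_has_derivative:
  fixes f :: "complex ^ 'n::finite \<Rightarrow> complex"
  assumes "holo_on f U" "z \<in> U"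
  shows "(f has_derivative (\<lambda>h. \<Sum>i\<in>UNIV. pd i f z * h $ i)) (at z)"
proof -
  obtain L where L: "(f has_derivative L) (at z)" "\<And>c h. L (c *s h) = c * L h"
    using holo_onD[OF assms] by blast
  have "(\<lambda>h. \<Sum>i\<in>UNIV. pd i f z * h $ i) = L"
  proof
    fix h
    show "(\<Sum>i\<in>UNIV. pd i f z * h $ i) = L h"
      using complex_linear_eq_sum[OF has_derivative_linear[OF L(1)] L(2), of h]
      by (simp add: pd_eq[OF L])
  qed
  with L(1) show ?thesis by simp
qed

lemma pd_const: "pd k (\<lambda>z. c) z = 0"
  by (simp add: pd_def)

lemma pd_add:
  fixes f :: "complex ^ 'n::finite \<Rightarrow> complex"
  assumes "holo_on f U" "holo_on g U" "z \<in> U"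
  shows "pd k (\<lambda>z. f z + g z) z = pd k f z + pd k g z"
proof -
  obtain L M where L: "(f has_derivative L) (at z)" "\<And>c h. L (c *s h) = c * L h"
      and M: "(g has_derivative M) (at z)" "\<And>c h. M (c *s h) = c * M h"
    using assms(1,2)[THEN holo_onD, OF assms(3)] by metis
  have "pd k (\<lambda>z. f z + g z) z = L (axis k 1) + M (axis k 1)"
    by (rule pd_eq[OF has_derivative_add[OF L(1) M(1)]]) (simp add: L(2) M(2) algebra_simps)
  then show ?thesis
    using L M by (simp add: pd_eq)
qed

lemma pd_mult:
  fixes f :: "complex ^ 'n::finite \<Rightarrow> complex"
  assumes "holo_on f U" "holo_on g U" "z \<in> U"
  shows "pd k (\<lambda>z. f z * g z) z = pd k f z * g z + f z * pd k g z"
proof -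
  obtain L M where L: "(f has_derivative L) (at z)" "\<And>c h. L (c *s h) = c * L h"
      and M: "(g has_derivative M) (at z)" "\<And>c h. M (c *s h) = c * M h"
    using assms(1,2)[THEN holo_onD, OF assms(3)] by metis
  have "pd k (\<lambda>z. f z * g z) z = f z * M (axis k 1) + L (axis k 1) * g z"
    by (rule pd_eq[OF has_derivative_mult[OF L(1) M(1)]]) (simp add: L(2) M(2) algebra_simps)
  then show ?thesis
    using L M by (simp add: pd_eq)
qed

lemma eventually_axis:
  fixes z :: "complex ^ 'n::finite"
  assumes "open N" "z \<in> N"
  shows "\<forall>\<^sub>F t in nhds 0. z + axis k t \<in> N"
proof -
  have "continuous_on UNIV (\<lambda>t. z + axis k t)"
    by (intro continuous_intros linear_continuous_on bounded_linear_axis)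
  then have "open ((\<lambda>t. z + axis k t) -` N)"
    using assms(1) by (simp add: open_vimage)
  moreover have "0 \<in> (\<lambda>t. z + axis k t) -` N"
    using assms(2) by (simp add: axis_zero)
  ultimately show ?thesis
    using eventually_nhds_in_open by fastforce
qed

lemma pd_cong:
  fixes f :: "complex ^ 'n::finite \<Rightarrow> complex"
  assumes "open N" "z \<in> N" "\<And>w. w \<in> N \<Longrightarrow> f w = g w"
  shows "pd k f z = pd k g z"
  unfolding pd_def
proof (rule deriv_cong_ev)
  show "\<forall>\<^sub>F t in nhds 0. f (z + axis k t) = g (z + axis k t)"
    using eventually_axis[OF assms(1,2), of k] by eventually_elim (simp add: assms(3))
qed (rule refl)

lemma pd_translate: "pd k (\<lambda>w. f (w + g)) z = pd k f (z + g)"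
  by (simp add: pd_def add_ac)

section \<open>Cauchy's integral for partial derivatives\<close>

lemma norm_axis: "norm (axis k x :: complex ^ 'n::finite) = norm x"
proof -
  have "(norm (axis k x $ i :: complex))\<^sup>2 = (if i = k then (norm x)\<^sup>2 else 0)" for i
    by (simp add: axis_def)
  then show ?thesis
    by (simp add: norm_vec_def L2_set_def)
qed

text \<open>This is \<open>circlepath 0 r\<close> as a plain function of a real parameter. Contour
  integrals become integrals over \<open>cbox 0 1\<close>, to which the theorems on parameter
  integrals apply.\<close>

definition circ :: "real \<Rightarrow> real \<Rightarrow> complex" where
  "circ r x = of_real r * exp (2 * of_real pi * \<i> * of_real x)"

lemma norm_circ: "0 < r \<Longrightarrow> norm (circ r x) = r"
  by (simp add: circ_def norm_mult norm_exp_eq_Re)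

lemma circ_nonzero: "0 < r \<Longrightarrow> circ r x \<noteq> 0"
  by (simp add: circ_def)

lemma add_axis_circ_mem:
  fixes z :: "complex ^ 'n::finite"
  assumes "cball z r \<subseteq> U" "0 < r"
  shows "z + axis k (circ r x) \<in> U"
proof -
  have "z + axis k (circ r x) \<in> cball z r"
    using assms(2) by (simp add: dist_norm norm_axis norm_circ)
  then show ?thesis using assms(1) by blast
qed

lemma continuous_on_circ: "continuous_on S (circ r)"
  unfolding circ_def by (intro continuous_intros)

text \<open>Joint continuity in centre and parameter is what continuity of the integral and
  differentiation under it require; it is applied to a function and to its partial
  derivatives.\<close>

lemma continuous_on_axis_circ:
  fixes f :: "complex ^ 'n::finite \<Rightarrow> complex"
  assumes "continuous_on U f" "0 < r" "\<And>z. z \<in> W \<Longrightarrow> cball z r \<subseteq> U"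
  shows "continuous_on (W \<times> T) (\<lambda>(z, x). f (z + axis k (circ r x)) / circ r x)"
proof -
  have "continuous_on (W \<times> T) (\<lambda>p. f (fst p + axis k (circ r (snd p))) / circ r (snd p))"
    by (intro continuous_on_divide continuous_on_compose2[OF assms(1)] continuous_on_add
        continuous_on_fst continuous_on_snd continuous_on_id
        bounded_linear.continuous_on[OF bounded_linear_axis]
        continuous_on_compose2[OF continuous_on_circ[of UNIV]])
      (auto simp: circ_nonzero assms(2) intro!: add_axis_circ_mem assms(3))
  then show ?thesis
    by (simp add: case_prod_unfold)
qed

text \<open>Cauchy's formula for the derivative of the slice at 0. On the circle
  \<open>u = circ r x\<close> one has \<open>du = 2 pi i u dx\<close>, which cancels the prefactor
  and one of the two factors \<open>u\<close> in the denominator.\<close>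

lemma pd_eq_integral:
  fixes f :: "complex ^ 'n::finite \<Rightarrow> complex"
  assumes f: "holo_on f U" and r: "0 < r" "cball z r \<subseteq> U"
  shows "pd k f z = integral (cbox 0 1) (\<lambda>x. f (z + axis k (circ r x)) / circ r x)"
proof -
  let ?g = "\<lambda>t. f (z + axis k t)"
  have mem: "z + axis k t \<in> U" if "norm t \<le> r" for t
  proof -
    have "z + axis k t \<in> cball z r"
      using that by (simp add: dist_norm norm_axis)
    then show ?thesis using r(2) by blast
  qed
  have d: "?g field_differentiable (at t)" if "norm t \<le> r" for t
    using holo_onD[OF f mem[OF that]] has_field_derivative_axis[of f _ z k t]
    unfolding field_differentiable_def by metis
  have "?g holomorphic_on cball 0 r"
    unfolding holomorphic_on_def
    by (auto intro!: field_differentiable_at_within d)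
  then have "continuous_on (cball 0 r) ?g" "?g holomorphic_on ball 0 r"
    by (auto intro: holomorphic_on_imp_continuous_on holomorphic_on_subset)
  then have "(?g has_field_derivative
      (1 / (2 * of_real pi * \<i>) * contour_integral (circlepath 0 r) (\<lambda>u. ?g u / (u - 0)^2))) (at 0)"
    using r(1) by (intro Cauchy_derivative_integral_circlepath) auto
  then have "pd k f z =
      1 / (2 * of_real pi * \<i>) * contour_integral (circlepath 0 r) (\<lambda>u. ?g u / (u - 0)^2)"
    unfolding pd_def by (rule DERIV_imp_deriv)
  also have "\<dots> = 1 / (2 * of_real pi * \<i>) *
      integral {0..1} (\<lambda>x. (2 * of_real pi * \<i>) * (?g (circ r x) / circ r x))"
  proof -
    have "?g (circlepath 0 r x) / (circlepath 0 r x - 0)^2 * vector_derivative (circlepath 0 r) (at x)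
        = (2 * of_real pi * \<i>) * (?g (circ r x) / circ r x)" for x
    proof -
      have "circlepath 0 r x = circ r x"
        by (simp add: circlepath circ_def)
      moreover have "vector_derivative (circlepath 0 r) (at x) = 2 * of_real pi * \<i> * circ r x"
        by (simp add: vector_derivative_circlepath circ_def)
      ultimately show ?thesis
        using circ_nonzero[OF r(1), of x] by (simp add: power2_eq_square field_simps)
    qed
    then show ?thesis
      unfolding contour_integral_integral by simp
  qed
  also have "\<dots> = integral {0..1} (\<lambda>x. ?g (circ r x) / circ r x)"
    by (subst integral_mult_right) simp
  finally show ?thesis
    by (simp add: cbox_interval)
qed

text \<open>One radius serves for all centres near \<open>z\<close>, so the integral formula holds
  with a fixed radius on a neighbourhood and can be differentiated there.\<close>

lemma open_cball_nbhd:
  fixes z :: "'a::real_normed_vector"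
  assumes "open U" "z \<in> U"
  obtains r where "0 < r" "\<And>w. w \<in> ball z r \<Longrightarrow> cball w r \<subseteq> U"
proof -
  obtain e where e: "0 < e" "cball z e \<subseteq> U"
    using assms open_contains_cball by blast
  have "cball w (e / 2) \<subseteq> U" if "w \<in> ball z (e / 2)" for w
  proof
    fix x assume "x \<in> cball w (e / 2)"
    then have "dist z x \<le> e"
      using that dist_triangle[of z x w] by (simp add: dist_commute)
    then show "x \<in> U" using e(2) by (simp add: subset_eq)
  qed
  then show ?thesis using that[of "e / 2"] e(1) by simp
qed

text \<open>Follows from the integral formula and the continuity of \<open>f\<close>. It has to
  precede holomorphy, because the derivative of the integrand contains the partial derivatives of
  \<open>f\<close>.\<close>

lemma continuous_on_pd:
  fixes f :: "complex ^ 'n::finite \<Rightarrow> complex"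
  assumes f: "holo_on f U"
  shows "continuous_on U (pd k f)"
proof (rule continuous_at_imp_continuous_on, rule ballI)
  fix z assume "z \<in> U"
  then obtain r where r: "0 < r" "\<And>w. w \<in> ball z r \<Longrightarrow> cball w r \<subseteq> U"
    using open_cball_nbhd holo_on_open[OF f] by blast
  have "continuous_on (ball z r)
      (\<lambda>w. integral (cbox 0 1) (\<lambda>x. f (w + axis k (circ r x)) / circ r x))"
    by (intro integral_continuous_on_param continuous_on_axis_circ[OF holo_on_imp_continuous_on[OF f]] r)
  then have "continuous_on (ball z r) (pd k f)"
    by (rule continuous_on_eq) (simp add: pd_eq_integral[OF f r(1,2)])
  then show "isCont (pd k f) z"
    using r(1) by (simp add: continuous_on_eq_continuous_at)
qed

text \<open>Differentiate Cauchy's integral formula for the derivative under the integral sign.\<close>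

lemma holo_on_pd:
  fixes f :: "complex ^ 'n::finite \<Rightarrow> complex"
  assumes f: "holo_on f U"
  shows "holo_on (pd k f) U"
  unfolding holo_on_iff
proof (intro conjI ballI)
  show "open U" using f by (rule holo_on_open)
  fix z assume "z \<in> U"
  then obtain r where r: "0 < r" "\<And>w. w \<in> ball z r \<Longrightarrow> cball w r \<subseteq> U"
    using open_cball_nbhd holo_on_open[OF f] by blast
  define c where "c i w x = pd i f (w + axis k (circ r x)) / circ r x" for i w x
  \<comment> \<open>The derivative of the integrand, packed as a bounded linear map because
    differentiation under the integral expects a continuous family of such maps.\<close>
  define D where "D w x = (\<Sum>i\<in>UNIV. blinfun_mult_right (c i w x) o\<^sub>L Blinfun (\<lambda>h :: complex ^ 'n. h $ i))"
    for w x
  have D: "blinfun_apply (D w x) h = (\<Sum>i\<in>UNIV. c i w x * h $ i)" for w x h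
    by (simp add: D_def blinfun.sum_left bounded_linear_Blinfun_apply bounded_linear_vec_nth)
  have cont: "continuous_on (ball z r \<times> cbox 0 1) (\<lambda>(w, x). c i w x)" for i
    unfolding c_def by (intro continuous_on_axis_circ[OF continuous_on_pd[OF f]] r)
  have contD: "continuous_on (ball z r \<times> cbox 0 1) (\<lambda>(w, x). D w x)"
    using cont unfolding D_def case_prod_unfold
    by (intro continuous_intros bounded_linear.continuous_on[OF bounded_linear_blinfun_mult_right])
  have z: "z \<in> ball z r" using r(1) by simp
  have "((\<lambda>w. integral (cbox 0 1) (\<lambda>x. f (w + axis k (circ r x)) / circ r x)) has_derivative
      integral (cbox 0 1) (D z)) (at z within ball z r)"
  proof (rule leibniz_rule[OF _ _ contD z convex_ball])
    fix w x assume w: "w \<in> ball z r"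
    have "(f has_derivative (\<lambda>h. \<Sum>i\<in>UNIV. pd i f (w + axis k (circ r x)) * h $ i))
        (at (w + axis k (circ r x)))"
      by (rule holo_on_has_derivative[OF f add_axis_circ_mem[OF r(2)[OF w] r(1)]])
    moreover have "((\<lambda>w. w + axis k (circ r x)) has_derivative (\<lambda>h. h)) (at w within ball z r)"
      by (auto intro!: derivative_eq_intros)
    ultimately have "((\<lambda>w. f (w + axis k (circ r x))) has_derivative
        (\<lambda>h. \<Sum>i\<in>UNIV. pd i f (w + axis k (circ r x)) * h $ i)) (at w within ball z r)"
      by (rule has_derivative_compose[rotated])
    then have "((\<lambda>w. f (w + axis k (circ r x)) * inverse (circ r x)) has_derivative
        (\<lambda>h. (\<Sum>i\<in>UNIV. pd i f (w + axis k (circ r x)) * h $ i) * inverse (circ r x)))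
        (at w within ball z r)"
      by (rule has_derivative_mult_left)
    moreover have "blinfun_apply (D w x) =
        (\<lambda>h. (\<Sum>i\<in>UNIV. pd i f (w + axis k (circ r x)) * h $ i) * inverse (circ r x))"
      by (simp add: D c_def divide_inverse sum_distrib_left sum_distrib_right mult_ac fun_eq_iff)
    ultimately show "((\<lambda>w. f (w + axis k (circ r x)) / circ r x) has_derivative blinfun_apply (D w x))
        (at w within ball z r)"
      by (simp only: divide_inverse)
  next
    fix w assume "w \<in> ball z r"
    then have "continuous_on (cbox 0 1) (\<lambda>x. f (w + axis k (circ r x)) / circ r x)"
      using continuous_on_compose2[OF continuous_on_axis_circ[OF holo_on_imp_continuous_on[OF f] r(1),
          of "ball z r" "cbox 0 1" k], of "cbox 0 1" "\<lambda>x. (w, x)"]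
        r(2) by (force intro: continuous_intros)
    then show "(\<lambda>x. f (w + axis k (circ r x)) / circ r x) integrable_on cbox 0 1"
      by (rule integrable_continuous)
  qed
  then have "((\<lambda>w. integral (cbox 0 1) (\<lambda>x. f (w + axis k (circ r x)) / circ r x)) has_derivative
      integral (cbox 0 1) (D z)) (at z)"
    using at_within_open[OF z open_ball] by simp
  then have "(pd k f has_derivative integral (cbox 0 1) (D z)) (at z)"
    by (rule has_derivative_transform_within_open[OF _ open_ball z])
      (simp add: pd_eq_integral[OF f r(1,2)])
  \<comment> \<open>Complex linearity survives: evaluation at a vector commutes with the integral,
    and the integrand is complex linear for each parameter.\<close>
  moreover have "blinfun_apply (integral (cbox 0 1) (D z)) (a *s h) =
      a * blinfun_apply (integral (cbox 0 1) (D z)) h" for a h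
  proof -
    have "continuous_on (cbox 0 1) (D z)"
      using continuous_on_compose2[OF contD, of "cbox 0 1" "\<lambda>x. (z, x)"] z
      by (force intro: continuous_intros)
    then have "D z integrable_on cbox 0 1"
      by (rule integrable_continuous)
    then have "blinfun_apply (integral (cbox 0 1) (D z)) h =
        integral (cbox 0 1) (\<lambda>x. \<Sum>i\<in>UNIV. c i z x * h $ i)" for h
      by (simp add: blinfun_apply_integral D)
    moreover have "(\<Sum>i\<in>UNIV. c i z x * (a *s h) $ i) = a * (\<Sum>i\<in>UNIV. c i z x * h $ i)" for x
      by (simp add: sum_distrib_left mult_ac)
    ultimately show ?thesis
      by (simp del: vector_smult_component)
  qed
  ultimately show "\<exists>L. (pd k f has_derivative L) (at z) \<and> (\<forall>c h. L (c *s h) = c * L h)"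
    by blast
qed

section \<open>Generic equality and meromorphic functions\<close>

text \<open>A nonempty open piece of \<open>U\<close> meets \<open>A\<close> in a nonempty open set,
  which in turn meets \<open>B\<close>; \<open>B\<close> itself may be arbitrary.\<close>

lemma subset_closure_Int_open:
  fixes U :: "'a::topological_space set"
  assumes "open U" "open A" "U \<subseteq> closure A" "U \<subseteq> closure B"
  shows "U \<subseteq> closure (A \<inter> B)"
proof -
  have "U \<subseteq> closure (U \<inter> A)"
    using open_Int_closure_subset[OF assms(1), of A] assms(3) by blast
  moreover have "U \<inter> A \<subseteq> closure (U \<inter> A \<inter> B)"
    using open_Int_closure_subset[OF open_Int[OF assms(1,2)], of B] assms(4) by blast
  then have "closure (U \<inter> A) \<subseteq> closure (U \<inter> A \<inter> B)"
    by (rule closure_minimal) simp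
  moreover have "closure (U \<inter> A \<inter> B) \<subseteq> closure (A \<inter> B)"
    by (rule closure_mono) blast
  ultimately show ?thesis by blast
qed

text \<open>For open \<open>U\<close> the interior may be taken in the whole space, which makes
  restriction to smaller open sets and localization immediate.\<close>

lemma generically_eq_open:
  assumes "open U"
  shows "generically_eq U f g \<longleftrightarrow> U \<subseteq> closure (interior {z. f z = g z})"
proof -
  have eq: "interior {z\<in>U. f z = g z} = U \<inter> interior {z. f z = g z}"
    using assms interior_Int[of U "{z. f z = g z}"]
    by (simp add: interior_open Int_def)
  have "U \<subseteq> closure (U \<inter> interior {z. f z = g z}) \<longleftrightarrow> U \<subseteq> closure (interior {z. f z = g z})"
    using open_Int_closure_subset[OF assms, of "interior {z. f z = g z}"]
      closure_mono[of "U \<inter> interior {z. f z = g z}" "interior {z. f z = g z}"] by blast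
  then show ?thesis
    unfolding generically_eq_def eq .
qed

lemma generically_eq_subset:
  "generically_eq U f g \<Longrightarrow> open U \<Longrightarrow> open V \<Longrightarrow> V \<subseteq> U \<Longrightarrow> generically_eq V f g"
  by (simp add: generically_eq_open)

lemma generically_eq_local:
  assumes "open U" "\<And>z. z \<in> U \<Longrightarrow> \<exists>N. open N \<and> z \<in> N \<and> generically_eq N f g"
  shows "generically_eq U f g"
proof -
  have "z \<in> closure (interior {z. f z = g z})" if "z \<in> U" for z
    using assms(2)[OF that] generically_eq_open by blast
  then show ?thesis
    using assms(1) by (auto simp: generically_eq_open)
qed

lemma generically_eqI:
  assumes "open U" "\<And>z. z \<in> U \<Longrightarrow> f z = g z"
  shows "generically_eq U f g"
proof -
  have "U \<subseteq> interior {z. f z = g z}"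
    using assms by (intro interior_maximal) auto
  then show ?thesis
    unfolding generically_eq_open[OF assms(1)] by (rule order_trans[OF _ closure_subset])
qed

lemma generically_eq_dense:
  assumes "open U" "open A" "U \<subseteq> closure A" "\<And>z. z \<in> U \<Longrightarrow> z \<in> A \<Longrightarrow> f z = g z"
  shows "generically_eq U f g"
proof -
  have "U \<subseteq> closure (U \<inter> A)"
    using open_Int_closure_subset[OF assms(1), of A] assms(3) by blast
  moreover have "U \<inter> A \<subseteq> interior {z. f z = g z}"
    using assms by (intro interior_maximal) auto
  ultimately show ?thesis
    unfolding generically_eq_open[OF assms(1)]
    using closure_mono by blast
qed

text \<open>The transfer principle used throughout: a pointwise deduction from two equations is
  valid generically, because the interiors of the two agreement sets meet in an open set whose
  closure contains \<open>U\<close>.\<close>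

lemma generically_eq_lift2:
  assumes "open U" "generically_eq U f g" "generically_eq U f' g'"
    "\<And>z. z \<in> U \<Longrightarrow> f z = g z \<Longrightarrow> f' z = g' z \<Longrightarrow> f'' z = g'' z"
  shows "generically_eq U f'' g''"
proof (rule generically_eq_dense[OF assms(1)])
  let ?A = "interior {z. f z = g z}" and ?B = "interior {z. f' z = g' z}"
  show "open (?A \<inter> ?B)" by blast
  show "U \<subseteq> closure (?A \<inter> ?B)"
    using assms(2,3) by (intro subset_closure_Int_open) (auto simp: generically_eq_open assms(1))
  fix z assume "z \<in> U" "z \<in> ?A \<inter> ?B"
  then show "f'' z = g'' z"
    using assms(4)[of z] interior_subset[of "{z. f z = g z}"] interior_subset[of "{z. f' z = g' z}"]
    by blast
qed

lemma generically_eq_lift: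
  assumes "open U" "generically_eq U f g" "\<And>z. z \<in> U \<Longrightarrow> f z = g z \<Longrightarrow> f' z = g' z"
  shows "generically_eq U f' g'"
  using generically_eq_lift2[OF assms(1,2,2)] assms(3) by blast

lemma generically_eq_refl: "open U \<Longrightarrow> generically_eq U f f"
  by (rule generically_eqI) auto

lemma generically_eq_sym: "generically_eq U f g \<Longrightarrow> generically_eq U g f"
  by (simp add: generically_eq_def eq_commute)

lemma generically_eq_trans:
  assumes "open U" "generically_eq U f g" "generically_eq U g h"
  shows "generically_eq U f h"
  using assms by (rule generically_eq_lift2) simp

lemma generically_eq_ball:
  assumes "open U" "finite I" "\<And>i. i \<in> I \<Longrightarrow> generically_eq U (f i) (g i)"
  shows "generically_eq U (\<lambda>z. \<forall>i\<in>I. f i z = g i z) (\<lambda>z. True)"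
  using assms(2,3)
proof (induction I rule: finite_induct)
  case empty
  show ?case using assms(1) by (intro generically_eqI) auto
next
  case (insert i I)
  have "generically_eq U (f i) (g i)"
    "generically_eq U (\<lambda>z. \<forall>i\<in>I. f i z = g i z) (\<lambda>z. True)"
    using insert by auto
  then show ?case
    by (rule generically_eq_lift2[OF assms(1)]) auto
qed

lemma generically_eq_vecI:
  fixes f g :: "'a::topological_space \<Rightarrow> 'b ^ 'n::finite"
  assumes "open U" "\<And>i. generically_eq U (\<lambda>z. f z $ i) (\<lambda>z. g z $ i)"
  shows "generically_eq U f g"
proof -
  have "generically_eq U (\<lambda>z. \<forall>i\<in>UNIV. f z $ i = g z $ i) (\<lambda>z. True)"
    using assms by (intro generically_eq_ball) auto
  then show ?thesis
    by (rule generically_eq_lift[OF assms(1)]) (simp add: vec_eq_iff)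
qed

lemma generically_eq_translate:
  fixes f :: "'a::real_normed_vector \<Rightarrow> 'b"
  assumes "generically_eq U f h" "open U"
  shows "generically_eq {z. z + g \<in> U} (\<lambda>z. f (z + g)) (\<lambda>z. h (z + g))"
proof -
  have op: "open {z. z + g \<in> S}" if "open S" for S :: "'a set"
    using open_vimage[OF that, of "\<lambda>z. z + g"] by (simp add: vimage_def continuous_intros)
  have "{z. z + g \<in> U} \<subseteq> closure {z. z + g \<in> interior {z. f z = h z}}"
  proof
    fix z assume "z \<in> {z. z + g \<in> U}"
    then have "z + g \<in> closure (interior {z. f z = h z})"
      using assms by (auto simp: generically_eq_open)
    then have "(+) (- g) (z + g) \<in> (+) (- g) ` closure (interior {z. f z = h z})"
      by blast
    also have "\<dots> = closure ((+) (- g) ` interior {z. f z = h z})"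
      by (rule closure_translation[symmetric])
    also have "(+) (- g) ` interior {z. f z = h z} = {z. z + g \<in> interior {z. f z = h z}}"
      by (force simp: image_iff)
    finally show "z \<in> closure {z. z + g \<in> interior {z. f z = h z}}"
      by simp
  qed
  then show ?thesis
    using interior_subset[of "{z. f z = h z}"]
    by (intro generically_eq_dense[OF op[OF assms(2)] op[OF open_interior]]) auto
qed

text \<open>The locus of disagreement in \<open>U\<close> is open, so if it were nonempty it would
  meet the interior of the agreement set.\<close>

lemma continuous_generically_eq:
  fixes f g :: "'a::topological_space \<Rightarrow> 'b::real_normed_vector"
  assumes "open U" "continuous_on U f" "continuous_on U g" "generically_eq U f g" "z \<in> U"
  shows "f z = g z"
proof (rule ccontr)
  assume "f z \<noteq> g z"
  let ?A = "interior {z. f z = g z}" and ?W = "(\<lambda>w. f w - g w) -` (- {0}) \<inter> U"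
  have "open ?W"
    using continuous_open_preimage[OF continuous_on_diff[OF assms(2,3)] assms(1), of "- {0}"]
    by (simp add: Int_commute open_Compl)
  moreover have "?W \<inter> ?A = {}"
    using interior_subset[of "{z. f z = g z}"] by auto
  ultimately have "?W \<inter> closure ?A = {}"
    by (simp add: open_Int_closure_eq_empty)
  then show False
    using assms(1,4,5) \<open>f z \<noteq> g z\<close> by (auto simp: generically_eq_open)
qed

section \<open>Normal forms of meromorphic functions\<close>

lemma regular_value_unique:
  assumes "regular_value f z u" "regular_value f z v"
  shows "u = v"
proof -
  obtain M F N H where *: "open M" "z \<in> M" "holo_on F M" "generically_eq M f F" "F z = u"
    "open N" "z \<in> N" "holo_on H N" "generically_eq N f H" "H z = v"
    using assms unfolding regular_value_def by blast
  have o: "open (M \<inter> N)" using * by blast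
  have "generically_eq (M \<inter> N) F H"
    using o * by (meson generically_eq_subset generically_eq_sym generically_eq_trans inf_le1 inf_le2)
  moreover have "continuous_on (M \<inter> N) F" "continuous_on (M \<inter> N) H"
    using *(3,8) holo_on_imp_continuous_on continuous_on_subset by blast+
  ultimately show ?thesis
    using continuous_generically_eq[OF o, of F H z] * by blast
qed

lemma regularize_eqI: "regular_value f z v \<Longrightarrow> regularize f z = v"
  unfolding regularize_def using regular_value_unique by (metis the_equality)

text \<open>The passage from generic to pointwise statements: a holomorphic extension of
  \<open>f\<close> near \<open>z\<close> is, on a smaller neighbourhood, also one of
  \<open>g\<close>.\<close>

lemma regularize_cong:
  assumes "open N" "z \<in> N" "generically_eq N f g"
  shows "regularize f z = regularize g z"
proof -
  have "regular_value g z v" if fg: "generically_eq N f g" and v: "regular_value f z v"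
    for f g :: "complex ^ 'a \<Rightarrow> complex" and v
  proof -
    obtain M F where *: "open M" "z \<in> M" "holo_on F M" "generically_eq M f F" "F z = v"
      using v unfolding regular_value_def by blast
    have o: "open (M \<inter> N)" using * assms(1) by blast
    have "generically_eq (M \<inter> N) g F"
      using o * fg assms(1) by (meson generically_eq_subset generically_eq_sym generically_eq_trans inf_le1 inf_le2)
    moreover have "holo_on F (M \<inter> N)"
      using holo_on_subset[OF *(3) _ o] by blast
    ultimately show ?thesis
      using o * assms(2) unfolding regular_value_def by blast
  qed
  then have "regular_value f z = regular_value g z"
    using assms generically_eq_sym by blast
  then show ?thesis
    unfolding regularize_def by (simp only:)
qed

lemma regularize_holo:
  assumes "holo_on f U" "z \<in> U"
  shows "regularize f z = f z"
  using assms holo_on_open[OF assms(1)] generically_eq_refl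
  by (intro regularize_eqI) (auto simp: regular_value_def)

lemma regular_value_translate:
  fixes f :: "complex ^ 'n::finite \<Rightarrow> complex"
  assumes "regular_value f (z + g) v"
  shows "regular_value (\<lambda>z. f (z + g)) z v"
proof -
  obtain N F where *: "open N" "z + g \<in> N" "holo_on F N" "generically_eq N f F" "F (z + g) = v"
    using assms unfolding regular_value_def by blast
  have "open {z. z + g \<in> N}"
    using holo_on_open[OF holo_on_translate[OF *(3)]] .
  then show ?thesis
    unfolding regular_value_def
    using * holo_on_translate[OF *(3), of g] generically_eq_translate[OF *(4,1), of g]
    by (intro exI[of _ "{z. z + g \<in> N}"] exI[of _ "\<lambda>z. F (z + g)"]) auto
qed

lemma regularize_translate:
  fixes f :: "complex ^ 'n::finite \<Rightarrow> complex"
  shows "regularize (\<lambda>z. f (z + g)) z = regularize f (z + g)"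
proof -
  have "regular_value (\<lambda>z. f (z + g)) z = regular_value f (z + g)"
    using regular_value_translate[of f z g]
      regular_value_translate[of "\<lambda>z. f (z + g)" "z + g" "- g"] by (auto simp: add.assoc fun_eq_iff)
  then show ?thesis
    unfolding regularize_def by (simp only:)
qed

lemma mero_on_subset: "mero_on f U \<Longrightarrow> V \<subseteq> U \<Longrightarrow> open V \<Longrightarrow> mero_on f V"
  unfolding mero_on_def by blast

lemma mero_on_local:
  assumes "open U" "\<And>z. z \<in> U \<Longrightarrow> \<exists>N. open N \<and> z \<in> N \<and> mero_on f N"
  shows "mero_on f U"
  unfolding mero_on_def using assms(1)
proof (intro conjI ballI)
  fix z assume "z \<in> U"
  then obtain N where "open N" "z \<in> N" "mero_on f N" using assms(2) by blast
  then show "\<exists>N g h. open N \<and> z \<in> N \<and> holo_on g N \<and> holo_on h N \<and>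
        N \<subseteq> closure {w\<in>N. h w \<noteq> 0} \<and> generically_eq N f (\<lambda>w. g w / h w)"
    and "f z = regularize f z"
    unfolding mero_on_def by blast+
qed

lemma mero_on_cong:
  assumes "mero_on g U" "\<And>z. z \<in> U \<Longrightarrow> f z = g z"
  shows "mero_on f U"
  unfolding mero_on_def
proof (intro conjI ballI)
  show U: "open U" using assms(1) by (simp add: mero_on_def)
  have fg: "generically_eq U f g" using U assms(2) by (rule generically_eqI)
  fix z assume z: "z \<in> U"
  then obtain N a h where *: "open N" "z \<in> N" "holo_on a N" "holo_on h N"
      "N \<subseteq> closure {w\<in>N. h w \<noteq> 0}" "generically_eq N g (\<lambda>w. a w / h w)"
    using assms(1) unfolding mero_on_def by blast
  let ?N = "N \<inter> U"
  have o: "open ?N" using * U by blast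
  have "?N \<subseteq> closure (U \<inter> {w\<in>N. h w \<noteq> 0})"
    using open_Int_closure_subset[OF U, of "{w\<in>N. h w \<noteq> 0}"] *(5) by blast
  also have "U \<inter> {w\<in>N. h w \<noteq> 0} = {w\<in>?N. h w \<noteq> 0}" by blast
  finally have "?N \<subseteq> closure {w\<in>?N. h w \<noteq> 0}" .
  moreover have "generically_eq ?N f (\<lambda>w. a w / h w)"
    using fg *(6) o U *(1)
    by (meson generically_eq_subset generically_eq_trans inf_le1 inf_le2)
  ultimately show "\<exists>N a h. open N \<and> z \<in> N \<and> holo_on a N \<and> holo_on h N \<and>
        N \<subseteq> closure {w\<in>N. h w \<noteq> 0} \<and> generically_eq N f (\<lambda>w. a w / h w)"
    using o z *(2) holo_on_subset[OF *(3) inf_le1 o] holo_on_subset[OF *(4) inf_le1 o] by blast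
  show "f z = regularize f z"
    using assms z regularize_cong[OF U z fg] by (simp add: mero_on_def)
qed

text \<open>The first clause of \<open>mero_on\<close> without the normal form. A formula such as a
  covariant derivative has this property before its values at the poles are corrected.\<close>

definition local_quotient :: "(complex ^ 'n \<Rightarrow> complex) \<Rightarrow> complex ^ 'n \<Rightarrow> bool" where
  "local_quotient f z \<longleftrightarrow> (\<exists>N g h. open N \<and> z \<in> N \<and> holo_on g N \<and> holo_on h N \<and>
      N \<subseteq> closure {w\<in>N. h w \<noteq> 0} \<and> generically_eq N f (\<lambda>w. g w / h w))"

text \<open>Away from the zeros of \<open>h\<close> the quotient is holomorphic, hence its own
  regularization, and these points form an open set that is dense in \<open>N\<close>.\<close>

lemma regularize_quotient:
  fixes f :: "complex ^ 'n::finite \<Rightarrow> complex"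
  assumes N: "open N" "holo_on g N" "holo_on h N" "N \<subseteq> closure {w\<in>N. h w \<noteq> 0}"
    and f: "generically_eq N f (\<lambda>w. g w / h w)"
  shows "generically_eq N (regularize f) f"
proof -
  let ?A = "{w\<in>N. h w \<noteq> 0}"
  have A: "open ?A"
    using continuous_open_preimage[OF holo_on_imp_continuous_on[OF N(3)] N(1), of "- {0}"]
    by (simp add: vimage_def Int_def open_Compl)
  have "holo_on (\<lambda>w. g w / h w) ?A"
    unfolding holo_on_iff
  proof (intro conjI ballI A)
    fix z assume z: "z \<in> ?A"
    obtain L M where *: "(g has_derivative L) (at z)" "\<And>c v. L (c *s v) = c * L v"
        "(h has_derivative M) (at z)" "\<And>c v. M (c *s v) = c * M v"
      using N(2,3)[THEN holo_onD] z by (metis (no_types, lifting) mem_Collect_eq)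
    define D where "D v = - g z * (inverse (h z) * M v * inverse (h z)) + L v / h z" for v
    have "((\<lambda>w. g w / h w) has_derivative D) (at z)"
      unfolding D_def using * z by (intro has_derivative_divide) auto
    moreover have "D (c *s v) = c * D v" for c v
      by (simp add: D_def *(2,4) algebra_simps)
    ultimately show "\<exists>L. ((\<lambda>w. g w / h w) has_derivative L) (at z) \<and> (\<forall>c v. L (c *s v) = c * L v)"
      by blast
  qed
  then have "regularize (\<lambda>w. g w / h w) z = g z / h z" if "z \<in> ?A" for z
    using regularize_holo that by blast
  moreover have "regularize f z = regularize (\<lambda>w. g w / h w) z" if "z \<in> N" for z
    using regularize_cong[OF N(1) that f] .
  ultimately have "generically_eq N (regularize f) (\<lambda>w. g w / h w)"
    by (intro generically_eq_dense[OF N(1) A N(4)]) auto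
  then show ?thesis
    using f N(1) generically_eq_sym generically_eq_trans by blast
qed

lemma generically_eq_regularize:
  fixes f :: "complex ^ 'n::finite \<Rightarrow> complex"
  assumes "open U" "\<And>z. z \<in> U \<Longrightarrow> local_quotient f z"
  shows "generically_eq U (regularize f) f"
  using assms(1)
proof (rule generically_eq_local)
  fix z assume "z \<in> U"
  then obtain N g h where "open N" "z \<in> N" "holo_on g N" "holo_on h N"
      "N \<subseteq> closure {w\<in>N. h w \<noteq> 0}" "generically_eq N f (\<lambda>w. g w / h w)"
    using assms(2) unfolding local_quotient_def by blast
  then show "\<exists>N. open N \<and> z \<in> N \<and> generically_eq N (regularize f) f"
    using regularize_quotient by blast
qed

lemma regularize_regularize:
  fixes f :: "complex ^ 'n::finite \<Rightarrow> complex"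
  assumes "open U" "\<And>z. z \<in> U \<Longrightarrow> local_quotient f z" "z \<in> U"
  shows "regularize (regularize f) z = regularize f z"
  using regularize_cong[OF assms(1,3) generically_eq_regularize[OF assms(1,2)]] .

lemma mero_on_regularize:
  fixes f :: "complex ^ 'n::finite \<Rightarrow> complex"
  assumes "open U" "\<And>z. z \<in> U \<Longrightarrow> local_quotient f z"
  shows "mero_on (regularize f) U"
  unfolding mero_on_def using assms(1)
proof (intro conjI ballI)
  fix z assume z: "z \<in> U"
  then obtain N g h where N: "open N" "z \<in> N" "holo_on g N" "holo_on h N"
      "N \<subseteq> closure {w\<in>N. h w \<noteq> 0}" "generically_eq N f (\<lambda>w. g w / h w)"
    using assms(2) unfolding local_quotient_def by blast
  then have "generically_eq N (regularize f) (\<lambda>w. g w / h w)"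
    using regularize_quotient generically_eq_trans by blast
  with N show "\<exists>N g h. open N \<and> z \<in> N \<and> holo_on g N \<and> holo_on h N \<and>
        N \<subseteq> closure {w\<in>N. h w \<noteq> 0} \<and> generically_eq N (regularize f) (\<lambda>w. g w / h w)" by blast
  show "regularize f z = regularize (regularize f) z"
    using regularize_regularize[OF assms z] by simp
qed

section \<open>Quotients by groups of translations\<close>

text \<open>Covers both \<^const>\<open>std_atlas\<close>, with \<open>G = {0}\<close>, and \<^const>\<open>quotient_atlas\<close>.\<close>

locale translation_atlas =
  fixes A :: "('a, 'n::finite) atlas" and p :: "complex ^ 'n \<Rightarrow> 'a" and G :: "(complex ^ 'n) set"
  assumes chart_map: "c \<in> A \<Longrightarrow> snd c = p"
    and chart_open: "c \<in> A \<Longrightarrow> open (fst c)"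
    and chart_inj: "c \<in> A \<Longrightarrow> inj_on p (fst c)"
    and chart_cover: "\<exists>c\<in>A. z \<in> fst c"
    and fibre_iff: "p z = p w \<longleftrightarrow> w - z \<in> G"
begin

lemma zero_in_G: "0 \<in> G"
  using fibre_iff[of 0 0] by simp

lemma p_add: "g \<in> G \<Longrightarrow> p (z + g) = p z"
  using fibre_iff[of z "z + g"] by simp

lemma carrier_eq: "carrier_of A = range p"
proof
  show "carrier_of A \<subseteq> range p"
    by (auto simp: carrier_of_def chart_map)
  show "range p \<subseteq> carrier_of A"
  proof clarify
    fix z
    obtain c where "c \<in> A" "z \<in> fst c" using chart_cover by blast
    then show "p z \<in> carrier_of A"
      unfolding carrier_of_def using chart_map by fastforce
  qed
qed

lemma coords_eq: "c \<in> A \<Longrightarrow> coords c U = fst c \<inter> p -` U"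
  by (auto simp: coords_def chart_map)

lemma coords_range: "c \<in> A \<Longrightarrow> coords c (range p) = fst c"
  by (auto simp: coords_eq)

text \<open>The atlas induces the quotient topology of \<open>p\<close>: the charts cover, and every
  chart domain is open.\<close>

lemma openin_iff: "openin (manifold_topology A) U \<longleftrightarrow> U \<subseteq> range p \<and> open (p -` U)"
proof -
  have "p -` U = (\<Union>c\<in>A. coords c U)"
    using chart_cover by (fastforce simp: coords_eq)
  moreover have "coords c U = fst c \<inter> p -` U" if "c \<in> A" for c
    using that by (rule coords_eq)
  ultimately have "(\<forall>c\<in>A. open (coords c U)) \<longleftrightarrow> open (p -` U)"
    using chart_open by (metis open_Int open_UN)
  then show ?thesis
    by (simp add: openin_manifold_topology carrier_eq)
qed

lemma openin_range: "openin (manifold_topology A) (range p)"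
  by (simp add: openin_iff vimage_def)

lemma open_coords: "openin (manifold_topology A) U \<Longrightarrow> c \<in> A \<Longrightarrow> open (coords c U)"
  by (simp add: openin_manifold_topology)

text \<open>Inverting \<open>p\<close> on a chart selects the representative in its domain, here
  \<open>u + g\<close>. The hypothesis on \<open>q\<close> covers both uses: \<open>q = id\<close>
  between charts of \<open>A\<close>, and \<open>q = p\<close> on the identity chart of C^n.\<close>

lemma local_expr_eq:
  assumes "c \<in> A" "\<And>u. q (snd b u) = p u" "g \<in> G" "u + g \<in> fst c"
  shows "local_expr q b c u = u + g"
proof -
  have "local_expr q b c u = inv_into (fst c) p (p (u + g))"
    using assms by (simp add: local_expr_def chart_map p_add)
  then show ?thesis
    using assms chart_inj by simp
qed

lemma local_dom_eq:
  assumes "c \<in> A" "\<And>u. q (snd b u) = p u"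
  shows "local_dom q b c U = coords b U \<inter> (\<Union>g\<in>G. {w. w + g \<in> fst c})"
proof -
  have "p w \<in> p ` fst c \<longleftrightarrow> (\<exists>g\<in>G. w + g \<in> fst c)" for w
  proof
    assume "p w \<in> p ` fst c"
    then obtain v where "v \<in> fst c" "p w = p v" by blast
    then show "\<exists>g\<in>G. w + g \<in> fst c"
      by (intro bexI[of _ "v - w"]) (simp_all add: fibre_iff)
  next
    assume "\<exists>g\<in>G. w + g \<in> fst c"
    then show "p w \<in> p ` fst c"
      using p_add by (metis imageI)
  qed
  then show ?thesis
    using assms by (auto simp: local_dom_def chart_map)
qed

lemma open_translate_chart: "c \<in> A \<Longrightarrow> open {w. w + g \<in> fst c}"
  using open_vimage[OF chart_open, of c "\<lambda>w. w + g"] by (simp add: vimage_def continuous_intros)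

lemma open_local_dom:
  assumes "c \<in> A" "\<And>u. q (snd b u) = p u" "open (coords b U)"
  shows "open (local_dom q b c U)"
  unfolding local_dom_eq[OF assms(1,2)]
  by (intro open_Int open_UN ballI assms(3) open_translate_chart assms(1))

text \<open>Near \<open>w\<close> the local expression is translation by the fixed \<open>g\<close>,
  since \<open>u + g\<close> stays in the open chart domain.\<close>

lemma jacobian_local_expr:
  assumes "c \<in> A" "\<And>u. q (snd b u) = p u" "g \<in> G" "w + g \<in> fst c"
  shows "jacobian (local_expr q b c) w = mat 1"
proof -
  have "pd k (\<lambda>u. local_expr q b c u $ i) w = (if i = k then 1 else 0)" for i k
  proof -
    have "pd k (\<lambda>u. local_expr q b c u $ i) w = pd k (\<lambda>u. (u + g) $ i) w"
      by (rule pd_cong[OF open_translate_chart[OF assms(1), of g]])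
        (use assms in \<open>auto simp: local_expr_eq\<close>)
    also have "\<dots> = axis k 1 $ i"
      by (rule pd_eq) (auto intro!: derivative_eq_intros bounded_linear_imp_has_derivative
          bounded_linear_vec_nth)
    finally show ?thesis by (simp add: axis_def)
  qed
  then show ?thesis
    by (simp add: jacobian_def mat_def vec_eq_iff)
qed

text \<open>Changes of charts are translations by elements of \<open>G\<close>.\<close>

definition compatible :: "'a set \<Rightarrow> (('a, 'n) chart \<Rightarrow> complex ^ 'n \<Rightarrow> 'v) \<Rightarrow> bool" where
  "compatible U X \<longleftrightarrow>
    (\<forall>b\<in>A. \<forall>c\<in>A. \<forall>w\<in>coords b U. \<forall>g\<in>G. w + g \<in> fst c \<longrightarrow> X c (w + g) = X b w)"

lemma compatibleI:
  "(\<And>b c w g. b \<in> A \<Longrightarrow> c \<in> A \<Longrightarrow> w \<in> coords b U \<Longrightarrow> g \<in> G \<Longrightarrow> w + g \<in> fst c \<Longrightarrow>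
      X c (w + g) = X b w) \<Longrightarrow> compatible U X"
  unfolding compatible_def by blast

lemma compatibleD:
  "compatible U X \<Longrightarrow> b \<in> A \<Longrightarrow> c \<in> A \<Longrightarrow> w \<in> coords b U \<Longrightarrow> g \<in> G \<Longrightarrow> w + g \<in> fst c \<Longrightarrow>
    X c (w + g) = X b w"
  unfolding compatible_def by blast

lemma add_mem_coords:
  "b \<in> A \<Longrightarrow> c \<in> A \<Longrightarrow> w \<in> coords b U \<Longrightarrow> g \<in> G \<Longrightarrow> w + g \<in> fst c \<Longrightarrow> w + g \<in> coords c U"
  by (simp add: coords_eq p_add)

lemma vfield_related_iff:
  assumes "\<And>b u. b \<in> B \<Longrightarrow> q (snd b u) = p u"
  shows "vfield_related B A q U X Y \<longleftrightarrow>
    (\<forall>b\<in>B. \<forall>c\<in>A. \<forall>w\<in>coords b U. \<forall>g\<in>G. w + g \<in> fst c \<longrightarrow> Y c (w + g) = X b w)"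
proof -
  have "(\<forall>w\<in>local_dom q b c U. Y c (local_expr q b c w) = jacobian (local_expr q b c) w *v X b w) \<longleftrightarrow>
      (\<forall>w\<in>coords b U. \<forall>g\<in>G. w + g \<in> fst c \<longrightarrow> Y c (w + g) = X b w)" if "b \<in> B" "c \<in> A" for b c
  proof -
    have "Y c (local_expr q b c w) = jacobian (local_expr q b c) w *v X b w \<longleftrightarrow> Y c (w + g) = X b w"
      if "g \<in> G" "w + g \<in> fst c" for w g
      using local_expr_eq[OF \<open>c \<in> A\<close> assms[OF \<open>b \<in> B\<close>] that]
        jacobian_local_expr[OF \<open>c \<in> A\<close> assms[OF \<open>b \<in> B\<close>] that] by simp
    then show ?thesis
      unfolding local_dom_eq[OF \<open>c \<in> A\<close> assms[OF \<open>b \<in> B\<close>]] by blast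
  qed
  then show ?thesis
    unfolding vfield_related_def by simp
qed

lemma vform_relatedI:
  assumes q: "\<And>b u. b \<in> B \<Longrightarrow> q (snd b u) = p u" and op: "\<And>b. b \<in> B \<Longrightarrow> open (coords b U)"
    and eq: "\<And>b c w g. b \<in> B \<Longrightarrow> c \<in> A \<Longrightarrow> w \<in> coords b U \<Longrightarrow> g \<in> G \<Longrightarrow> w + g \<in> fst c \<Longrightarrow>
      \<eta> c (w + g) = \<omega> b w"
  shows "vform_related B A q U \<omega> \<eta>"
  unfolding vform_related_def
proof (intro ballI generically_eqI)
  fix b c assume b: "b \<in> B" and c: "c \<in> A"
  show "open (local_dom q b c U)"
    by (rule open_local_dom[OF c q[OF b] op[OF b]])
  fix w assume "w \<in> local_dom q b c U"
  then obtain g where g: "w \<in> coords b U" "g \<in> G" "w + g \<in> fst c"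
    using local_dom_eq[OF c q[OF b]] by auto
  show "\<eta> c (local_expr q b c w) ** jacobian (local_expr q b c) w =
      jacobian (local_expr q b c) w ** \<omega> b w"
    using eq[OF b c g] local_expr_eq[OF c q[OF b] g(2,3)] jacobian_local_expr[OF c q[OF b] g(2,3)]
    by (simp add: matrix_mul_lid matrix_mul_rid)
qed

text \<open>The relation is only generic; the hypotheses \<open>reg\<close> say that both sides are
  in normal form at the points compared, which turns it into an equation there.\<close>

lemma vform_relatedD:
  assumes rel: "vform_related B A q U \<omega> \<eta>" and b: "b \<in> B" and c: "c \<in> A"
    and q: "\<And>u. q (snd b u) = p u" and op: "open (coords b U)"
    and g: "w \<in> coords b U" "g \<in> G" "w + g \<in> fst c"
    and reg: "\<And>i k. \<omega> b w $ i $ k = regularize (\<lambda>z. \<omega> b z $ i $ k) w"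
      "\<And>i k. \<eta> c (w + g) $ i $ k = regularize (\<lambda>z. \<eta> c z $ i $ k) (w + g)"
  shows "\<eta> c (w + g) = \<omega> b w"
proof -
  define N where "N = coords b U \<inter> {u. u + g \<in> fst c}"
  have N: "open N" "w \<in> N" "N \<subseteq> local_dom q b c U"
    using op open_translate_chart[OF c] g local_dom_eq[OF c q] by (auto simp: N_def)
  have "generically_eq N (\<lambda>w. \<eta> c (local_expr q b c w) ** jacobian (local_expr q b c) w)
        (\<lambda>w. jacobian (local_expr q b c) w ** \<omega> b w)"
    using rel b c N generically_eq_subset[OF _ open_local_dom[OF c q op]]
    unfolding vform_related_def by blast
  then have "generically_eq N (\<lambda>u. \<eta> c (u + g)) (\<omega> b)"
  proof (rule generically_eq_lift[OF N(1)])
    fix u assume "u \<in> N"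
      and "\<eta> c (local_expr q b c u) ** jacobian (local_expr q b c) u =
        jacobian (local_expr q b c) u ** \<omega> b u"
    then show "\<eta> c (u + g) = \<omega> b u"
      using local_expr_eq[OF c q g(2), of u] jacobian_local_expr[OF c q g(2), of u]
      by (simp add: N_def matrix_mul_lid matrix_mul_rid)
  qed
  then have ev: "generically_eq N (\<lambda>u. \<eta> c (u + g) $ i $ k) (\<lambda>u. \<omega> b u $ i $ k)" for i k
    by (rule generically_eq_lift[OF N(1)]) simp
  have "\<eta> c (w + g) $ i $ k = \<omega> b w $ i $ k" for i k
  proof -
    have "\<eta> c (w + g) $ i $ k = regularize (\<lambda>z. \<eta> c z $ i $ k) (w + g)"
      by (rule reg(2))
    also have "\<dots> = regularize (\<lambda>u. \<eta> c (u + g) $ i $ k) w"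
      by (rule regularize_translate[symmetric])
    also have "\<dots> = regularize (\<lambda>u. \<omega> b u $ i $ k) w"
      by (rule regularize_cong[OF N(1,2) ev])
    also have "\<dots> = \<omega> b w $ i $ k"
      by (rule reg(1)[symmetric])
    finally show ?thesis .
  qed
  then show ?thesis
    by (simp only: vec_eq_iff) blast
qed

lemma vector_fields_iff:
  "X \<in> vector_fields A U \<longleftrightarrow>
     (\<forall>c z. \<not> (c \<in> A \<and> z \<in> coords c U) \<longrightarrow> X c z = 0) \<and>
     (\<forall>c\<in>A. \<forall>i. holo_on (\<lambda>z. X c z $ i) (coords c U)) \<and> compatible U X"
proof -
  have "vfield_related A A id U X X \<longleftrightarrow> compatible U X"
    unfolding compatible_def by (rule vfield_related_iff) (simp add: chart_map)
  then show ?thesis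
    by (simp add: vector_fields_def)
qed

lemma vector_fieldsI:
  assumes "\<And>c z. \<not> (c \<in> A \<and> z \<in> coords c U) \<Longrightarrow> X c z = 0"
    and "\<And>c i. c \<in> A \<Longrightarrow> holo_on (\<lambda>z. X c z $ i) (coords c U)" and "compatible U X"
  shows "X \<in> vector_fields A U"
  unfolding vector_fields_iff using assms by blast

lemma vector_fieldsD:
  assumes "X \<in> vector_fields A U"
  shows "\<not> (c \<in> A \<and> z \<in> coords c U) \<Longrightarrow> X c z = 0"
    and "c \<in> A \<Longrightarrow> holo_on (\<lambda>z. X c z $ i) (coords c U)" and "compatible U X"
  using assms unfolding vector_fields_iff by blast+

lemma holo_fun_iff: "holo_fun A U f \<longleftrightarrow> (\<forall>c\<in>A. holo_on (\<lambda>z. f (p z)) (coords c U))"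
  by (simp add: holo_fun_def chart_map)

lemma mero_vforms_compatible:
  assumes U: "openin (manifold_topology A) U" and w: "\<omega> \<in> mero_vforms A D U"
  shows "compatible U \<omega>"
  unfolding compatible_def
proof (intro ballI impI)
  fix b c w g assume *: "b \<in> A" "c \<in> A" "w \<in> coords b U" "g \<in> G" "w + g \<in> fst c"
  then have "w + g \<in> coords c U"
    by (simp add: coords_eq p_add)
  then show "\<omega> c (w + g) = \<omega> b w"
    using * assms(2) chart_map open_coords[OF U]
    by (intro vform_relatedD[of A id U \<omega> \<omega>]) (auto simp: mero_vforms_def mero_on_def)
qed

text \<open>The components pulled back to C^n. The arbitrary choice of a chart is harmless for
  compatible families, see \<open>lift_eq\<close>.\<close>

definition lift :: "(('a, 'n) chart \<Rightarrow> complex ^ 'n \<Rightarrow> 'v) \<Rightarrow> complex ^ 'n \<Rightarrow> 'v" where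
  "lift X z = X (SOME c. c \<in> A \<and> z \<in> fst c) z"

lemma lift_eq:
  assumes "compatible U X" "c \<in> A" "z \<in> coords c U"
  shows "lift X z = X c z"
proof -
  define b where "b = (SOME c. c \<in> A \<and> z \<in> fst c)"
  have "\<exists>c. c \<in> A \<and> z \<in> fst c"
    using chart_cover by blast
  then have "b \<in> A \<and> z \<in> fst b"
    unfolding b_def by (rule someI_ex)
  then have "X b (z + 0) = X c z"
    using assms zero_in_G by (intro assms(1)[unfolded compatible_def, rule_format]) auto
  then show ?thesis
    by (simp add: lift_def b_def)
qed

lemma lift_add:
  assumes "compatible U X" "p z \<in> U" "g \<in> G"
  shows "lift X (z + g) = lift X z"
proof -
  obtain b c where *: "b \<in> A" "z \<in> fst b" "c \<in> A" "z + g \<in> fst c"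
    using chart_cover by metis
  then have "lift X (z + g) = X c (z + g)" "lift X z = X b z"
    using assms by (auto intro!: lift_eq simp: coords_eq p_add)
  then show ?thesis
    using assms * by (auto simp: compatible_def coords_eq)
qed

end

section \<open>Connections and their Christoffel symbols\<close>

text \<open>The classical component of the covariant derivative, partial derivative plus Christoffel
  term, as a raw formula whose values at poles carry no meaning.\<close>

definition covariant_coeff ::
    "('n \<Rightarrow> complex ^ 'n \<Rightarrow> complex ^ 'n ^ 'n) \<Rightarrow> (complex ^ 'n \<Rightarrow> complex ^ 'n) \<Rightarrow> 'n \<Rightarrow> 'n \<Rightarrow>
     complex ^ 'n \<Rightarrow> complex" where
  "covariant_coeff \<Gamma> X i k z = pd k (\<lambda>w. X w $ i) z + (\<Sum>j\<in>UNIV. X z $ j * \<Gamma> j z $ i $ k)"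

text \<open>
  \<open>\<Gamma> j z $ i $ k\<close> is the coefficient of \<open>dz\<^sub>k \<otimes> \<partial>/\<partial>z\<^sub>i\<close> in the image of \<open>\<partial>/\<partial>z\<^sub>j\<close>. The
  regularization is forced by the normal form of meromorphic functions.
\<close>

definition connection_of ::
    "('a, 'n::finite) atlas \<Rightarrow> ('n \<Rightarrow> complex ^ 'n \<Rightarrow> complex ^ 'n ^ 'n) \<Rightarrow> ('a, 'n) connection" where
  "connection_of A \<Gamma> U X =
    (if openin (manifold_topology A) U \<and> X \<in> vector_fields A U
     then (\<lambda>c z. if c \<in> A \<and> z \<in> coords c U
       then \<chi> i k. regularize (covariant_coeff \<Gamma> (X c) i k) z else 0)
     else undefined)"

definition frame :: "('a, 'n) atlas \<Rightarrow> 'n \<Rightarrow> ('a, 'n::finite) vfield" where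
  "frame A j = (\<lambda>c z. if c \<in> A \<and> z \<in> fst c then axis j 1 else 0)"

lemma covariant_coeff_cong:
  assumes "open N" "z \<in> N" "\<And>w. w \<in> N \<Longrightarrow> X w = Y w"
  shows "covariant_coeff \<Gamma> X i k z = covariant_coeff \<Gamma> Y i k z"
  using assms pd_cong[OF assms(1,2), of "\<lambda>w. X w $ i" "\<lambda>w. Y w $ i"]
  by (simp add: covariant_coeff_def)

lemma regularize_covariant_coeff_cong:
  assumes "open N" "z \<in> N" "\<And>w. w \<in> N \<Longrightarrow> X w = Y w"
  shows "regularize (covariant_coeff \<Gamma> X i k) z = regularize (covariant_coeff \<Gamma> Y i k) z"
  using assms covariant_coeff_cong
  by (intro regularize_cong[OF assms(1,2)] generically_eqI) blast+

lemma mero_connectionD: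
  assumes "mero_connection A D conn" "openin (manifold_topology A) U"
  shows "X \<in> vector_fields A U \<Longrightarrow> conn U X \<in> mero_vforms A D U"
    and "openin (manifold_topology A) W \<Longrightarrow> W \<subseteq> U \<Longrightarrow> X \<in> vector_fields A U \<Longrightarrow>
      conn W (restrict_section A W X) = restrict_section A W (conn U X)"
    and "X \<in> vector_fields A U \<Longrightarrow> Y \<in> vector_fields A U \<Longrightarrow>
      vform_eq A U (conn U (\<lambda>c z. X c z + Y c z)) (\<lambda>c z. conn U X c z + conn U Y c z)"
    and "X \<in> vector_fields A U \<Longrightarrow>
      vform_eq A U (conn U (\<lambda>c z. a *s X c z)) (\<lambda>c z. \<chi> i k. a * conn U X c z $ i $ k)"
    and "X \<in> vector_fields A U \<Longrightarrow> holo_fun A U f \<Longrightarrow>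
      vform_eq A U (conn U (\<lambda>c z. f (snd c z) *s X c z))
        (\<lambda>c z. d_tensor f X c z + (\<chi> i k. f (snd c z) * conn U X c z $ i $ k))"
proof -
  note * = conjunct2[OF assms(1)[unfolded mero_connection_def], THEN spec[of _ U], THEN mp, OF assms(2)]
  note 1 = *[THEN conjunct1] and r1 = *[THEN conjunct2]
  note 2 = r1[THEN conjunct1] and r2 = r1[THEN conjunct2]
  note 3 = r2[THEN conjunct1] and r3 = r2[THEN conjunct2]
  note 4 = r3[THEN conjunct1] and 5 = r3[THEN conjunct2]
  show "X \<in> vector_fields A U \<Longrightarrow> conn U X \<in> mero_vforms A D U"
    using 1 by (rule bspec)
  show "openin (manifold_topology A) W \<Longrightarrow> W \<subseteq> U \<Longrightarrow> X \<in> vector_fields A U \<Longrightarrow>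
      conn W (restrict_section A W X) = restrict_section A W (conn U X)"
    by (rule 2[rule_format]) simp
  show "X \<in> vector_fields A U \<Longrightarrow> Y \<in> vector_fields A U \<Longrightarrow>
      vform_eq A U (conn U (\<lambda>c z. X c z + Y c z)) (\<lambda>c z. conn U X c z + conn U Y c z)"
    by (rule 3[rule_format])
  show "X \<in> vector_fields A U \<Longrightarrow>
      vform_eq A U (conn U (\<lambda>c z. a *s X c z)) (\<lambda>c z. \<chi> i k. a * conn U X c z $ i $ k)"
    by (rule 4[rule_format])
  show "X \<in> vector_fields A U \<Longrightarrow> holo_fun A U f \<Longrightarrow>
      vform_eq A U (conn U (\<lambda>c z. f (snd c z) *s X c z))
        (\<lambda>c z. d_tensor f X c z + (\<chi> i k. f (snd c z) * conn U X c z $ i $ k))"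
    by (rule 5[rule_format])
qed

lemma mero_connection_undefined:
  assumes "mero_connection A D conn" "\<not> (openin (manifold_topology A) U \<and> X \<in> vector_fields A U)"
  shows "conn U X = undefined"
  using conjunct1[OF assms(1)[unfolded mero_connection_def]] assms(2) by blast

lemma mero_vformsD:
  assumes "\<omega> \<in> mero_vforms A D U"
  shows "\<not> (c \<in> A \<and> z \<in> coords c U) \<Longrightarrow> \<omega> c z = 0"
    and "c \<in> A \<Longrightarrow> mero_on (\<lambda>z. \<omega> c z $ i $ k) (coords c U)"
  using assms unfolding mero_vforms_def by blast+

context translation_atlas
begin

lemma frame_vector_field: "frame A j \<in> vector_fields A (range p)"
proof (rule vector_fieldsI)
  fix c i assume c: "c \<in> A"
  show "holo_on (\<lambda>z. frame A j c z $ i) (coords c (range p))"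
    by (rule holo_on_cong[OF _ holo_on_const[of _ "axis j 1 $ i"]])
      (auto simp: frame_def c coords_range chart_open)
next
  show "compatible (range p) (frame A j)"
    by (rule compatibleI) (simp add: frame_def coords_range)
qed (auto simp: frame_def coords_range)

lemma restrict_vector_field:
  assumes X: "X \<in> vector_fields A U" and W: "openin (manifold_topology A) W" "W \<subseteq> U"
  shows "restrict_section A W X \<in> vector_fields A W"
proof (rule vector_fieldsI)
  fix c i assume c: "c \<in> A"
  have "holo_on (\<lambda>z. X c z $ i) (coords c W)"
    using W(2) by (intro holo_on_subset[OF vector_fieldsD(2)[OF X c] _ open_coords[OF W(1) c]])
      (auto simp: coords_eq[OF c])
  then show "holo_on (\<lambda>z. restrict_section A W X c z $ i) (coords c W)"
    by (rule holo_on_cong[rotated]) (simp add: restrict_section_def c)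
next
  show "compatible W (restrict_section A W X)"
  proof (rule compatibleI)
    fix b c w g assume *: "b \<in> A" "c \<in> A" "w \<in> coords b W" "g \<in> G" "w + g \<in> fst c"
    then have "w \<in> coords b U"
      using W(2) by (auto simp: coords_eq)
    then show "restrict_section A W X c (w + g) = restrict_section A W X b w"
      using * add_mem_coords[OF *] compatibleD[OF vector_fieldsD(3)[OF X]]
      by (simp add: restrict_section_def)
  qed
qed (auto simp: restrict_section_def)

lemma add_vector_field:
  assumes "X \<in> vector_fields A U" "Y \<in> vector_fields A U"
  shows "(\<lambda>c z. X c z + Y c z) \<in> vector_fields A U"
proof (rule vector_fieldsI)
  show "compatible U (\<lambda>c z. X c z + Y c z)"
    by (rule compatibleI) (simp add: assms[THEN vector_fieldsD(3), THEN compatibleD])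
qed (simp_all add: assms[THEN vector_fieldsD(1)] assms[THEN vector_fieldsD(2)] holo_on_add)

lemma scale_vector_field:
  assumes "X \<in> vector_fields A U" "holo_fun A U f"
  shows "(\<lambda>c z. f (snd c z) *s X c z) \<in> vector_fields A U"
proof (rule vector_fieldsI)
  fix c i assume c: "c \<in> A"
  show "holo_on (\<lambda>z. (f (snd c z) *s X c z) $ i) (coords c U)"
    using assms(2) c vector_fieldsD(2)[OF assms(1) c]
    by (auto simp: holo_fun_iff chart_map intro: holo_on_mult)
next
  show "compatible U (\<lambda>c z. f (snd c z) *s X c z)"
    by (rule compatibleI)
      (simp add: assms(1)[THEN vector_fieldsD(3), THEN compatibleD] chart_map p_add)
qed (simp add: assms(1)[THEN vector_fieldsD(1)])

text \<open>The Leibniz rule for finite combinations with holomorphic coefficients. Additivity holds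
  only up to generic equality, so the induction composes such equalities.\<close>

lemma connection_sum:
  assumes conn: "mero_connection A D conn" and U: "openin (manifold_topology A) U"
    and X: "\<And>j. j \<in> J \<Longrightarrow> X j \<in> vector_fields A U" and f: "\<And>j. j \<in> J \<Longrightarrow> holo_fun A U (f j)"
    and J: "finite J"
  shows "(\<lambda>c z. \<Sum>j\<in>J. f j (snd c z) *s X j c z) \<in> vector_fields A U \<and>
    vform_eq A U (conn U (\<lambda>c z. \<Sum>j\<in>J. f j (snd c z) *s X j c z))
      (\<lambda>c z. \<Sum>j\<in>J. d_tensor (f j) (X j) c z + (\<chi> i k. f j (snd c z) * conn U (X j) c z $ i $ k))"
  using J X f
proof (induction J rule: finite_induct)
  case empty
  define Z :: "('a, 'n) vfield" where "Z = (\<lambda>c z. 0)"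
  have Z: "Z \<in> vector_fields A U"
    using open_coords[OF U]
    by (intro vector_fieldsI compatibleI) (simp_all add: Z_def holo_on_const)
  \<comment> \<open>The empty sum is not an instance of additivity; that the zero field has
    generically zero image comes from homogeneity with the scalar 0.\<close>
  have "vform_eq A U (conn U (\<lambda>c z. 0 *s Z c z)) (\<lambda>c z. \<chi> i k. 0 * conn U Z c z $ i $ k)"
    by (rule mero_connectionD(4)[OF conn U Z])
  moreover have "(\<lambda>c z. 0 *s Z c z) = Z"
    by (simp add: Z_def)
  moreover have "(\<lambda>c z. \<chi> i k. 0 * conn U Z c z $ i $ k) = (\<lambda>c z. 0)"
    by (simp add: vec_eq_iff fun_eq_iff)
  ultimately show ?case
    using Z by (simp add: Z_def)
next
  case (insert j J)
  let ?S = "\<lambda>c z. \<Sum>j\<in>J. f j (snd c z) *s X j c z" and ?F = "\<lambda>c z. f j (snd c z) *s X j c z"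
  let ?T = "\<lambda>c z. \<Sum>j\<in>J. d_tensor (f j) (X j) c z + (\<chi> i k. f j (snd c z) * conn U (X j) c z $ i $ k)"
  have IH: "?S \<in> vector_fields A U" "vform_eq A U (conn U ?S) ?T"
    using insert by auto
  have F: "?F \<in> vector_fields A U"
    using insert.prems by (intro scale_vector_field) auto
  have 1: "vform_eq A U (conn U (\<lambda>c z. ?F c z + ?S c z)) (\<lambda>c z. conn U ?F c z + conn U ?S c z)"
    by (rule mero_connectionD(3)[OF conn U F IH(1)])
  have 2: "vform_eq A U (conn U ?F)
      (\<lambda>c z. d_tensor (f j) (X j) c z + (\<chi> i k. f j (snd c z) * conn U (X j) c z $ i $ k))"
    using insert.prems by (intro mero_connectionD(5)[OF conn U]) auto
  have "vform_eq A U (conn U (\<lambda>c z. ?F c z + ?S c z))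
      (\<lambda>c z. (d_tensor (f j) (X j) c z + (\<chi> i k. f j (snd c z) * conn U (X j) c z $ i $ k)) + ?T c z)"
    unfolding vform_eq_def
  proof
    fix c assume c: "c \<in> A"
    note o = open_coords[OF U c]
    have "generically_eq (coords c U) (\<lambda>z. conn U ?F c z + conn U ?S c z)
      (\<lambda>z. (d_tensor (f j) (X j) c z + (\<chi> i k. f j (snd c z) * conn U (X j) c z $ i $ k)) + ?T c z)"
      by (rule generically_eq_lift2[OF o bspec[OF 2[unfolded vform_eq_def] c]
            bspec[OF IH(2)[unfolded vform_eq_def] c]]) (simp only:)
    then show "generically_eq (coords c U) (conn U (\<lambda>c z. ?F c z + ?S c z) c)
      (\<lambda>z. (d_tensor (f j) (X j) c z + (\<chi> i k. f j (snd c z) * conn U (X j) c z $ i $ k)) + ?T c z)"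
      by (rule generically_eq_trans[OF o bspec[OF 1[unfolded vform_eq_def] c]])
  qed
  then show ?case
    using insert.hyps add_vector_field[OF F IH(1)] by simp
qed

section \<open>Recovering a connection from its Christoffel symbols\<close>

definition christoffel :: "('a, 'n) connection \<Rightarrow> 'n \<Rightarrow> complex ^ 'n \<Rightarrow> complex ^ 'n ^ 'n" where
  "christoffel conn j = lift (conn (range p) (frame A j))"

lemma frame_image_vform:
  assumes "mero_connection A D conn"
  shows "conn (range p) (frame A j) \<in> mero_vforms A D (range p)"
  by (rule mero_connectionD(1)[OF assms openin_range frame_vector_field])

lemma christoffel_eq:
  assumes "mero_connection A D conn" "c \<in> A" "z \<in> fst c"
  shows "christoffel conn j z = conn (range p) (frame A j) c z"
  unfolding christoffel_def
  by (rule lift_eq[OF mero_vforms_compatible[OF openin_range frame_image_vform[OF assms(1)]]])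
    (use assms in \<open>auto simp: coords_range\<close>)

lemma christoffel_invariant:
  assumes "mero_connection A D conn" "g \<in> G"
  shows "christoffel conn j (z + g) = christoffel conn j z"
  unfolding christoffel_def
  by (rule lift_add[OF mero_vforms_compatible[OF openin_range frame_image_vform[OF assms(1)]]])
    (use assms in auto)

lemma mero_on_christoffel:
  assumes "mero_connection A D conn"
  shows "mero_on (\<lambda>z. christoffel conn j z $ i $ k) UNIV"
proof (rule mero_on_local)
  fix z :: "complex ^ 'n"
  obtain c where c: "c \<in> A" "z \<in> fst c" using chart_cover by blast
  have "mero_on (\<lambda>z. conn (range p) (frame A j) c z $ i $ k) (fst c)"
    using mero_vformsD(2)[OF frame_image_vform[OF assms] c(1)] by (simp add: coords_range c(1))
  then have "mero_on (\<lambda>z. christoffel conn j z $ i $ k) (fst c)"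
    by (rule mero_on_cong) (simp add: christoffel_eq[OF assms c(1)])
  then show "\<exists>N. open N \<and> z \<in> N \<and> mero_on (\<lambda>z. christoffel conn j z $ i $ k) N"
    using c chart_open by blast
qed simp

text \<open>Over \<open>U\<close> a field is a combination of the restricted coordinate fields.
  Compatibility with restriction identifies the images of these with the global symbols, and the
  Leibniz rule yields the covariant derivative formula generically. Normal forms turn this into
  equality of functions.\<close>

lemma connection_eq:
  assumes conn: "mero_connection A D conn"
  shows "conn = connection_of A (christoffel conn)"
proof (intro ext)
  fix U X c z
  show "conn U X c z = connection_of A (christoffel conn) U X c z"
  proof (cases "openin (manifold_topology A) U \<and> X \<in> vector_fields A U")
    case False
    then have "conn U X = undefined"
      by (rule mero_connection_undefined[OF conn])
    moreover have "connection_of A (christoffel conn) U X = undefined"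
      unfolding connection_of_def by (simp only: False if_False)
    ultimately show ?thesis by simp
  next
    case True
    then have U: "openin (manifold_topology A) U" and X: "X \<in> vector_fields A U" by auto
    have UX: "conn U X \<in> mero_vforms A D U"
      by (rule mero_connectionD(1)[OF conn U X])
    show ?thesis
    proof (cases "c \<in> A \<and> z \<in> coords c U")
      case False
      then have "conn U X c z = 0"
        by (rule mero_vformsD(1)[OF UX])
      moreover have "connection_of A (christoffel conn) U X c z = 0"
        unfolding connection_of_def by (simp only: True False simp_thms if_True if_False)
      ultimately show ?thesis by simp
    next
      case cz: True
      have Up: "U \<subseteq> range p" using U by (simp add: openin_iff)
      have comp: "compatible U X" using X by (rule vector_fieldsD(3))
      \<comment> \<open>The Leibniz rule multiplies by functions on the manifold, so the components
        are transported down by choosing a representative; invariance of \<open>lift\<close> makes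
        the choice irrelevant.\<close>
      define x where "x j a = lift X (SOME w. p w = a) $ j" for j a
      have x: "x j (p w) = X b w $ j" if "b \<in> A" "w \<in> coords b U" for b w j
      proof -
        define v where "v = (SOME v. p v = p w)"
        have v: "p v = p w" unfolding v_def by (rule someI) (rule refl)
        then have "w - v \<in> G" by (simp add: fibre_iff)
        then have "lift X (v + (w - v)) = lift X v"
          using that v by (intro lift_add[OF comp]) (simp_all add: coords_eq)
        then show ?thesis
          using lift_eq[OF comp that] by (simp add: x_def v_def)
      qed
      have hx: "holo_fun A U (x j)" for j
        unfolding holo_fun_iff
      proof
        fix b assume b: "b \<in> A"
        have "holo_on (\<lambda>z. X b z $ j) (coords b U)"
          using X b by (rule vector_fieldsD(2))
        then show "holo_on (\<lambda>z. x j (p z)) (coords b U)"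
          by (rule holo_on_cong[rotated]) (rule x[OF b])
      qed
      define E where "E j = restrict_section A U (frame A j)" for j
      have E: "E j \<in> vector_fields A U" for j
        unfolding E_def by (rule restrict_vector_field[OF frame_vector_field U Up])
      have Eb: "E j b w = (if b \<in> A \<and> w \<in> coords b U then axis j 1 else 0)" for j b w
        by (auto simp: E_def restrict_section_def frame_def coords_eq)
      have connE: "conn U (E j) b w = christoffel conn j w" if "b \<in> A" "w \<in> coords b U" for j b w
      proof -
        have "conn U (E j) = restrict_section A U (conn (range p) (frame A j))"
          unfolding E_def by (rule mero_connectionD(2)[OF conn openin_range U Up frame_vector_field])
        then show ?thesis
          using that christoffel_eq[OF conn, of b w j] by (simp add: restrict_section_def coords_eq)
      qed
      have sum: "(\<lambda>b w. \<Sum>j\<in>UNIV. x j (snd b w) *s E j b w) = X"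
      proof (intro ext)
        fix b w
        show "(\<Sum>j\<in>UNIV. x j (snd b w) *s E j b w) = X b w"
        proof (cases "b \<in> A \<and> w \<in> coords b U")
          case True
          then have "(\<Sum>j\<in>UNIV. x j (snd b w) *s E j b w) = (\<Sum>j\<in>UNIV. X b w $ j *s axis j 1)"
            by (intro sum.cong) (simp_all add: Eb x[of b w] chart_map)
          then show ?thesis
            by (simp add: basis_expansion)
        next
          case False
          then have "X b w = 0" by (rule vector_fieldsD(1)[OF X])
          with False show ?thesis by (auto simp: Eb)
        qed
      qed
      have "vform_eq A U (conn U X) (\<lambda>c z. \<Sum>j\<in>UNIV. d_tensor (x j) (E j) c z +
          (\<chi> i k. x j (snd c z) * conn U (E j) c z $ i $ k))"
        using connection_sum[OF conn U, of UNIV E x] E hx unfolding sum by simp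
      then have gen: "generically_eq (coords c U) (conn U X c) (\<lambda>z. \<Sum>j\<in>UNIV. d_tensor (x j) (E j) c z +
          (\<chi> i k. x j (snd c z) * conn U (E j) c z $ i $ k))"
        using cz unfolding vform_eq_def by blast
      have o: "open (coords c U)" using open_coords[OF U] cz by blast
      have "conn U X c z $ i $ k = regularize (covariant_coeff (christoffel conn) (X c) i k) z" for i k
      proof -
        have "generically_eq (coords c U) (\<lambda>z. conn U X c z $ i $ k)
            (covariant_coeff (christoffel conn) (X c) i k)"
        proof (rule generically_eq_lift[OF o gen])
          fix w assume w: "w \<in> coords c U"
            and eq: "conn U X c w = (\<Sum>j\<in>UNIV. d_tensor (x j) (E j) c w +
              (\<chi> i k. x j (snd c w) * conn U (E j) c w $ i $ k))"
          have c: "c \<in> A" using cz by blast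
          have "pd k (\<lambda>u. x i (p u)) w = pd k (\<lambda>u. X c u $ i) w"
            by (rule pd_cong[OF o w]) (rule x[OF c])
          moreover have "(\<Sum>j\<in>UNIV. pd k (\<lambda>u. x j (p u)) w * axis j 1 $ i) = pd k (\<lambda>u. x i (p u)) w"
            by (simp add: axis_def if_distrib cong: if_cong)
          ultimately show "conn U X c w $ i $ k = covariant_coeff (christoffel conn) (X c) i k w"
            unfolding eq using w c
            by (simp add: d_tensor_def Eb connE x[of c w] chart_map sum.distrib covariant_coeff_def)
        qed
        \<comment> \<open>Generic equality gives equal regularizations, and the components of
          \<open>conn U X\<close> are already in normal form.\<close>
        then have "regularize (\<lambda>z. conn U X c z $ i $ k) z =
            regularize (covariant_coeff (christoffel conn) (X c) i k) z"
          using cz by (intro regularize_cong[OF o]) auto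
        moreover have "conn U X c z $ i $ k = regularize (\<lambda>z. conn U X c z $ i $ k) z"
          using mero_vformsD(2)[OF UX, of c i k] cz unfolding mero_on_def by blast
        ultimately show ?thesis by metis
      qed
      then show ?thesis
        using True cz by (simp add: connection_of_def vec_eq_iff)
    qed
  qed
qed

text \<open>Constant components have zero derivative, so only the symbol survives; its normal form,
  the last hypothesis, removes the outer regularization.\<close>

lemma christoffel_connection_of:
  assumes "c \<in> A" "z \<in> fst c"
    and "\<And>i k. regularize (\<lambda>z. \<Gamma> j z $ i $ k) z = \<Gamma> j z $ i $ k"
  shows "connection_of A \<Gamma> (range p) (frame A j) c z = \<Gamma> j z"
proof -
  have "regularize (covariant_coeff \<Gamma> (frame A j c) i k) z = \<Gamma> j z $ i $ k" for i k
  proof -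
    have "regularize (covariant_coeff \<Gamma> (frame A j c) i k) z =
        regularize (covariant_coeff \<Gamma> (\<lambda>z. axis j 1) i k) z"
      by (rule regularize_covariant_coeff_cong[OF chart_open[OF assms(1)] assms(2)])
        (simp add: frame_def assms(1))
    also have "covariant_coeff \<Gamma> (\<lambda>z. axis j 1) i k = (\<lambda>z. \<Gamma> j z $ i $ k)"
      by (auto simp: covariant_coeff_def pd_const axis_def if_distrib[of "\<lambda>x. x * _"] cong: if_cong)
    finally show ?thesis by (simp add: assms(3))
  qed
  then show ?thesis
    using assms openin_range frame_vector_field
    by (simp add: connection_of_def coords_range vec_eq_iff)
qed

end

section \<open>Meromorphic functions of one coordinate\<close>

lemma meromorphic_local_quotient:
  assumes "f meromorphic_on {b}"
  shows "\<exists>m r F. 0 < r \<and> F holomorphic_on ball b r \<and> (\<forall>w\<in>ball b r - {b}. (w - b) ^ m * f w = F w)"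
proof (cases "\<exists>\<^sub>F w in at b. f w \<noteq> 0")
  case True
  have "isolated_singularity_at f b" "not_essential f b"
    using assms by (auto simp: meromorphic_at_iff)
  from zorder_exist[OF this True] obtain r where r: "r > 0" "zor_poly f b holomorphic_on cball b r"
      "\<And>w. w \<in> cball b r - {b} \<Longrightarrow> f w = zor_poly f b w * (w - b) powi zorder f b"
    by blast
  \<comment> \<open>The pole order, or 0 if there is no pole. The exponent
    \<open>zorder f b + int m\<close> is then nonnegative, so an ordinary power of
    \<open>w - b\<close> remains.\<close>
  define m where "m = nat (- zorder f b)"
  define F where "F w = zor_poly f b w * (w - b) ^ nat (zorder f b + int m)" for w
  have "zor_poly f b holomorphic_on ball b r"
    using r(2) by (rule holomorphic_on_subset) auto
  then have "F holomorphic_on ball b r"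
    unfolding F_def by (intro holomorphic_intros)
  moreover have "(w - b) ^ m * f w = F w" if "w \<in> ball b r - {b}" for w
  proof -
    have "(w - b) ^ m * (w - b) powi zorder f b = (w - b) powi (int m + zorder f b)"
      using that by (subst power_int_add) auto
    also have "\<dots> = (w - b) ^ nat (zorder f b + int m)"
      by (simp add: power_int_def m_def add.commute)
    finally show ?thesis
      using r(3)[of w] that by (simp add: F_def mult_ac)
  qed
  ultimately show ?thesis
    using r(1) by blast
next
  case False
  then have "\<forall>\<^sub>F w in at b. f w = 0"
    by (simp add: frequently_def)
  then obtain r where "0 < r" "\<And>w. w \<noteq> b \<Longrightarrow> dist w b < r \<Longrightarrow> f w = 0"
    unfolding eventually_at by auto
  then show ?thesis
    by (intro exI[of _ 0] exI[of _ r] exI[of _ "\<lambda>w. 0"]) (auto simp: dist_commute)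
qed

text \<open>A covariant derivative sums several coefficient functions, which must be cleared by one
  power. Adding the exponents suffices, since no minimal exponent is wanted.\<close>

lemma meromorphic_common_denominator:
  assumes "finite I" "\<And>i. i \<in> I \<Longrightarrow> f i meromorphic_on {b}"
  shows "\<exists>m r. 0 < r \<and> (\<forall>i\<in>I. \<exists>F. F holomorphic_on ball b r \<and>
    (\<forall>w\<in>ball b r - {b}. (w - b) ^ m * f i w = F w))"
  using assms
proof (induction I rule: finite_induct)
  case empty
  show ?case by (auto intro: exI[of _ 1])
next
  case (insert i I)
  have "\<exists>m r. 0 < r \<and> (\<forall>i\<in>I. \<exists>F. F holomorphic_on ball b r \<and>
      (\<forall>w\<in>ball b r - {b}. (w - b) ^ m * f i w = F w))"
    by (rule insert.IH) (simp add: insert.prems)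
  then obtain m r where mr: "0 < r" "\<And>i. i \<in> I \<Longrightarrow> \<exists>F. F holomorphic_on ball b r \<and>
      (\<forall>w\<in>ball b r - {b}. (w - b) ^ m * f i w = F w)"
    by blast
  obtain n s H where ns: "0 < s" "H holomorphic_on ball b s"
      "\<And>w. w \<in> ball b s - {b} \<Longrightarrow> (w - b) ^ n * f i w = H w"
    using meromorphic_local_quotient[OF insert.prems[OF insertI1]] by blast
  have "\<exists>F. F holomorphic_on ball b (min r s) \<and>
      (\<forall>w\<in>ball b (min r s) - {b}. (w - b) ^ (m + n) * f j w = F w)" if j: "j \<in> insert i I" for j
  proof (cases "j = i")
    case True
    have "(\<lambda>w. (w - b) ^ m * H w) holomorphic_on ball b (min r s)"
      using ns(2) by (intro holomorphic_intros) (auto elim: holomorphic_on_subset)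
    moreover have "(w - b) ^ (m + n) * f j w = (w - b) ^ m * H w" if "w \<in> ball b (min r s) - {b}" for w
      using ns(3)[of w] that True by (simp add: power_add)
    ultimately show ?thesis by blast
  next
    case False
    then obtain F where F: "F holomorphic_on ball b r"
        "\<And>w. w \<in> ball b r - {b} \<Longrightarrow> (w - b) ^ m * f j w = F w"
      using mr(2) j by blast
    have "(\<lambda>w. (w - b) ^ n * F w) holomorphic_on ball b (min r s)"
      using F(1) by (intro holomorphic_intros) (auto elim: holomorphic_on_subset)
    moreover have "(w - b) ^ (m + n) * f j w = (w - b) ^ n * F w" if "w \<in> ball b (min r s) - {b}" for w
      using F(2)[of w] that by (simp add: power_add)
    ultimately show ?thesis by blast
  qed
  then show ?case
    using mr(1) ns(1) by (intro exI[of _ "m + n"] exI[of _ "min r s"]) auto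
qed

text \<open>A point on the hyperplane is the limit of its shifts along axis \<open>l\<close>, and
  every nonzero shift leaves the hyperplane.\<close>

lemma dense_hyperplane_complement:
  fixes U :: "(complex ^ 'n::finite) set"
  assumes "open U"
  shows "U \<subseteq> closure {z\<in>U. z $ l \<noteq> b}"
proof
  fix z assume z: "z \<in> U"
  show "z \<in> closure {z\<in>U. z $ l \<noteq> b}"
  proof (cases "z $ l = b")
    case False
    then show ?thesis
      using z by (intro subsetD[OF closure_subset]) simp
  next
    case True
    have "\<forall>\<^sub>F t in at 0. z + axis l t \<in> U"
      using eventually_axis[OF assms z, of l] unfolding eventually_at_filter by (rule eventually_mono) simp
    moreover have "\<forall>\<^sub>F t in at (0::complex). t \<noteq> 0"
      by (simp add: eventually_at_filter)
    ultimately have "\<forall>\<^sub>F t in at 0. z + axis l t \<in> closure {z\<in>U. z $ l \<noteq> b}"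
      by eventually_elim (intro subsetD[OF closure_subset], simp add: True axis_def)
    moreover have "((\<lambda>t. z + axis l t) \<longlongrightarrow> z + axis l 0) (at (0::complex))"
      by (intro tendsto_intros bounded_linear.tendsto[OF bounded_linear_axis])
    ultimately show ?thesis
      using Lim_in_closed_set[OF closed_closure] by (fastforce simp: axis_zero)
  qed
qed

lemma open_hyperplane_complement: "open {z :: complex ^ 'n::finite. z $ l \<noteq> b}"
  using open_vec_nth_vimage[of "- {b}" l] by (simp add: open_Compl)

text \<open>The normal form in one variable agrees with the one in several. Off a pole the function
  is holomorphic; at a pole both conventions give 0, because a holomorphic extension would be
  bounded near the point while \<open>f\<close> is not.\<close>

lemma regularize_vec_nth:
  fixes l :: "'n::finite"
  assumes "f nicely_meromorphic_on UNIV"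
  shows "regularize (\<lambda>z :: complex ^ 'n. f (z $ l)) z = f (z $ l)"
proof (cases "is_pole f (z $ l)")
  case False
  then have "f analytic_on {z $ l}"
    using nicely_meromorphic_on_imp_analytic_at[OF assms] by blast
  then obtain S where "open S" "z $ l \<in> S" "f holomorphic_on S"
    by (auto simp: analytic_at)
  then show ?thesis
    using regularize_holo[OF holo_on_vec_nth[of f S l]] by auto
next
  case True
  let ?f = "\<lambda>z :: complex ^ 'n. f (z $ l)"
  have "\<not> regular_value ?f z v" for v
  proof
    assume "regular_value ?f z v"
    then obtain N F where N: "open N" "z \<in> N" "holo_on F N" "generically_eq N ?f F"
      unfolding regular_value_def by blast
    \<comment> \<open>On \<open>M\<close> the values of \<open>F\<close> stay within 1 of
      \<open>F z\<close>, hence below the bound \<open>norm (F z) + 1\<close> that \<open>f\<close>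
      exceeds near its pole.\<close>
    define M where "M = N \<inter> F -` ball (F z) 1"
    have M: "open M" "z \<in> M" "\<And>w. w \<in> M \<Longrightarrow> dist (F w) (F z) < 1"
      using continuous_open_preimage[OF holo_on_imp_continuous_on[OF N(3)] N(1), of "ball (F z) 1"] N(2)
      by (auto simp: M_def dist_commute)
    have "\<forall>\<^sub>F t in at (z $ l). norm (F z) + 1 < norm (f t)"
      using True unfolding is_pole_def
      by (simp add: filterlim_at_infinity_conv_norm_at_top filterlim_at_top_dense)
    then obtain S where S: "open S" "z $ l \<in> S" "\<And>t. t \<in> S \<Longrightarrow> t \<noteq> z $ l \<Longrightarrow> norm (F z) + 1 < norm (f t)"
      unfolding eventually_at_topological by blast
    let ?U = "N \<inter> M \<inter> {w. w $ l \<in> S}" and ?A = "interior {w. f (w $ l) = F w}"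
    have U: "open ?U"
      using N(1) M(1) open_vec_nth_vimage[OF S(1)] by blast
    \<comment> \<open>A point is needed where the two functions agree and which avoids the polar
      hyperplane; such points are dense near \<open>z\<close>.\<close>
    have "?U \<subseteq> closure (?A \<inter> {w\<in>?U. w $ l \<noteq> z $ l})"
      using N(1,4) by (intro subset_closure_Int_open[OF U] dense_hyperplane_complement[OF U])
        (auto simp: generically_eq_open)
    moreover have "z \<in> ?U"
      using N(2) M(2) S(2) by simp
    ultimately have "?A \<inter> {w\<in>?U. w $ l \<noteq> z $ l} \<noteq> {}"
      by (metis (no_types, lifting) closure_empty empty_iff subsetD)
    then obtain w where w: "w \<in> ?A" "w \<in> ?U" "w $ l \<noteq> z $ l"
      by blast
    then have "f (w $ l) = F w"
      using interior_subset by blast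
    moreover have "norm (F z) + 1 < norm (f (w $ l))" "dist (F w) (F z) < 1"
      using w S(3) M(3) by auto
    ultimately show False
      using norm_triangle_ineq2[of "F w" "F z"] by (simp add: dist_norm)
  qed
  then have "regularize ?f z = 0"
    by (simp add: regularize_def)
  \<comment> \<open>A nicely meromorphic function either has a pole with value 0 or is continuous at
    the point, and continuity is incompatible with a pole.\<close>
  moreover have "f (z $ l) = 0"
    using assms True is_pole_def not_tendsto_and_filterlim_at_infinity[of "at (z $ l)" f "f (z $ l)"]
    unfolding nicely_meromorphic_on_def by auto
  ultimately show ?thesis by simp
qed

section \<open>The connections with given Christoffel symbols\<close>

text \<open>Differentiation commutes with translation, and the symbols are invariant. The two fields
  \<open>X\<close> and \<open>Y\<close> allow both a change of charts and the comparison along the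
  covering.\<close>

lemma (in translation_atlas) regularize_covariant_coeff_translate:
  assumes "\<And>j z. \<Gamma> j (z + g) = \<Gamma> j z" "open N" "w \<in> N" "\<And>u. u \<in> N \<Longrightarrow> Y (u + g) = X u"
  shows "regularize (covariant_coeff \<Gamma> Y i k) (w + g) = regularize (covariant_coeff \<Gamma> X i k) w"
proof -
  have "regularize (covariant_coeff \<Gamma> Y i k) (w + g) =
      regularize (\<lambda>z. covariant_coeff \<Gamma> Y i k (z + g)) w"
    by (rule regularize_translate[symmetric])
  also have "(\<lambda>z. covariant_coeff \<Gamma> Y i k (z + g)) = covariant_coeff \<Gamma> (\<lambda>u. Y (u + g)) i k"
    using pd_translate[of k "\<lambda>u. Y u $ i" g]
    by (simp add: covariant_coeff_def assms(1) fun_eq_iff)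
  also have "regularize (covariant_coeff \<Gamma> (\<lambda>u. Y (u + g)) i k) w = regularize (covariant_coeff \<Gamma> X i k) w"
    by (rule regularize_covariant_coeff_cong[OF assms(2,3)]) (rule assms(4))
  finally show ?thesis .
qed

text \<open>Index order: \<open>f j i k\<close> is the coefficient of \<open>dz_k\<close> tensor the
  \<open>i\<close>-th coordinate field in the image of the \<open>j\<close>-th one.\<close>

definition symbols ::
    "'n \<Rightarrow> ('n \<Rightarrow> 'n \<Rightarrow> 'n \<Rightarrow> complex \<Rightarrow> complex) \<Rightarrow> 'n \<Rightarrow> complex ^ 'n \<Rightarrow> complex ^ 'n ^ 'n" where
  "symbols l f j z = (\<chi> i k. f j i k (z $ l))"

text \<open>Used for the torus and, periodicity being trivial for \<open>G = {0}\<close>, for C^n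
  itself, so that a connection and its pullback are built from the same symbols.\<close>

locale periodic_symbols = translation_atlas A p G
  for A :: "('a, 'n::finite) atlas" and p :: "complex ^ 'n \<Rightarrow> 'a" and G :: "(complex ^ 'n) set" +
  fixes l :: 'n and f :: "'n \<Rightarrow> 'n \<Rightarrow> 'n \<Rightarrow> complex \<Rightarrow> complex"
  assumes nice: "f j i k nicely_meromorphic_on UNIV"
    and periodic: "g \<in> G \<Longrightarrow> f j i k (t + g $ l) = f j i k t"
begin

abbreviation \<Gamma> :: "'n \<Rightarrow> complex ^ 'n \<Rightarrow> complex ^ 'n ^ 'n" where
  "\<Gamma> \<equiv> symbols l f"

section \<open>The pole set and its divisor\<close>

definition poles :: "complex set" where
  "poles = {t. \<exists>j i k. is_pole (f j i k) t}"

lemma \<Gamma>_add: "g \<in> G \<Longrightarrow> \<Gamma> j (z + g) = \<Gamma> j z"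
  by (simp add: symbols_def periodic)

lemma poles_add:
  assumes "g \<in> G"
  shows "t + g $ l \<in> poles \<longleftrightarrow> t \<in> poles"
proof -
  have "is_pole (f j i k) (t + g $ l) \<longleftrightarrow> is_pole (f j i k) t" for j i k
  proof -
    have "is_pole (f j i k) (t + g $ l) \<longleftrightarrow> is_pole (\<lambda>x. f j i k (t + g $ l + x)) 0"
      by (rule is_pole_shift_0)
    also have "(\<lambda>x. f j i k (t + g $ l + x)) = (\<lambda>x. f j i k (t + x))"
      using periodic[OF assms] by (metis add.commute add.left_commute)
    also have "is_pole \<dots> 0 \<longleftrightarrow> is_pole (f j i k) t"
      by (rule is_pole_shift_0[symmetric])
    finally show ?thesis .
  qed
  then show ?thesis by (simp add: poles_def)
qed

lemma meromorphic: "f j i k meromorphic_on {t}"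
  using nice meromorphic_on_subset unfolding nicely_meromorphic_on_def by blast

text \<open>Each meromorphic function has isolated poles, and there are only finitely many index
  triples.\<close>

lemma eventually_not_poles: "\<forall>\<^sub>F t in at t0. t \<notin> poles"
proof -
  have "\<forall>\<^sub>F t in at t0. \<not> is_pole (f j i k) t" for j i k
    using meromorphic[of j i k t0] by (intro eventually_not_pole) (simp add: meromorphic_at_iff)
  then have "\<forall>\<^sub>F t in at t0. \<forall>j i k. \<not> is_pole (f j i k) t"
    by (intro eventually_all_finite)
  then show ?thesis
    by (simp add: poles_def)
qed

lemma open_Compl_poles: "open (- poles)"
proof (subst open_subopen, intro ballI)
  fix t assume t: "t \<in> - poles"
  obtain S where "open S" "t \<in> S" "\<And>u. u \<in> S \<Longrightarrow> u \<noteq> t \<Longrightarrow> u \<notin> poles"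
    using eventually_not_poles[of t] unfolding eventually_at_topological by blast
  then show "\<exists>T. open T \<and> t \<in> T \<and> T \<subseteq> - poles"
    using t by (intro exI[of _ S]) auto
qed

lemma open_off_poles: "open {z :: complex ^ 'n. z $ l \<notin> poles}"
  using open_vec_nth_vimage[OF open_Compl_poles] by simp

lemma holo_on_off_poles: "holo_on (\<lambda>z. f j i k (z $ l)) {z. z $ l \<notin> poles}"
proof -
  have "f j i k analytic_on - poles"
    using nicely_meromorphic_on_imp_analytic_at[OF nice]
    by (subst analytic_on_analytic_at) (auto simp: poles_def)
  then have "f j i k holomorphic_on - poles"
    by (rule analytic_imp_holomorphic)
  from holo_on_vec_nth[OF this open_Compl_poles, of l] show ?thesis by simp
qed

text \<open>
  The factor 2 makes the discs of the pole neighbourhoods disjoint, so that the nearby pole is unique.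
\<close>

definition near :: "complex \<Rightarrow> complex \<Rightarrow> bool" where
  "near t b \<longleftrightarrow> b \<in> poles \<and> (\<exists>s. dist t b < s \<and> (\<forall>b'\<in>poles - {b}. 2 * s \<le> dist b b'))"

lemma near_unique:
  assumes "near t b" "near t b'"
  shows "b = b'"
proof (rule ccontr)
  assume ne: "b \<noteq> b'"
  obtain s where s: "b \<in> poles" "dist t b < s" "\<And>c. c \<in> poles - {b} \<Longrightarrow> 2 * s \<le> dist b c"
    using assms(1) unfolding near_def by blast
  obtain s' where s': "b' \<in> poles" "dist t b' < s'" "\<And>c. c \<in> poles - {b'} \<Longrightarrow> 2 * s' \<le> dist b' c"
    using assms(2) unfolding near_def by blast
  have "2 * s \<le> dist b b'" "2 * s' \<le> dist b' b"
    using s(3)[of b'] s'(3)[of b] s(1) s'(1) ne by auto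
  then show False
    using s(2) s'(2) dist_triangle[of b b' t] by (simp add: dist_commute)
qed

lemma near_self:
  assumes "b \<in> poles"
  shows "near b b"
proof -
  obtain r where r: "0 < r" "\<And>t. t \<noteq> b \<Longrightarrow> dist t b < r \<Longrightarrow> t \<notin> poles"
    using eventually_not_poles[of b] unfolding eventually_at by blast
  \<comment> \<open>The radius \<open>r / 2\<close> absorbs the factor 2 in
    \<open>near\<close>.\<close>
  then have "\<forall>b'\<in>poles - {b}. 2 * (r / 2) \<le> dist b b'"
    by (metis DiffE dist_commute field_sum_of_halves insertI1 linorder_not_less mult_2)
  then show ?thesis
    using assms r(1) unfolding near_def by (intro conjI exI[of _ "r / 2"]) auto
qed

lemma open_near: "open {t. near t b}"
proof (subst open_subopen, intro ballI)
  fix t assume "t \<in> {t. near t b}"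
  then obtain s where s: "b \<in> poles" "dist t b < s" "\<forall>c\<in>poles - {b}. 2 * s \<le> dist b c"
    unfolding near_def by blast
  then show "\<exists>T. open T \<and> t \<in> T \<and> T \<subseteq> {t. near t b}"
    by (intro exI[of _ "ball b s"]) (auto simp: near_def dist_commute)
qed

lemma near_add:
  assumes g: "g \<in> G" and "near t b"
  shows "near (t + g $ l) (b + g $ l)"
proof -
  obtain s where s: "b \<in> poles" "dist t b < s" "\<And>c. c \<in> poles - {b} \<Longrightarrow> 2 * s \<le> dist b c"
    using assms(2) unfolding near_def by blast
  have "2 * s \<le> dist (b + g $ l) c" if "c \<in> poles - {b + g $ l}" for c
  proof -
    have "c - g $ l \<in> poles - {b}"
      using that poles_add[OF g, of "c - g $ l"] by auto
    from s(3)[OF this] show ?thesis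
      by (simp add: dist_norm algebra_simps)
  qed
  then show ?thesis
    using s poles_add[OF g] unfolding near_def by (intro conjI exI[of _ s]) auto
qed

definition W\<^sub>0 :: "'a set" where "W\<^sub>0 = p ` {z. z $ l \<notin> poles}"

definition W\<^sub>1 :: "'a set" where "W\<^sub>1 = p ` {z. \<exists>b. near (z $ l) b}"

text \<open>Translation by \<open>G\<close> moves the coordinate and its nearby pole by the same
  amount, so on \<open>W\<^sub>1\<close> the value is independent of the representative, see
  \<open>offset_eq\<close>.\<close>

definition offset :: "'a \<Rightarrow> complex" where
  "offset a = (let z = SOME z. p z = a in z $ l - (THE b. near (z $ l) b))"

text \<open>The polar hypersurfaces are taken with multiplicity one; higher pole orders are absorbed
  by the powers of the local equation allowed in \<open>mero_vforms\<close>.\<close>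

definition D :: "'a divisor" where
  "D = {(W\<^sub>0, \<lambda>_. 1), (W\<^sub>1, offset)}"

lemma mem_W\<^sub>0_iff: "p z \<in> W\<^sub>0 \<longleftrightarrow> z $ l \<notin> poles"
proof
  assume "p z \<in> W\<^sub>0"
  then obtain v where v: "v $ l \<notin> poles" "p z = p v" by (auto simp: W\<^sub>0_def)
  then show "z $ l \<notin> poles"
    using poles_add[of "v - z" "z $ l"] fibre_iff by simp
qed (auto simp: W\<^sub>0_def)

lemma mem_W\<^sub>1_iff: "p z \<in> W\<^sub>1 \<longleftrightarrow> (\<exists>b. near (z $ l) b)"
proof
  assume "p z \<in> W\<^sub>1"
  then obtain v b where v: "near (v $ l) b" "p v = p z" by (auto simp: W\<^sub>1_def)
  then show "\<exists>b. near (z $ l) b"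
    using near_add[of "z - v" "v $ l" b] fibre_iff by auto
qed (auto simp: W\<^sub>1_def)

lemma offset_eq:
  assumes "near (z $ l) b"
  shows "offset (p z) = z $ l - b"
proof -
  define v where "v = (SOME v. p v = p z)"
  have "p v = p z" unfolding v_def by (rule someI) (rule refl)
  then have "v - z \<in> G" using fibre_iff[of z v] by simp
  then have "near (z $ l + (v - z) $ l) (b + (v - z) $ l)"
    using assms by (rule near_add)
  then have n: "near (v $ l) (b + (v - z) $ l)" by simp
  then have "(THE c. near (v $ l) c) = b + (v - z) $ l"
    using near_unique by blast
  then show ?thesis
    by (simp add: offset_def v_def[symmetric])
qed

lemma openin_W\<^sub>0: "openin (manifold_topology A) W\<^sub>0"
proof -
  have "p -` W\<^sub>0 = {z. z $ l \<notin> poles}"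
    by (auto simp: mem_W\<^sub>0_iff)
  moreover have "W\<^sub>0 \<subseteq> range p"
    by (auto simp: W\<^sub>0_def)
  ultimately show ?thesis
    by (simp add: openin_iff open_off_poles)
qed

lemma open_near_vec: "open {z :: complex ^ 'n. near (z $ l) b}"
  using open_vec_nth_vimage[OF open_near] by simp

lemma openin_W\<^sub>1: "openin (manifold_topology A) W\<^sub>1"
proof -
  have "p -` W\<^sub>1 = (\<Union>b. {z. near (z $ l) b})"
    by (auto simp: mem_W\<^sub>1_iff)
  moreover have "W\<^sub>1 \<subseteq> range p"
    by (auto simp: W\<^sub>1_def)
  moreover have "open (\<Union>b. {z. near (z $ l) b})"
    by (intro open_UN ballI open_near_vec)
  ultimately show ?thesis
    by (simp only: openin_iff)
qed

lemma holo_fun_offset: "holo_fun A W\<^sub>1 offset"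
  unfolding holo_fun_iff
proof
  fix c assume c: "c \<in> A"
  show "holo_on (\<lambda>z. offset (p z)) (coords c W\<^sub>1)"
  proof (rule holo_on_local)
    show "open (coords c W\<^sub>1)" by (rule open_coords[OF openin_W\<^sub>1 c])
    fix z assume "z \<in> coords c W\<^sub>1"
    then obtain b where b: "near (z $ l) b" using c by (auto simp: coords_eq mem_W\<^sub>1_iff)
    have "holo_on (\<lambda>z. z $ l - b) {z. near (z $ l) b}"
      using holo_on_vec_nth[of "\<lambda>t. t - b" UNIV l] holo_on_subset[OF _ subset_UNIV open_near_vec]
      by (simp add: holomorphic_intros)
    then have "holo_on (\<lambda>z. offset (p z)) {z. near (z $ l) b}"
      by (rule holo_on_cong[rotated]) (simp add: offset_eq)
    then show "\<exists>N. open N \<and> z \<in> N \<and> holo_on (\<lambda>z. offset (p z)) N"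
      using b open_near_vec by blast
  qed
qed

lemma offset_nonzero:
  assumes "p z \<in> W\<^sub>0" "p z \<in> W\<^sub>1"
  shows "offset (p z) \<noteq> 0"
proof -
  obtain b where b: "near (z $ l) b" using assms(2) mem_W\<^sub>1_iff by blast
  then have "z $ l \<noteq> b" using assms(1) by (auto simp: mem_W\<^sub>0_iff near_def)
  then show ?thesis by (simp add: offset_eq[OF b])
qed

text \<open>On the overlap of the two patches \<open>offset\<close> has no zeros, so it and its
  inverse are the transition units. Near a pole, density of its nonvanishing locus is that of a
  hyperplane complement.\<close>

lemma effective_divisor_D: "effective_divisor A D"
  unfolding effective_divisor_def
proof (intro conjI)
  have "p z \<in> W\<^sub>0 \<union> W\<^sub>1" for z
    using near_self by (auto simp: mem_W\<^sub>0_iff mem_W\<^sub>1_iff)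
  moreover have "W\<^sub>0 \<subseteq> range p" "W\<^sub>1 \<subseteq> range p" by (auto simp: W\<^sub>0_def W\<^sub>1_def)
  ultimately show "(\<Union>(W, h)\<in>D. W) = carrier_of A"
    by (auto simp: D_def carrier_eq)
next
  have "holo_fun A W\<^sub>0 (\<lambda>_. 1)"
    using open_coords[OF openin_W\<^sub>0] by (simp add: holo_fun_iff holo_on_const)
  moreover have "coords c W\<^sub>0 \<subseteq> closure {z \<in> coords c W\<^sub>0. (1::complex) \<noteq> 0}" for c :: "('a, 'n) chart"
    using closure_subset[of "coords c W\<^sub>0"] by simp
  moreover have "coords c W\<^sub>1 \<subseteq> closure {z \<in> coords c W\<^sub>1. offset (snd c z) \<noteq> 0}" if c: "c \<in> A" for c
  proof
    fix z assume z: "z \<in> coords c W\<^sub>1"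
    then obtain b where b: "near (z $ l) b" using c by (auto simp: coords_eq mem_W\<^sub>1_iff)
    let ?N = "coords c W\<^sub>1 \<inter> {z. near (z $ l) b}"
    have "open ?N"
      using open_coords[OF openin_W\<^sub>1 c] open_near_vec by (rule open_Int)
    then have "z \<in> closure {w\<in>?N. w $ l \<noteq> b}"
      using dense_hyperplane_complement[of ?N l b] z b by blast
    also have "{w\<in>?N. w $ l \<noteq> b} \<subseteq> {z \<in> coords c W\<^sub>1. offset (snd c z) \<noteq> 0}"
      using c by (auto simp: chart_map offset_eq)
    then have "closure {w\<in>?N. w $ l \<noteq> b} \<subseteq> closure {z \<in> coords c W\<^sub>1. offset (snd c z) \<noteq> 0}"
      by (rule closure_mono)
    finally show "z \<in> closure {z \<in> coords c W\<^sub>1. offset (snd c z) \<noteq> 0}" .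
  qed
  ultimately show "\<forall>(W, h)\<in>D. openin (manifold_topology A) W \<and> holo_fun A W h \<and>
        (\<forall>c\<in>A. coords c W \<subseteq> closure {z \<in> coords c W. h (snd c z) \<noteq> 0})"
    using openin_W\<^sub>0 openin_W\<^sub>1 holo_fun_offset by (simp add: D_def)
next
  have one: "\<exists>u. holo_fun A W u \<and> (\<forall>x\<in>W. u x \<noteq> 0 \<and> h x = u x * h x)"
    if "openin (manifold_topology A) W" for W and h :: "'a \<Rightarrow> complex"
    using open_coords[OF that] by (intro exI[of _ "\<lambda>_. 1"]) (simp add: holo_fun_iff holo_on_const)
  let ?W = "W\<^sub>0 \<inter> W\<^sub>1"
  have sub: "coords c ?W \<subseteq> coords c W\<^sub>1" "open (coords c ?W)" if "c \<in> A" for c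
    using that open_coords[OF openin_Int[OF openin_W\<^sub>0 openin_W\<^sub>1]] by (auto simp: coords_def)
  have off: "holo_fun A ?W offset"
    using holo_fun_offset holo_on_subset[OF _ sub] unfolding holo_fun_iff by blast
  have nz: "offset x \<noteq> 0" if "x \<in> ?W" for x
    using that offset_nonzero by (auto simp: W\<^sub>0_def)
  have inv: "holo_fun A ?W (\<lambda>x. inverse (offset x))"
    using off unfolding holo_fun_iff
    by (intro ballI holo_on_inverse) (auto simp: coords_eq intro!: nz)
  have "\<exists>u. holo_fun A (W\<^sub>0 \<inter> W\<^sub>1) u \<and> (\<forall>x\<in>W\<^sub>0 \<inter> W\<^sub>1. u x \<noteq> 0 \<and> 1 = u x * offset x)"
    using inv nz by (intro exI[of _ "\<lambda>x. inverse (offset x)"]) simp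
  moreover have "\<exists>u. holo_fun A (W\<^sub>1 \<inter> W\<^sub>0) u \<and> (\<forall>x\<in>W\<^sub>1 \<inter> W\<^sub>0. u x \<noteq> 0 \<and> offset x = u x * 1)"
    using off nz by (intro exI[of _ offset]) (simp add: Int_commute)
  ultimately show "\<forall>(W, h)\<in>D. \<forall>(W', h')\<in>D. \<exists>u. holo_fun A (W \<inter> W') u \<and>
        (\<forall>x\<in>W \<inter> W'. u x \<noteq> 0 \<and> h x = u x * h' x)"
    using one[OF openin_W\<^sub>0, of "\<lambda>_. 1"] one[OF openin_W\<^sub>1, of offset] by (simp add: D_def)
qed

text \<open>One power of \<open>w $ l - z $ l\<close> clears all symbols, whether or not
  \<open>z $ l\<close> is a pole, and the derivative term is holomorphic by
  \<open>holo_on_pd\<close>. This gives both the quotient representation and the bound on the pole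
  order.\<close>

lemma covariant_coeff_local_form:
  assumes X: "\<And>i. holo_on (\<lambda>z. X z $ i) U" and z: "z \<in> U"
  obtains m N F where "open N" "z \<in> N" "N \<subseteq> U" "holo_on F N"
    "\<And>w. w \<in> N \<Longrightarrow> w $ l \<noteq> z $ l \<Longrightarrow> (w $ l - z $ l) ^ m * covariant_coeff \<Gamma> X i k w = F w"
proof -
  let ?b = "z $ l"
  obtain m r where mr: "0 < r" "\<And>j. \<exists>F. F holomorphic_on ball ?b r \<and>
      (\<forall>t\<in>ball ?b r - {?b}. (t - ?b) ^ m * f j i k t = F t)"
    using meromorphic_common_denominator[of UNIV "\<lambda>j. f j i k" ?b] meromorphic by auto
  then obtain F where F: "\<And>j. F j holomorphic_on ball ?b r"
      "\<And>j t. t \<in> ball ?b r - {?b} \<Longrightarrow> (t - ?b) ^ m * f j i k t = F j t"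
    by metis
  define N where "N = U \<inter> {w. w $ l \<in> ball ?b r}"
  have U: "open U" using X by (rule holo_on_open)
  have ballN: "open {w :: complex ^ 'n. w $ l \<in> ball ?b r}"
    by (rule open_vec_nth_vimage[OF open_ball])
  have N: "open N" "z \<in> N" "N \<subseteq> U"
    using U ballN mr(1) z by (auto simp: N_def)
  have XN: "holo_on (\<lambda>z. X z $ i) N" for i
    by (rule holo_on_subset[OF X N(3,1)])
  have FN: "holo_on (\<lambda>w. F j (w $ l)) N" for j
    by (rule holo_on_subset[OF holo_on_vec_nth[OF F(1) open_ball] _ N(1)]) (auto simp: N_def)
  have pol: "holo_on (\<lambda>w. (w $ l - ?b) ^ m) N"
    using holo_on_subset[OF holo_on_vec_nth[of "\<lambda>t. (t - ?b) ^ m" UNIV l] _ N(1)]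
    by (simp add: holomorphic_intros)
  define H where "H w = (w $ l - ?b) ^ m * pd k (\<lambda>u. X u $ i) w + (\<Sum>j\<in>UNIV. X w $ j * F j (w $ l))"
    for w
  have "holo_on H N"
    unfolding H_def
    by (intro holo_on_add holo_on_mult holo_on_sum N(1) pol holo_on_pd XN FN)
  moreover have "(w $ l - ?b) ^ m * covariant_coeff \<Gamma> X i k w = H w" if "w \<in> N" "w $ l \<noteq> ?b" for w
  proof -
    have "(w $ l - ?b) ^ m * f j i k (w $ l) = F j (w $ l)" for j
      using that by (intro F(2)) (simp add: N_def)
    then have eq: "(w $ l - ?b) ^ m * (X w $ j * f j i k (w $ l)) = X w $ j * F j (w $ l)" for j
      by (metis mult.left_commute)
    show ?thesis
      by (simp add: H_def covariant_coeff_def symbols_def distrib_left sum_distrib_left del: mult_cancel_left)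
        (rule sum.cong[OF refl eq])
  qed
  ultimately show ?thesis
    using that N by blast
qed

lemma holo_on_covariant_coeff:
  assumes X: "\<And>i. holo_on (\<lambda>z. X z $ i) U"
  shows "holo_on (covariant_coeff \<Gamma> X i k) (U \<inter> {z. z $ l \<notin> poles})"
proof -
  let ?N = "U \<inter> {z. z $ l \<notin> poles}"
  have N: "open ?N" using holo_on_open[OF X] open_off_poles by (rule open_Int)
  have XN: "holo_on (\<lambda>z. X z $ i) ?N" for i
    by (rule holo_on_subset[OF X inf_le1 N])
  have fN: "holo_on (\<lambda>z. f j i k (z $ l)) ?N" for j
    by (rule holo_on_subset[OF holo_on_off_poles inf_le2 N])
  show ?thesis
    unfolding covariant_coeff_def symbols_def
    by (simp, intro holo_on_add holo_on_sum holo_on_mult holo_on_pd XN fN N)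
qed

lemma local_quotient_covariant_coeff:
  assumes X: "\<And>i. holo_on (\<lambda>z. X z $ i) U" and z: "z \<in> U"
  shows "local_quotient (covariant_coeff \<Gamma> X i k) z"
proof -
  let ?h = "\<lambda>m w :: complex ^ 'n. (w $ l - z $ l) ^ m"
  obtain m N F where N: "open N" "z \<in> N" "N \<subseteq> U" "holo_on F N"
      "\<And>w. w \<in> N \<Longrightarrow> w $ l \<noteq> z $ l \<Longrightarrow> (w $ l - z $ l) ^ m * covariant_coeff \<Gamma> X i k w = F w"
    by (rule covariant_coeff_local_form[OF X z, of i k], rule that)
  have "holo_on (?h m) N"
    using holo_on_subset[OF holo_on_vec_nth[of "\<lambda>t. (t - z $ l) ^ m" UNIV l] _ N(1)]
    by (simp add: holomorphic_intros)
  moreover have "N \<subseteq> closure {w\<in>N. ?h m w \<noteq> 0}"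
  proof -
    have "closure {w\<in>N. w $ l \<noteq> z $ l} \<subseteq> closure {w\<in>N. ?h m w \<noteq> 0}"
      by (rule closure_mono) auto
    then show ?thesis
      using dense_hyperplane_complement[OF N(1), of l "z $ l"] by blast
  qed
  moreover have "generically_eq N (covariant_coeff \<Gamma> X i k) (\<lambda>w. F w / ?h m w)"
  proof (rule generically_eq_dense[OF N(1), of "{w. w $ l \<noteq> z $ l}"])
    show "N \<subseteq> closure {w. w $ l \<noteq> z $ l}"
      by (rule order_trans[OF dense_hyperplane_complement[OF N(1), of l "z $ l"] closure_mono]) auto
    fix w assume "w \<in> N" "w \<in> {w. w $ l \<noteq> z $ l}"
    then show "covariant_coeff \<Gamma> X i k w = F w / ?h m w"
      using N(5)[of w] by (simp add: field_simps)
  qed (rule open_hyperplane_complement)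
  ultimately show ?thesis
    unfolding local_quotient_def using N(1,2,4) by blast
qed

section \<open>Verification of the connection axioms\<close>

lemma connection_of_eq:
  assumes "openin (manifold_topology A) U" "X \<in> vector_fields A U"
  shows "connection_of A \<Gamma> U X = (\<lambda>c z. if c \<in> A \<and> z \<in> coords c U
    then \<chi> i k. regularize (covariant_coeff \<Gamma> (X c) i k) z else 0)"
  using assms by (simp add: connection_of_def)

lemma generically_eq_connection_of:
  assumes U: "openin (manifold_topology A) U" and X: "X \<in> vector_fields A U" and c: "c \<in> A"
  shows "generically_eq (coords c U) (\<lambda>z. connection_of A \<Gamma> U X c z $ i $ k) (covariant_coeff \<Gamma> (X c) i k)"
proof -
  note o = open_coords[OF U c]
  have "generically_eq (coords c U) (regularize (covariant_coeff \<Gamma> (X c) i k)) (covariant_coeff \<Gamma> (X c) i k)"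
    using local_quotient_covariant_coeff[OF vector_fieldsD(2)[OF X c]]
    by (intro generically_eq_regularize[OF o])
  then show ?thesis
    by (rule generically_eq_lift[OF o]) (simp add: connection_of_eq[OF U X] c)
qed

text \<open>A scheme for the axioms: they hold pointwise for the raw formula, represented by
  \<open>\<omega>'\<close>, and the regularized images are then inserted up to generic
  equality.\<close>

lemma vform_eq_connection_of:
  assumes U: "openin (manifold_topology A) U" and X: "X \<in> vector_fields A U"
    and eq: "\<And>c z i k. c \<in> A \<Longrightarrow> z \<in> coords c U \<Longrightarrow> covariant_coeff \<Gamma> (X c) i k z = \<omega>' c z $ i $ k"
    and \<omega>: "\<And>c i k. c \<in> A \<Longrightarrow>
      generically_eq (coords c U) (\<lambda>z. \<omega>' c z $ i $ k) (\<lambda>z. \<omega> c z $ i $ k)"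
  shows "vform_eq A U (connection_of A \<Gamma> U X) \<omega>"
  unfolding vform_eq_def
proof (intro ballI generically_eq_vecI)
  fix c i k assume c: "c \<in> A"
  show o: "open (coords c U)" "open (coords c U)" by (rule open_coords[OF U c])+
  have "generically_eq (coords c U) (covariant_coeff \<Gamma> (X c) i k) (\<lambda>z. \<omega>' c z $ i $ k)"
    by (intro generically_eqI o eq c)
  then show "generically_eq (coords c U) (\<lambda>z. connection_of A \<Gamma> U X c z $ i $ k) (\<lambda>z. \<omega> c z $ i $ k)"
    using generically_eq_connection_of[OF U X c] \<omega>[OF c] generically_eq_trans[OF o(1)] by blast
qed

lemma connection_of_vform:
  assumes U: "openin (manifold_topology A) U" and X: "X \<in> vector_fields A U"
  shows "connection_of A \<Gamma> U X \<in> mero_vforms A D U"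
  unfolding mero_vforms_def
proof (intro CollectI conjI allI impI ballI)
  note eq = connection_of_eq[OF U X]
  show "connection_of A \<Gamma> U X c z = 0" if "\<not> (c \<in> A \<and> z \<in> coords c U)" for c z
    unfolding eq by (simp only: that if_False)
  fix c i k assume c: "c \<in> A"
  note o = open_coords[OF U c] and XU = vector_fieldsD(2)[OF X c]
  have "mero_on (regularize (covariant_coeff \<Gamma> (X c) i k)) (coords c U)"
    by (intro mero_on_regularize o local_quotient_covariant_coeff[OF XU])
  then show "mero_on (\<lambda>z. connection_of A \<Gamma> U X c z $ i $ k) (coords c U)"
    by (rule mero_on_cong) (simp add: eq c)
  have gen: "generically_eq (coords c U) (\<lambda>z. connection_of A \<Gamma> U X c z $ i $ k)
      (covariant_coeff \<Gamma> (X c) i k)"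
    by (rule generically_eq_connection_of[OF U X c])
  have "\<exists>m N F. open N \<and> z \<in> N \<and> holo_on F N \<and>
      generically_eq N (\<lambda>w. h (snd c w) ^ m * connection_of A \<Gamma> U X c w $ i $ k) F"
    if D: "(W, h) \<in> D" and z: "z \<in> coords c (U \<inter> W)" for W h z
  proof (cases "z $ l \<in> poles")
    case False
    let ?N = "coords c U \<inter> {z. z $ l \<notin> poles}"
    have N: "open ?N" using o open_off_poles by (rule open_Int)
    \<comment> \<open>Off the poles the raw formula is already holomorphic, so exponent 0 works for
      either local equation.\<close>
    have "generically_eq ?N (\<lambda>w. h (snd c w) ^ 0 * connection_of A \<Gamma> U X c w $ i $ k)
        (covariant_coeff \<Gamma> (X c) i k)"
      using generically_eq_subset[OF gen o N inf_le1] by simp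
    moreover have "z \<in> ?N"
      using z False by (auto simp: coords_def)
    ultimately show ?thesis
      using N holo_on_covariant_coeff[OF XU] by blast
  next
    case True
    have zU: "z \<in> coords c U" and zW: "p z \<in> W" using z c by (auto simp: coords_eq)
    \<comment> \<open>A polar point does not lie in \<open>W\<^sub>0\<close>, which leaves only the
      second local equation.\<close>
    then have W: "h = offset"
      using D True by (auto simp: D_def mem_W\<^sub>0_iff)
    obtain m N F where N: "open N" "z \<in> N" "N \<subseteq> coords c U" "holo_on F N"
      "\<And>w. w \<in> N \<Longrightarrow> w $ l \<noteq> z $ l \<Longrightarrow> (w $ l - z $ l) ^ m * covariant_coeff \<Gamma> (X c) i k w = F w"
      by (rule covariant_coeff_local_form[OF XU zU, of i k], rule that)
    \<comment> \<open>Inside this set the nearby pole is \<open>z $ l\<close>, so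
      \<open>offset\<close> is exactly the base of the power in the local form.\<close>
    let ?N = "N \<inter> {w. near (w $ l) (z $ l)}"
    have oN: "open ?N" using N(1) open_near_vec by (rule open_Int)
    have zN: "z \<in> ?N" using N(2) near_self[OF True] by simp
    have "?N \<subseteq> closure {w. w $ l \<noteq> z $ l}"
      by (rule order_trans[OF dense_hyperplane_complement[OF oN, of l "z $ l"] closure_mono]) auto
    \<comment> \<open>Avoiding the polar hyperplane is phrased as a generic equation, so that the
      transfer principle can combine it with the removal of the regularization.\<close>
    then have "generically_eq ?N (\<lambda>w. w $ l \<noteq> z $ l) (\<lambda>w. True)"
      by (intro generically_eq_dense[OF oN open_hyperplane_complement]) auto
    moreover have "generically_eq ?N (\<lambda>z. connection_of A \<Gamma> U X c z $ i $ k) (covariant_coeff \<Gamma> (X c) i k)"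
      using N(3) by (intro generically_eq_subset[OF gen o oN]) blast
    ultimately have "generically_eq ?N (\<lambda>w. h (snd c w) ^ m * connection_of A \<Gamma> U X c w $ i $ k) F"
    proof (rule generically_eq_lift2[OF oN])
      fix w assume w: "w \<in> ?N" "(w $ l \<noteq> z $ l) = True"
        and "connection_of A \<Gamma> U X c w $ i $ k = covariant_coeff \<Gamma> (X c) i k w"
      then show "h (snd c w) ^ m * connection_of A \<Gamma> U X c w $ i $ k = F w"
        using N(5)[of w] c by (simp add: W chart_map offset_eq[of w "z $ l"])
    qed
    then show ?thesis
      using oN zN holo_on_subset[OF N(4) inf_le1 oN] by blast
  qed
  then show "case x of (W, h) \<Rightarrow> \<forall>z\<in>coords c (U \<inter> W). \<exists>m N F. open N \<and> z \<in> N \<and> holo_on F N \<and>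
      generically_eq N (\<lambda>w. h (snd c w) ^ m * connection_of A \<Gamma> U X c w $ i $ k) F" if "x \<in> D" for x
    using that by (cases x) blast
next
  show "vform_related A A id U (connection_of A \<Gamma> U X) (connection_of A \<Gamma> U X)"
  proof (rule vform_relatedI)
    fix b c w g assume *: "b \<in> A" "c \<in> A" "w \<in> coords b U" "g \<in> G" "w + g \<in> fst c"
    let ?N = "coords b U \<inter> {u. u + g \<in> fst c}"
    have "regularize (covariant_coeff \<Gamma> (X c) i k) (w + g) = regularize (covariant_coeff \<Gamma> (X b) i k) w"
      for i k
    proof (rule regularize_covariant_coeff_translate)
      show "open ?N" using open_coords[OF U *(1)] open_translate_chart[OF *(2)] by (rule open_Int)
      show "X c (u + g) = X b u" if "u \<in> ?N" for u
        using that * by (intro compatibleD[OF vector_fieldsD(3)[OF X]]) auto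
    qed (use * \<Gamma>_add in auto)
    then show "connection_of A \<Gamma> U X c (w + g) = connection_of A \<Gamma> U X b w"
      using * add_mem_coords[OF *] by (simp add: connection_of_eq[OF U X])
  qed (auto simp: chart_map intro: open_coords[OF U])
qed

lemma connection_of_restrict:
  assumes U: "openin (manifold_topology A) U" and W: "openin (manifold_topology A) W" "W \<subseteq> U"
    and X: "X \<in> vector_fields A U"
  shows "connection_of A \<Gamma> W (restrict_section A W X) = restrict_section A W (connection_of A \<Gamma> U X)"
proof (intro ext)
  fix c z
  show "connection_of A \<Gamma> W (restrict_section A W X) c z = restrict_section A W (connection_of A \<Gamma> U X) c z"
  proof (cases "c \<in> A \<and> z \<in> coords c W")
    case True
    then have c: "c \<in> A" and z: "z \<in> coords c W" by auto
    have "regularize (covariant_coeff \<Gamma> (restrict_section A W X c) i k) z =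
        regularize (covariant_coeff \<Gamma> (X c) i k) z" for i k
      by (rule regularize_covariant_coeff_cong[OF open_coords[OF W(1) c] z])
        (simp add: restrict_section_def c)
    moreover have "z \<in> coords c U" using z W(2) by (auto simp: coords_def)
    moreover have "restrict_section A W (connection_of A \<Gamma> U X) c z = connection_of A \<Gamma> U X c z"
      by (simp add: restrict_section_def c z)
    ultimately show ?thesis
      using c z by (simp add: connection_of_eq[OF U X] connection_of_eq[OF W(1) restrict_vector_field[OF X W]])
  next
    case False
    have "connection_of A \<Gamma> W (restrict_section A W X) c z = 0"
      unfolding connection_of_eq[OF W(1) restrict_vector_field[OF X W]] by (simp only: False if_False)
    moreover have "restrict_section A W (connection_of A \<Gamma> U X) c z = 0"
      unfolding restrict_section_def by (simp only: False if_False)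
    ultimately show ?thesis by simp
  qed
qed

lemma covariant_coeff_add:
  assumes "\<And>i. holo_on (\<lambda>z. X z $ i) U" "\<And>i. holo_on (\<lambda>z. Y z $ i) U" "z \<in> U"
  shows "covariant_coeff \<Gamma> (\<lambda>z. X z + Y z) i k z = covariant_coeff \<Gamma> X i k z + covariant_coeff \<Gamma> Y i k z"
  using pd_add[OF assms(1,2,3), of k i i]
  by (simp add: covariant_coeff_def distrib_right sum.distrib)

lemma covariant_coeff_scale:
  assumes "\<And>i. holo_on (\<lambda>z. X z $ i) U" "holo_on a U" "z \<in> U"
  shows "covariant_coeff \<Gamma> (\<lambda>z. a z *s X z) i k z =
    pd k a z * X z $ i + a z * covariant_coeff \<Gamma> X i k z"
  using pd_mult[OF assms(2) assms(1) assms(3), of k i]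
  by (simp add: covariant_coeff_def distrib_left sum_distrib_left mult.assoc)

lemma connection_of_mero_connection: "mero_connection A D (connection_of A \<Gamma>)"
  unfolding mero_connection_def
proof (intro conjI allI impI ballI)
  show "connection_of A \<Gamma> U X = undefined"
    if "\<not> (openin (manifold_topology A) U \<and> X \<in> vector_fields A U)" for U X
    unfolding connection_of_def by (simp only: that if_False)
next
  fix U assume U: "openin (manifold_topology A) U"
  show "connection_of A \<Gamma> U X \<in> mero_vforms A D U" if "X \<in> vector_fields A U" for X
    using U that by (rule connection_of_vform)
  show "connection_of A \<Gamma> W (restrict_section A W X) = restrict_section A W (connection_of A \<Gamma> U X)"
    if "openin (manifold_topology A) W \<and> W \<subseteq> U \<and> X \<in> vector_fields A U" for W X
    using U that by (intro connection_of_restrict) auto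
  fix X assume X: "X \<in> vector_fields A U"
  note XU = vector_fieldsD(2)[OF X]
  show "vform_eq A U (connection_of A \<Gamma> U (\<lambda>c z. X c z + Y c z))
      (\<lambda>c z. connection_of A \<Gamma> U X c z + connection_of A \<Gamma> U Y c z)" if Y: "Y \<in> vector_fields A U" for Y
  proof (rule vform_eq_connection_of[OF U add_vector_field[OF X Y]])
    fix c i k assume c: "c \<in> A"
    show "covariant_coeff \<Gamma> (\<lambda>z. X c z + Y c z) i k z =
        (\<chi> i k. covariant_coeff \<Gamma> (X c) i k z + covariant_coeff \<Gamma> (Y c) i k z) $ i $ k"
      if "z \<in> coords c U" for z
      using covariant_coeff_add[OF XU[OF c] vector_fieldsD(2)[OF Y c] that] by simp
    show "generically_eq (coords c U)
        (\<lambda>z. (\<chi> i k. covariant_coeff \<Gamma> (X c) i k z + covariant_coeff \<Gamma> (Y c) i k z) $ i $ k)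
        (\<lambda>z. (connection_of A \<Gamma> U X c z + connection_of A \<Gamma> U Y c z) $ i $ k)"
      by (rule generically_eq_lift2[OF open_coords[OF U c] generically_eq_connection_of[OF U X c, of i k]
          generically_eq_connection_of[OF U Y c, of i k]]) simp
  qed
  \<comment> \<open>Homogeneity over the scalars will be the case of a constant function, whose
    differential vanishes.\<close>
  have scale: "vform_eq A U (connection_of A \<Gamma> U (\<lambda>c z. a (snd c z) *s X c z))
      (\<lambda>c z. d_tensor a X c z + (\<chi> i k. a (snd c z) * connection_of A \<Gamma> U X c z $ i $ k))"
    if a: "holo_fun A U a" for a
  proof (rule vform_eq_connection_of[OF U scale_vector_field[OF X a]])
    fix c i k assume c: "c \<in> A"
    have ac: "holo_on (\<lambda>z. a (snd c z)) (coords c U)"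
      using a c by (simp add: holo_fun_def)
    show "covariant_coeff \<Gamma> (\<lambda>z. a (snd c z) *s X c z) i k z =
        (d_tensor a X c z + (\<chi> i k. a (snd c z) * covariant_coeff \<Gamma> (X c) i k z)) $ i $ k"
      if "z \<in> coords c U" for z
      using covariant_coeff_scale[OF XU[OF c] ac that] by (simp add: d_tensor_def)
    show "generically_eq (coords c U)
        (\<lambda>z. (d_tensor a X c z + (\<chi> i k. a (snd c z) * covariant_coeff \<Gamma> (X c) i k z)) $ i $ k)
        (\<lambda>z. (d_tensor a X c z + (\<chi> i k. a (snd c z) * connection_of A \<Gamma> U X c z $ i $ k)) $ i $ k)"
      by (rule generically_eq_lift[OF open_coords[OF U c] generically_eq_connection_of[OF U X c, of i k]]) simp
  qed
  show "vform_eq A U (connection_of A \<Gamma> U (\<lambda>c z. f (snd c z) *s X c z))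
      (\<lambda>c z. d_tensor f X c z + (\<chi> i k. f (snd c z) * connection_of A \<Gamma> U X c z $ i $ k))"
    if "holo_fun A U f" for f
    using that by (rule scale)
  show "vform_eq A U (connection_of A \<Gamma> U (\<lambda>c z. a *s X c z))
      (\<lambda>c z. \<chi> i k. a * connection_of A \<Gamma> U X c z $ i $ k)" for a
  proof -
    have "holo_fun A U (\<lambda>_. a)"
      using open_coords[OF U] by (simp add: holo_fun_iff holo_on_const)
    from scale[OF this] show ?thesis
      by (simp add: d_tensor_def pd_const zero_vec_def[symmetric])
  qed
qed

lemma connection_of_mero_affine: "connection_of A \<Gamma> \<in> mero_affine_connections A"
  unfolding mero_affine_connections_def
  using effective_divisor_D connection_of_mero_connection by blast

lemma regularize_\<Gamma>: "regularize (\<lambda>z. \<Gamma> j z $ i $ k) z = \<Gamma> j z $ i $ k"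
  by (simp add: symbols_def regularize_vec_nth[OF nice])

end

section \<open>The universal covering of a torus\<close>

lemma translation_atlas_std: "translation_atlas (std_atlas :: (complex ^ 'n::finite, 'n) atlas) id {0}"
  by unfold_locales (auto simp: std_atlas_def)

text \<open>The dual functionals of the basis take integer values on the lattice; where all of them
  are below 1 in absolute value, a lattice vector is 0.\<close>

lemma full_lattice_discrete:
  fixes G :: "'v::euclidean_space set"
  assumes "full_lattice G"
  shows "\<exists>U. open U \<and> 0 \<in> U \<and> (\<forall>g\<in>G \<inter> U. g = 0)"
proof -
  obtain B where B: "independent B" "G = {\<Sum>b\<in>B. of_int (k b) *\<^sub>R b | k :: 'v \<Rightarrow> int. True}"
    using assms unfolding full_lattice_def by blast
  have fin: "finite B" using B(1) by (rule finiteI_independent)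
  have "\<exists>h :: 'v \<Rightarrow> real. linear h \<and> (\<forall>x\<in>B. h x = (if x = b then 1 else 0))" for b
    using linear_independent_extend[OF B(1), of "\<lambda>x. if x = b then 1 else 0 :: real"] by blast
  then obtain h :: "'v \<Rightarrow> 'v \<Rightarrow> real" where h: "\<And>b. linear (h b)"
      "\<And>b x. x \<in> B \<Longrightarrow> h b x = (if x = b then 1 else 0)"
    by metis
  define U where "U = (\<Inter>b\<in>B. h b -` ball 0 1)"
  have "open U"
    unfolding U_def using fin h(1)
    by (intro open_INT ballI open_vimage open_ball linear_continuous_on)
      (simp_all add: linear_conv_bounded_linear)
  moreover have "0 \<in> U"
    by (simp add: U_def linear_0[OF h(1)])
  moreover have "g = 0" if g: "g \<in> G" "g \<in> U" for g
  proof -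
    obtain k :: "'v \<Rightarrow> int" where k: "g = (\<Sum>b\<in>B. of_int (k b) *\<^sub>R b)"
      using g(1) B(2) by blast
    have "k b = 0" if b: "b \<in> B" for b
    proof -
      have "h b g = (\<Sum>x\<in>B. of_int (k x) *\<^sub>R h b x)"
        unfolding k by (simp add: linear_sum[OF h(1)] linear_scale[OF h(1)])
      also have "\<dots> = of_int (k b)"
        using fin b by (simp add: h(2) if_distrib cong: if_cong)
      finally have "\<bar>real_of_int (k b)\<bar> < 1"
        using g(2) b by (auto simp: U_def)
      then show ?thesis by linarith
    qed
    then show ?thesis by (simp add: k)
  qed
  ultimately show ?thesis by blast
qed

lemma translation_atlas_quotient:
  fixes G :: "(complex ^ 'n::finite) set"
  assumes "full_lattice G"
  shows "translation_atlas (quotient_atlas G) (quot_proj G) G"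
proof
  fix z :: "complex ^ 'n"
  obtain U where U: "open U" "0 \<in> U" "\<And>g. g \<in> G \<Longrightarrow> g \<in> U \<Longrightarrow> g = 0"
    using full_lattice_discrete[OF assms] by blast
  then obtain e where e: "0 < e" "ball 0 e \<subseteq> U"
    using open_contains_ball by blast
  \<comment> \<open>Two points of a ball of radius \<open>e / 2\<close> differ by less than
    \<open>e\<close>, hence not by a nonzero lattice vector.\<close>
  have "inj_on (quot_proj G) (ball z (e / 2))"
  proof (rule inj_onI)
    fix x y assume xy: "x \<in> ball z (e / 2)" "y \<in> ball z (e / 2)" "quot_proj G x = quot_proj G y"
    have "dist x y < e"
      using xy dist_triangle3[of x y z] by simp
    then have "y - x \<in> U"
      using e(2) by (auto simp: subset_eq dist_norm norm_minus_commute)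
    then show "x = y"
      using U(3)[of "y - x"] xy(3) mem_quot_proj_iff[OF assms] by simp
  qed
  then show "\<exists>c\<in>quotient_atlas G. z \<in> fst c"
    using e(1) by (intro bexI[of _ "(ball z (e / 2), quot_proj G)"]) (auto simp: quotient_atlas_def)
qed (auto simp: quotient_atlas_def mem_quot_proj_iff[OF assms])

lemma (in translation_atlas) openin_image:
  assumes "open V"
  shows "openin (manifold_topology A) (p ` V)"
proof -
  have "p -` (p ` V) = (\<Union>g\<in>G. {z. z + g \<in> V})"
  proof (intro set_eqI iffI)
    fix z assume "z \<in> p -` (p ` V)"
    then obtain v where "v \<in> V" "p z = p v" by auto
    then show "z \<in> (\<Union>g\<in>G. {z. z + g \<in> V})"
      using fibre_iff by (intro UN_I[of "v - z"]) auto
  next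
    fix z assume "z \<in> (\<Union>g\<in>G. {z. z + g \<in> V})"
    then obtain g where "g \<in> G" "z + g \<in> V" by blast
    then show "z \<in> p -` (p ` V)"
      using p_add[of g z] by (metis imageI vimageI)
  qed
  moreover have "open {z. z + g \<in> V}" for g
    using open_vimage[OF assms, of "\<lambda>z. z + g"] by (simp add: vimage_def continuous_intros)
  ultimately show ?thesis
    by (auto simp: openin_iff)
qed

lemma (in translation_atlas) vfield_related_std_iff:
  "vfield_related std_atlas A p V X Y \<longleftrightarrow>
    (\<forall>b\<in>std_atlas. \<forall>c\<in>A. \<forall>w\<in>coords b V. \<forall>g\<in>G. w + g \<in> fst c \<longrightarrow> Y c (w + g) = X b w)"
  by (rule vfield_related_iff) (auto simp: std_atlas_def)

section \<open>The pullback to the universal covering\<close>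

context periodic_symbols
begin

lemma periodic_symbols_std: "periodic_symbols (std_atlas :: (complex ^ 'n, 'n) atlas) id {0} l f"
  by (intro periodic_symbols.intro translation_atlas_std periodic_symbols_axioms.intro) (auto simp: nice)

text \<open>The existence half: the same formula is evaluated on both sides, at points that differ
  by an element of \<open>G\<close>, under which the symbols are invariant.\<close>

lemma pullback_connection_related:
  assumes V: "open V" and X: "X \<in> vector_fields std_atlas V"
    and Y: "Y \<in> vector_fields A (p ` V)" and rel: "vfield_related std_atlas A p V X Y"
  shows "vform_related std_atlas A p V (connection_of std_atlas \<Gamma> V X) (connection_of A \<Gamma> (p ` V) Y)"
proof -
  interpret S: periodic_symbols "std_atlas :: (complex ^ 'n, 'n) atlas" id "{0}" l f
    by (rule periodic_symbols_std)
  have q: "p (snd b u) = p u" if "b \<in> std_atlas" for b :: "(complex ^ 'n, 'n) chart" and u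
    using that by (auto simp: std_atlas_def)
  have SV: "openin (manifold_topology std_atlas) V"
    using V by (simp add: S.openin_iff)
  show ?thesis
  proof (rule vform_relatedI[OF q])
    fix b :: "(complex ^ 'n, 'n) chart" and c w g
    assume *: "b \<in> std_atlas" "c \<in> A" "w \<in> coords b V" "g \<in> G" "w + g \<in> fst c"
    let ?N = "coords b V \<inter> {u. u + g \<in> fst c}"
    have "regularize (covariant_coeff \<Gamma> (Y c) i k) (w + g) = regularize (covariant_coeff \<Gamma> (X b) i k) w"
      for i k
    proof (rule regularize_covariant_coeff_translate)
      show "open ?N"
        using S.open_coords[OF SV *(1)] open_translate_chart[OF *(2)] by (rule open_Int)
      show "Y c (u + g) = X b u" if "u \<in> ?N" for u
        using rel * that unfolding vfield_related_std_iff by blast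
    qed (use * \<Gamma>_add in auto)
    moreover have "w + g \<in> coords c (p ` V)"
      using * by (auto simp: coords_eq p_add S.coords_eq)
    ultimately show "connection_of A \<Gamma> (p ` V) Y c (w + g) = connection_of std_atlas \<Gamma> V X b w"
      using * by (simp add: connection_of_eq[OF openin_image[OF V] Y] S.connection_of_eq[OF SV X])
  qed (auto intro: S.open_coords[OF SV])
qed

text \<open>A connection on C^n is determined by its symbols, so testing on coordinate fields
  suffices. They are restricted to a chart domain, where \<open>p\<close> is injective, and
  compatibility with restriction leads back to the global fields.\<close>

lemma pullback_connection_unique:
  assumes conn': "conn' \<in> mero_affine_connections std_atlas"
    and rel: "\<And>V X Y. open V \<Longrightarrow> inj_on p V \<Longrightarrow> X \<in> vector_fields std_atlas V \<Longrightarrow>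
      Y \<in> vector_fields A (p ` V) \<Longrightarrow> vfield_related std_atlas A p V X Y \<Longrightarrow>
      vform_related std_atlas A p V (conn' V X) (connection_of A \<Gamma> (p ` V) Y)"
  shows "conn' = connection_of std_atlas \<Gamma>"
proof -
  interpret S: periodic_symbols "std_atlas :: (complex ^ 'n, 'n) atlas" id "{0}" l f
    by (rule periodic_symbols_std)
  obtain D' where conn: "mero_connection std_atlas D' conn'"
    using conn' unfolding mero_affine_connections_def by blast
  have q: "p (snd b u) = p u" if "b \<in> std_atlas" for b :: "(complex ^ 'n, 'n) chart" and u
    using that by (auto simp: std_atlas_def)
  have "S.christoffel conn' j z = \<Gamma> j z" for j z
  proof -
    obtain c where c: "c \<in> A" "z \<in> fst c" using chart_cover by blast
    let ?V = "fst c"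
    let ?b = "(UNIV, id) :: (complex ^ 'n, 'n) chart"
    note V = chart_open[OF c(1)]
    have b: "?b \<in> std_atlas" by (simp add: std_atlas_def)
    have SV: "openin (manifold_topology std_atlas) ?V"
      using V by (simp add: S.openin_iff)
    note pV = openin_image[OF V]
    have pV': "p ` ?V \<subseteq> range p" by blast
    define X where "X = restrict_section std_atlas ?V (frame std_atlas j)"
    define Y where "Y = restrict_section A (p ` ?V) (frame A j)"
    have X: "X \<in> vector_fields std_atlas ?V"
      unfolding X_def by (rule S.restrict_vector_field[OF S.frame_vector_field SV]) simp
    have Y: "Y \<in> vector_fields A (p ` ?V)"
      unfolding Y_def by (rule restrict_vector_field[OF frame_vector_field pV pV'])
    have "Y d (w + g) = X a w" if "a \<in> std_atlas" "d \<in> A" "w \<in> coords a ?V" "g \<in> G" "w + g \<in> fst d"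
      for a d w g
    proof -
      have "w + g \<in> coords d (p ` ?V)" "w \<in> fst a"
        using that by (auto simp: coords_eq p_add S.coords_eq)
      then show ?thesis
        using that by (simp add: X_def Y_def restrict_section_def frame_def)
    qed
    then have "vfield_related std_atlas A p ?V X Y"
      unfolding vfield_related_std_iff by blast
    from rel[OF V chart_inj[OF c(1)] X Y this]
    have R: "vform_related std_atlas A p ?V (conn' ?V X) (connection_of A \<Gamma> (p ` ?V) Y)" .
    have zb: "z \<in> coords ?b ?V" using c(2) by (simp add: coords_def)
    have zc: "z \<in> coords c (p ` ?V)" using c by (simp add: coords_eq)
    \<comment> \<open>The covering relates \<open>z\<close> to itself by the translation 0; both
      sides are in normal form, so the generic relation holds at \<open>z\<close>.\<close>
    have "connection_of A \<Gamma> (p ` ?V) Y c (z + 0) = conn' ?V X ?b z"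
    proof (rule vform_relatedD[OF R b c(1) q[OF b] S.open_coords[OF SV b] zb zero_in_G])
      show "z + 0 \<in> fst c" using c(2) by simp
      fix i k
      show "conn' ?V X ?b z $ i $ k = regularize (\<lambda>z. conn' ?V X ?b z $ i $ k) z"
        using mero_vformsD(2)[OF mero_connectionD(1)[OF conn SV X] b] zb unfolding mero_on_def by blast
      have "connection_of A \<Gamma> (p ` ?V) Y c z $ i $ k =
          regularize (\<lambda>z. connection_of A \<Gamma> (p ` ?V) Y c z $ i $ k) z"
        using mero_vformsD(2)[OF connection_of_vform[OF pV Y] c(1)] zc unfolding mero_on_def by blast
      then show "connection_of A \<Gamma> (p ` ?V) Y c (z + 0) $ i $ k =
          regularize (\<lambda>z. connection_of A \<Gamma> (p ` ?V) Y c z $ i $ k) (z + 0)"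
        by simp
    qed
    moreover have "connection_of A \<Gamma> (p ` ?V) Y c z = \<Gamma> j z"
    proof -
      have "connection_of A \<Gamma> (p ` ?V) Y =
          restrict_section A (p ` ?V) (connection_of A \<Gamma> (range p) (frame A j))"
        unfolding Y_def by (rule connection_of_restrict[OF openin_range pV pV' frame_vector_field])
      then show ?thesis
        using c zc christoffel_connection_of[OF c, of \<Gamma> j] by (simp add: restrict_section_def regularize_\<Gamma>)
    qed
    moreover have "conn' ?V X ?b z = S.christoffel conn' j z"
    proof -
      have "conn' ?V X = restrict_section std_atlas ?V (conn' (range id) (frame std_atlas j))"
        unfolding X_def by (rule mero_connectionD(2)[OF conn S.openin_range SV _ S.frame_vector_field]) simp
      then show ?thesis
        using b zb S.christoffel_eq[OF conn b, of z j] by (simp add: restrict_section_def)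
    qed
    ultimately show ?thesis by simp
  qed
  then have "S.christoffel conn' = \<Gamma>" by (intro ext)
  then show ?thesis
    using S.connection_eq[OF conn] by simp
qed

lemma pullback_connection_of:
  "pullback_connection std_atlas A p (connection_of A \<Gamma>) = connection_of std_atlas \<Gamma>"
  unfolding pullback_connection_def
proof (rule the_equality)
  interpret S: periodic_symbols "std_atlas :: (complex ^ 'n, 'n) atlas" id "{0}" l f
    by (rule periodic_symbols_std)
  have op: "openin (manifold_topology (std_atlas :: (complex ^ 'n, 'n) atlas)) V \<longleftrightarrow> open V" for V
    by (simp add: S.openin_iff)
  show "connection_of std_atlas \<Gamma> \<in> mero_affine_connections std_atlas \<and>
    (\<forall>V X Y. openin (manifold_topology std_atlas) V \<and> inj_on p V \<and> X \<in> vector_fields std_atlas V \<and>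
      Y \<in> vector_fields A (p ` V) \<and> vfield_related std_atlas A p V X Y \<longrightarrow>
      vform_related std_atlas A p V (connection_of std_atlas \<Gamma> V X) (connection_of A \<Gamma> (p ` V) Y))"
    using S.connection_of_mero_affine pullback_connection_related unfolding op by blast
  fix conn'
  assume "conn' \<in> mero_affine_connections std_atlas \<and>
    (\<forall>V X Y. openin (manifold_topology std_atlas) V \<and> inj_on p V \<and> X \<in> vector_fields std_atlas V \<and>
      Y \<in> vector_fields A (p ` V) \<and> vfield_related std_atlas A p V X Y \<longrightarrow>
      vform_related std_atlas A p V (conn' V X) (connection_of A \<Gamma> (p ` V) Y))"
  then show "conn' = connection_of std_atlas \<Gamma>"
    unfolding op by (intro pullback_connection_unique) blast+
qed

lemma connection_coeff_pullback:
  "connection_coeff (pullback_connection std_atlas A p (connection_of A \<Gamma>)) k $ i $ j =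
    (\<lambda>z. f j i k (z $ l))"
proof
  fix z
  interpret S: periodic_symbols "std_atlas :: (complex ^ 'n, 'n) atlas" id "{0}" l f
    by (rule periodic_symbols_std)
  have "coord_frame j = frame (std_atlas :: (complex ^ 'n, 'n) atlas) j"
    by (auto simp: coord_frame_def frame_def std_atlas_def fun_eq_iff)
  moreover have "connection_of std_atlas \<Gamma> (range id) (frame std_atlas j) (UNIV, id) z = \<Gamma> j z"
    by (rule S.christoffel_connection_of) (simp_all add: std_atlas_def S.regularize_\<Gamma>)
  ultimately show "(connection_coeff (pullback_connection std_atlas A p (connection_of A \<Gamma>)) k $ i $ j) z =
      f j i k (z $ l)"
    by (simp add: pullback_connection_of connection_coeff_def symbols_def)
qed

end

text \<open>By invariance the symbol is a meromorphic function on the quotient, and surjectivity of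
  the pullback by \<open>\<pi>\<close> makes it a function on the elliptic curve.\<close>

lemma (in translation_atlas) christoffel_elliptic:
  assumes conn: "mero_connection A D conn" and red: "algebraic_reduction A \<Lambda> \<pi>"
    and \<Lambda>: "full_lattice \<Lambda>" and \<pi>: "\<And>z. \<pi> (p z) = quot_proj \<Lambda> (z $ l)"
  shows "\<exists>f\<in>elliptic_functions \<Lambda>. \<forall>z. christoffel conn j z $ i $ k = f (z $ l)"
proof -
  \<comment> \<open>The value 0 off the carrier is the convention of
    \<open>mero_functions\<close>.\<close>
  define F where "F x = (if x \<in> range p then christoffel conn j (SOME z. p z = x) $ i $ k else 0)" for x
  have F: "F (p z) = christoffel conn j z $ i $ k" for z
  proof -
    define v where "v = (SOME v. p v = p z)"
    have "p v = p z" unfolding v_def by (rule someI) (rule refl)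
    then have "z - v \<in> G" by (simp add: fibre_iff)
    from christoffel_invariant[OF conn this, of j v] show ?thesis
      by (simp add: F_def v_def[symmetric])
  qed
  have "F \<in> mero_functions A"
    unfolding mero_functions_def
  proof (intro CollectI conjI allI impI ballI)
    show "F x = 0" if "x \<notin> carrier_of A" for x
      using that by (simp add: F_def carrier_eq)
    fix c assume c: "c \<in> A"
    have "mero_on (\<lambda>z. christoffel conn j z $ i $ k) (fst c)"
      by (rule mero_on_subset[OF mero_on_christoffel[OF conn] subset_UNIV chart_open[OF c]])
    then show "mero_on (\<lambda>z. F (snd c z)) (fst c)"
      by (simp add: chart_map[OF c] F)
  qed
  then obtain h where h: "h \<in> elliptic_curve_functions \<Lambda>"
      "F = (\<lambda>x. if x \<in> carrier_of A then h (\<pi> x) else 0)"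
    using red unfolding algebraic_reduction_def bij_betw_def by blast
  have "(\<lambda>t. h (quot_proj \<Lambda> t)) \<in> elliptic_functions \<Lambda>"
  proof -
    have "quot_proj \<Lambda> (t + \<omega>) = quot_proj \<Lambda> t" if "\<omega> \<in> \<Lambda>" for t \<omega>
      using that mem_quot_proj_iff[OF \<Lambda>, of t "t + \<omega>"] by simp
    then show ?thesis
      using h(1) by (simp add: elliptic_functions_def elliptic_curve_functions_def)
  qed
  moreover have "christoffel conn j z $ i $ k = h (quot_proj \<Lambda> (z $ l))" for z
    using F[of z] by (simp add: h(2) carrier_eq \<pi>)
  ultimately show ?thesis
    by (intro bexI[of _ "\<lambda>t. h (quot_proj \<Lambda> t)"]) auto
qed

theorem theorem5p4:
  fixes G :: "(complex ^ 2) set" and \<Lambda>' :: "complex set"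
    and \<pi> :: "(complex ^ 2) set \<Rightarrow> complex set"
  assumes "two_torus G \<Lambda>' \<pi>"
    and "algebraic_reduction (quotient_atlas G) \<Lambda>' \<pi>"
    and "algebraic_dimension (quotient_atlas G) = 1"
  shows "bij_betw
    (\<lambda>conn. let conn' = pullback_connection std_atlas (quotient_atlas G) (quot_proj G) conn
          in (connection_coeff conn' 1, connection_coeff conn' 2))
    (mero_affine_connections (quotient_atlas G))
    {(f, g). \<forall>i j. f $ i $ j \<in> elliptic_functions_z1 \<Lambda>' \<and> g $ i $ j \<in> elliptic_functions_z1 \<Lambda>'}"
    (is "bij_betw ?\<Phi> ?M ?E")
proof -
  let ?A = "quotient_atlas G" and ?p = "quot_proj G"
  have G: "full_lattice G" and L: "full_lattice \<Lambda>'" and \<pi>: "\<And>z. \<pi> (?p z) = quot_proj \<Lambda>' (z $ 1)"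
    using assms(1) by (auto simp: two_torus_def)
  interpret Q: translation_atlas ?A ?p G
    by (rule translation_atlas_quotient[OF G])
  \<comment> \<open>The classes of 0 and \<open>g\<close> coincide; applying \<open>\<pi>\<close> to
    both places the first coordinate of \<open>g\<close> in \<open>\<Lambda>'\<close>.\<close>
  have GL: "g $ 1 \<in> \<Lambda>'" if "g \<in> G" for g
    using Q.p_add[OF that, of 0] \<pi>[of 0] \<pi>[of g] mem_quot_proj_iff[OF L, of 0 "g $ 1"] by simp
  define elliptic :: "(2 \<Rightarrow> 2 \<Rightarrow> 2 \<Rightarrow> complex \<Rightarrow> complex) \<Rightarrow> bool"
    where "elliptic f \<longleftrightarrow> (\<forall>j i k. f j i k \<in> elliptic_functions \<Lambda>')" for f
  have symbols: "periodic_symbols ?A ?p G 1 f" if "elliptic f" for f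
    using that GL unfolding elliptic_def elliptic_functions_def
    by (intro periodic_symbols.intro Q.translation_atlas_axioms periodic_symbols_axioms.intro) auto
  have coeff: "?\<Phi> (connection_of ?A (symbols 1 f)) =
      (\<chi> i j. (\<lambda>z. f j i 1 (z $ 1)), \<chi> i j. (\<lambda>z. f j i 2 (z $ 1)))" if "elliptic f" for f
    by (simp add: Let_def vec_eq_iff periodic_symbols.connection_coeff_pullback[OF symbols[OF that]])
  have mem: "connection_of ?A (symbols 1 f) \<in> ?M" if "elliptic f" for f
    by (rule periodic_symbols.connection_of_mero_affine[OF symbols[OF that]])
  \<comment> \<open>Here the algebraic reduction enters: every connection comes from elliptic
    symbols. Injectivity and the range of the map can then be read off from
    \<open>coeff\<close>.\<close>
  have ex: "\<exists>f. elliptic f \<and> conn = connection_of ?A (symbols 1 f)" if conn: "conn \<in> ?M" for conn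
  proof -
    obtain D where D: "mero_connection ?A D conn"
      using conn unfolding mero_affine_connections_def by blast
    have "\<exists>f. \<forall>j i k. f j i k \<in> elliptic_functions \<Lambda>' \<and> (\<forall>z. Q.christoffel conn j z $ i $ k = f j i k (z $ 1))"
      using Q.christoffel_elliptic[OF D assms(2) L \<pi>] by metis
    then obtain f where f: "elliptic f" "\<And>j i k z. Q.christoffel conn j z $ i $ k = f j i k (z $ 1)"
      unfolding elliptic_def by blast
    have "Q.christoffel conn = symbols 1 f"
      by (simp add: fun_eq_iff vec_eq_iff symbols_def f(2))
    then show ?thesis
      using f(1) Q.connection_eq[OF D] by auto
  qed
  show ?thesis
    unfolding bij_betw_def
  proof (intro conjI inj_onI subset_antisym subsetI)
    fix c d assume "c \<in> ?M" "d \<in> ?M" and eq: "?\<Phi> c = ?\<Phi> d"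
    then obtain f h where f: "elliptic f" "c = connection_of ?A (symbols 1 f)"
        and h: "elliptic h" "d = connection_of ?A (symbols 1 h)"
      using ex by blast
    \<comment> \<open>The two matrices hold the cases \<open>k = 1\<close> and \<open>k = 2\<close>,
      so together they determine all eight functions.\<close>
    have "f j i k (z $ 1) = h j i k (z $ 1)" for j i k and z :: "complex ^ 2"
      using eq exhaust_2[of k] unfolding f(2) h(2) coeff[OF f(1)] coeff[OF h(1)]
      by (auto simp: vec_eq_iff fun_eq_iff)
    then have "(symbols 1 f :: 2 \<Rightarrow> complex ^ 2 \<Rightarrow> _) = symbols 1 h"
      by (simp add: symbols_def fun_eq_iff)
    then show "c = d" by (simp add: f(2) h(2))
  next
    fix x assume "x \<in> ?\<Phi> ` ?M"
    then obtain f where "elliptic f" "x = ?\<Phi> (connection_of ?A (symbols 1 f))"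
      using ex by blast
    then show "x \<in> ?E"
      unfolding coeff[OF \<open>elliptic f\<close>] by (auto simp: elliptic_functions_z1_def elliptic_def)
  next
    fix x assume "x \<in> ?E"
    then obtain F H where x: "x = (F, H)"
        and FH: "\<And>i j. F $ i $ j \<in> elliptic_functions_z1 \<Lambda>'" "\<And>i j. H $ i $ j \<in> elliptic_functions_z1 \<Lambda>'"
      by auto
    have "\<exists>u. \<forall>i j. u i j \<in> elliptic_functions \<Lambda>' \<and> F $ i $ j = (\<lambda>z. u i j (z $ 1))"
      using FH(1) unfolding elliptic_functions_z1_def by (simp, metis)
    then obtain u where u: "\<And>i j. u i j \<in> elliptic_functions \<Lambda>'" "\<And>i j. F $ i $ j = (\<lambda>z. u i j (z $ 1))"
      by blast
    have "\<exists>v. \<forall>i j. v i j \<in> elliptic_functions \<Lambda>' \<and> H $ i $ j = (\<lambda>z. v i j (z $ 1))"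
      using FH(2) unfolding elliptic_functions_z1_def by (simp, metis)
    then obtain v where v: "\<And>i j. v i j \<in> elliptic_functions \<Lambda>'" "\<And>i j. H $ i $ j = (\<lambda>z. v i j (z $ 1))"
      by blast
    \<comment> \<open>The column \<open>j\<close> is the field to which the connection is applied,
      the row \<open>i\<close> the component of its image, and \<open>k\<close> selects the
      matrix.\<close>
    define f where "f j i k = (if k = 1 then u i j else v i j)" for j i k :: 2
    have f: "elliptic f" using u(1) v(1) by (simp add: elliptic_def f_def)
    have "x = ?\<Phi> (connection_of ?A (symbols 1 f))"
      unfolding coeff[OF f] x by (simp add: vec_eq_iff u(2) v(2) f_def)
    then show "x \<in> ?\<Phi> ` ?M"
      using mem[OF f] by blast
  qed
qed

end
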